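(* Let $\mathbb{D}_2((\hbar_1))((\hbar_2))$ be the Dunkl--Weyl algebra, i.e. $C^\infty(\mathbb{R}^2)^{\mathbb{Z}_2}((\hbar_1))((\hbar_2))$ with the star product described in the context. Then $[1]\neq 0$ in $HH_0(\mathbb{D}_2((\hbar_1))((\hbar_2)))$. Let $\phi$ denote the unique $\mathbb{C}((\hbar_1))((\hbar_2))$-linear trace on $\mathbb{D}_2((\hbar_1))((\hbar_2))$ such that $\phi(1)=1$. Then $$\phi(f)=\sum_{k=0}^{\infty}\frac{(i\hbar_1)^k}{(k!)^2}\left(\prod_{l=1}^{k}\left\{\frac{l}{2}+(-1)^{l+1}\frac{2\lfloor\frac{l+1}{2}\rfloor\hbar_2}{l+1}\right\}\right)\frac{\partial^{2k}f}{\partial z^k\partial\bar z^k}(0,0)$$ for any $f(z,\bar z)\in C^\infty(\mathbb{R}^2)^{\mathbb{Z}_2}\subset \mathbb{D}_2((\hbar_1))((\hbar_2))$.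
   Context: Let $\mathbb{Z}_2=\{1,\gamma\}$, with $\gamma$ acting on $\mathbb{C}\langle x,y\rangle$ (that is, on $x$ and $y$) and on $\mathbb{R}^2$ by multiplication by $-1$. Let $\mathcal{R}$ be the quotient of $\mathbb{C}\langle x,y\rangle((\hbar_1))((\hbar_2))\rtimes\mathbb{Z}_2$ by the relation $[y,x]=\frac{\hbar_1(1+2\hbar_2\gamma)}{2}$. There is a vector space isomorphism between $\mathbb{C}[x,y]\rtimes\mathbb{Z}_2((\hbar_1))((\hbar_2))$ and $\mathcal{R}$ identifying the commutative monomial $x^ay^b$ with the image in $\mathcal{R}$ of the noncommutative monomial $x^ay^b$. Let $\mathbf{e}=\frac{1+\gamma}{2}$ and $\mathcal{D}_2((\hbar_1))((\hbar_2))=\mathbb{C}[x,y]^{\mathbb{Z}_2}((\hbar_1))((\hbar_2))$. The map $f\mapsto f\,\mathbf{e}$ is an isomorphism of $\mathbb{C}((\hbar_1))((\hbar_2))$-modules from $\mathcal{D}_2((\hbar_1))((\hbar_2))$ to the spherical subalgebra $\mathbf{e}\mathcal{R}\mathbf{e}$, so the product of $\mathcal{R}$ induces a star product on $\mathcal{D}_2((\hbar_1))((\hbar_2))$. Halbout and Tang showed, by exhibiting an explicit Moyal-type formula for this product, that it induces a star product on $C^\infty(\mathbb{R}^2)^{\mathbb{Z}_2}((\hbar_1))((\hbar_2))$; $\mathbb{D}_2((\hbar_1))((\hbar_2))$ denotes the resulting algebra. Put $z=x+iy$, $\bar z=x-iy$, where $i=\sqrt{-1}$. The algebra $\mathbb{D}_2((\hbar_1))((\hbar_2))$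 is a bornological algebra with its canonical bornology, and the tensor powers used to define its Hochschild chains, and hence its Hochschild homology $HH_\bullet$, are bornological. One has $HH_0(\mathbb{D}_2((\hbar_1))((\hbar_2)))\cong\mathbb{C}((\hbar_1))((\hbar_2))$, so that the trace is unique up to a scalar. A trace is a linear functional vanishing on commutators. For a real number $r$, $\lfloor r\rfloor$ denotes the greatest integer $\le r$.
   Formalization: With f put into the algebra by x,y-ordering the formula fails: f = x²+y² has trace 0, but the formula gives iħ1(1/2+ħ2). So f(z,z̄) is read with z^a z̄^b as ordered products in R, applied to the Taylor expansion at 0; any element with the resulting expansion is allowed. *)

theory Defs
  imports
    "HOL-Analysis.Analysis"
    "HOL-Library.Poly_Mapping"
    "HOL-Computational_Algebra.Formal_Laurent_Series"
begin

section \<open>Even smooth functions on the plane\<close>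

type_synonym plane_fun = "real \<times> real \<Rightarrow> complex"

definition pdx :: "plane_fun \<Rightarrow> plane_fun" where
  "pdx f = (\<lambda>(x, y). vector_derivative (\<lambda>t. f (t, y)) (at x))"

definition pdy :: "plane_fun \<Rightarrow> plane_fun" where
  "pdy f = (\<lambda>(x, y). vector_derivative (\<lambda>t. f (x, t)) (at y))"

primrec Ck :: "nat \<Rightarrow> plane_fun \<Rightarrow> bool" where
  "Ck 0 f \<longleftrightarrow> continuous_on UNIV f"
| "Ck (Suc k) f \<longleftrightarrow> (\<forall>p. f differentiable (at p)) \<and> Ck k (pdx f) \<and> Ck k (pdy f)"

definition smooth :: "plane_fun \<Rightarrow> bool" where
  "smooth f \<longleftrightarrow> (\<forall>k. Ck k f)"

definition partial :: "nat \<Rightarrow> nat \<Rightarrow> plane_fun \<Rightarrow> plane_fun" where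
  "partial i j f = (pdx ^^ i) ((pdy ^^ j) f)"

definition dz :: "plane_fun \<Rightarrow> plane_fun" where
  "dz f = (\<lambda>p. (pdx f p - \<i> * pdy f p) / 2)"

definition dzbar :: "plane_fun \<Rightarrow> plane_fun" where
  "dzbar f = (\<lambda>p. (pdx f p + \<i> * pdy f p) / 2)"

lemma differentiable_sections:
  fixes f :: plane_fun
  assumes "f differentiable (at (x, y))"
  shows "(\<lambda>t. f (t, y)) differentiable (at x)" "(\<lambda>t. f (x, t)) differentiable (at y)"
proof -
  have 1: "(\<lambda>t. (t, y)) differentiable (at x)" and 2: "(\<lambda>t. (x, t)) differentiable (at y)"
    by (auto simp: differentiable_def intro!: exI derivative_eq_intros)
  show "(\<lambda>t. f (t, y)) differentiable (at x)"
    using differentiable_chain_at[OF 1, of f] assms by (simp add: o_def)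
  show "(\<lambda>t. f (x, t)) differentiable (at y)"
    using differentiable_chain_at[OF 2, of f] assms by (simp add: o_def)
qed

lemma has_vector_derivative_sections:
  fixes f :: plane_fun
  assumes "f differentiable (at (x, y))"
  shows "((\<lambda>t. f (t, y)) has_vector_derivative pdx f (x, y)) (at x)"
    and "((\<lambda>t. f (x, t)) has_vector_derivative pdy f (x, y)) (at y)"
  using differentiable_sections[OF assms] by (auto simp: pdx_def pdy_def vector_derivative_works)

lemma pdx_eqI: "(\<And>x y. ((\<lambda>t. f (t, y)) has_vector_derivative g (x, y)) (at x)) \<Longrightarrow> pdx f = g"
  by (auto simp: pdx_def fun_eq_iff vector_derivative_at)

lemma pdy_eqI: "(\<And>x y. ((\<lambda>t. f (x, t)) has_vector_derivative g (x, y)) (at y)) \<Longrightarrow> pdy f = g"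
  by (auto simp: pdy_def fun_eq_iff vector_derivative_at)

lemma pd_const: "pdx (\<lambda>p. c) = (\<lambda>p. 0)" "pdy (\<lambda>p. c) = (\<lambda>p. 0)"
  by (auto intro!: pdx_eqI pdy_eqI derivative_eq_intros)

lemma pd_add:
  assumes "\<forall>p. f differentiable (at p)" "\<forall>p. g differentiable (at p)"
  shows "pdx (\<lambda>p. f p + g p) = (\<lambda>p. pdx f p + pdx g p)"
    and "pdy (\<lambda>p. f p + g p) = (\<lambda>p. pdy f p + pdy g p)"
  by (auto intro!: pdx_eqI pdy_eqI has_vector_derivative_add has_vector_derivative_sections
      simp: assms)

lemma pd_mult:
  assumes "\<forall>p. f differentiable (at p)" "\<forall>p. g differentiable (at p)"
  shows "pdx (\<lambda>p. f p * g p) = (\<lambda>p. f p * pdx g p + pdx f p * g p)"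
    and "pdy (\<lambda>p. f p * g p) = (\<lambda>p. f p * pdy g p + pdy f p * g p)"
  by (auto intro!: pdx_eqI pdy_eqI has_vector_derivative_mult has_vector_derivative_sections
      simp: assms)

lemma Ck_const: "Ck k (\<lambda>p. c)"
  by (induction k arbitrary: c) (auto simp: pd_const)

lemma Ck_add: "Ck k f \<Longrightarrow> Ck k g \<Longrightarrow> Ck k (\<lambda>p. f p + g p)"
  by (induction k arbitrary: f g) (auto simp: pd_add intro: continuous_on_add)

lemma Ck_Suc_imp: "Ck (Suc k) f \<Longrightarrow> Ck k f"
proof (induction k arbitrary: f)
  case 0
  then show ?case
    by (auto intro!: differentiable_imp_continuous_on differentiable_at_imp_differentiable_on)
next
  case (Suc k)
  then show ?case by (metis Ck.simps(2))
qed

lemma Ck_mult: "Ck k f \<Longrightarrow> Ck k g \<Longrightarrow> Ck k (\<lambda>p. f p * g p)"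
proof (induction k arbitrary: f g)
  case 0
  then show ?case by (auto intro: continuous_on_mult)
next
  case (Suc k)
  note fg = Suc.prems(1)[THEN Ck_Suc_imp] Suc.prems(2)[THEN Ck_Suc_imp]
  show ?case
    using Suc.prems fg by (auto simp: pd_mult intro!: Ck_add Suc.IH)
qed

typedef even_smooth = "{f :: plane_fun. smooth f \<and> (\<forall>p. f (- p) = f p)}"
  morphisms es_fun Abs_even_smooth
  by (rule exI[of _ "\<lambda>p. 0"]) (auto simp: smooth_def Ck_const)

setup_lifting type_definition_even_smooth

instantiation even_smooth :: comm_ring_1
begin

lift_definition zero_even_smooth :: even_smooth is "\<lambda>p. 0"
  by (auto simp: smooth_def Ck_const)

lift_definition one_even_smooth :: even_smooth is "\<lambda>p. 1"
  by (auto simp: smooth_def Ck_const)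

lift_definition plus_even_smooth :: "even_smooth \<Rightarrow> even_smooth \<Rightarrow> even_smooth"
  is "\<lambda>f g p. f p + g p"
  by (auto simp: smooth_def Ck_add)

lift_definition times_even_smooth :: "even_smooth \<Rightarrow> even_smooth \<Rightarrow> even_smooth"
  is "\<lambda>f g p. f p * g p"
  by (auto simp: smooth_def Ck_mult)

lift_definition uminus_even_smooth :: "even_smooth \<Rightarrow> even_smooth"
  is "\<lambda>f p. - f p"
  using Ck_mult[OF Ck_const[of _ "- 1"]] by (auto simp: smooth_def)

lift_definition minus_even_smooth :: "even_smooth \<Rightarrow> even_smooth \<Rightarrow> even_smooth"
  is "\<lambda>f g p. f p - g p"
  using Ck_add[OF _ Ck_mult[OF Ck_const[of _ "- 1"]]] by (auto simp: smooth_def)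

instance
  by standard (transfer; force simp: algebra_simps fun_eq_iff)+

end

lift_definition es_const :: "complex \<Rightarrow> even_smooth" is "\<lambda>c p. c"
  by (auto simp: smooth_def Ck_const)


section \<open>Iterated Laurent series\<close>

notation fls_nth (infixl "$$" 75)

text \<open>\<open>'a fls fls\<close> is \<open>'a((\<hbar>1))((\<hbar>2))\<close>: \<open>F $$ n $$ m\<close> is the coefficient of \<open>\<hbar>1^m \<hbar>2^n\<close>.\<close>

abbreviation hbar1 :: "'a :: {zero,one} fls fls" where
  "hbar1 \<equiv> fls_const fls_X"

abbreviation hbar2 :: "'a :: {zero,one} fls fls" where
  "hbar2 \<equiv> fls_X"

definition const2 :: "'a :: zero \<Rightarrow> 'a fls fls" where
  "const2 a = fls_const (fls_const a)"

text \<open>Coefficientwise application, meaningful for maps that send 0 to 0.\<close>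

definition map2 :: "('a :: zero \<Rightarrow> 'b :: zero) \<Rightarrow> 'a fls fls \<Rightarrow> 'b fls fls" where
  "map2 h F = Abs_fls (\<lambda>n. Abs_fls (\<lambda>m. h (F $$ n $$ m)))"

lemma map2_nth:
  fixes h :: "'a :: zero \<Rightarrow> 'b :: zero"
  assumes "h 0 = 0"
  shows "map2 h F $$ n $$ m = h (F $$ n $$ m)"
proof -
  have inner: "Abs_fls (\<lambda>m. h (f $$ m)) $$ m = h (f $$ m)" for f :: "'a fls" and m
    by (rule nth_Abs_fls_lower_bound[of "fls_subdegree f"]) (simp add: assms)
  have zero: "Abs_fls (\<lambda>m. 0 :: 'b) = 0"
    by (simp add: zero_fls_def)
  have "map2 h F $$ n = Abs_fls (\<lambda>m. h (F $$ n $$ m))"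
    unfolding map2_def
    by (rule nth_Abs_fls_lower_bound[of "fls_subdegree F"]) (simp add: assms zero)
  then show ?thesis by (simp add: inner)
qed

text \<open>A series of elements of \<open>\<complex>((\<hbar>1))((\<hbar>2))\<close>, summed coefficientwise.\<close>

definition formal_sums :: "(nat \<Rightarrow> complex fls fls) \<Rightarrow> complex fls fls \<Rightarrow> bool" where
  "formal_sums t s \<longleftrightarrow> (\<forall>n m. (\<lambda>k. t k $$ n $$ m) sums (s $$ n $$ m))"


section \<open>The algebra \<open>\<R>\<close>\<close>

datatype gen = GenX | GenY

datatype word = Word (letters: "gen list")

instantiation word :: monoid_add
begin

definition zero_word :: word where "0 = Word []"

definition plus_word :: "word \<Rightarrow> word \<Rightarrow> word" where
  "u + v = Word (letters u @ letters v)"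

instance
  by standard (auto simp: zero_word_def plus_word_def)

end

text \<open>The free algebra on x and y, as the monoid algebra of the free monoid.\<close>

type_synonym free_alg = "word \<Rightarrow>\<^sub>0 complex"

definition gen :: "gen \<Rightarrow> free_alg" where
  "gen g = Poly_Mapping.single (Word [g]) 1"

definition scalar :: "complex \<Rightarrow> free_alg" where
  "scalar c = Poly_Mapping.single 0 c"

definition gamma_act :: "free_alg \<Rightarrow> free_alg" where
  "gamma_act = Poly_Mapping.mapp (\<lambda>w c. (- 1) ^ length (letters w) * c)"

text \<open>The crossed product with \<open>\<int>\<^sub>2\<close>: the pair \<open>(a, b)\<close> is \<open>a + b \<gamma>\<close>.\<close>

type_synonym crossed = "free_alg fls fls \<times> free_alg fls fls"

fun crossed_mult :: "crossed \<Rightarrow> crossed \<Rightarrow> crossed"  (infixl "\<odot>" 70) where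
  "(a, b) \<odot> (c, d) = (a * c + b * map2 gamma_act d, a * d + b * map2 gamma_act c)"

text \<open>\<open>[y, x] - \<hbar>1 (1 + 2 \<hbar>2 \<gamma>) / 2\<close>\<close>

definition relator :: crossed where
  "relator =
     (const2 (gen GenY * gen GenX - gen GenX * gen GenY) - const2 (scalar (1/2)) * hbar1,
      - (hbar1 * hbar2))"

text \<open>The two-sided ideal generated by the relator, and equality in the quotient \<open>\<R>\<close>.\<close>

inductive_set relator_ideal :: "crossed set" where
  gen: "a \<odot> relator \<odot> b \<in> relator_ideal"
| add: "u \<in> relator_ideal \<Longrightarrow> v \<in> relator_ideal \<Longrightarrow> u + v \<in> relator_ideal"

definition eq_R :: "crossed \<Rightarrow> crossed \<Rightarrow> bool"  (infix "\<doteq>" 50) where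
  "u \<doteq> v \<longleftrightarrow> u - v \<in> relator_ideal"

definition idem :: crossed where
  "idem = (const2 (scalar (1/2)), const2 (scalar (1/2)))"

definition spherical :: "free_alg fls fls \<Rightarrow> crossed" where
  "spherical a = (a, 0) \<odot> idem"


section \<open>The Dunkl--Weyl algebra\<close>

text \<open>Commutative polynomials in two variables; the key \<open>(a, b)\<close> is the exponent pair.\<close>

type_synonym poly2 = "(nat \<times> nat) \<Rightarrow>\<^sub>0 complex"

definition eval2 :: "poly2 \<Rightarrow> complex \<Rightarrow> complex \<Rightarrow> complex" where
  "eval2 p u v = (\<Sum>k\<in>Poly_Mapping.keys p. Poly_Mapping.lookup p k * u ^ fst k * v ^ snd k)"

definition even_poly :: "poly2 \<Rightarrow> bool" where
  "even_poly p \<longleftrightarrow> (\<forall>k\<in>Poly_Mapping.keys p. even (fst k + snd k))"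

text \<open>The commutative monomial \<open>u^a v^b\<close> goes to the noncommutative monomial \<open>u^a v^b\<close>.\<close>

definition ordered :: "free_alg \<Rightarrow> free_alg \<Rightarrow> poly2 \<Rightarrow> free_alg" where
  "ordered u v p =
     (\<Sum>k\<in>Poly_Mapping.keys p. scalar (Poly_Mapping.lookup p k) * u ^ fst k * v ^ snd k)"

type_synonym dunkl = "even_smooth fls fls"

definition poly_xy :: "poly2 \<Rightarrow> plane_fun" where
  "poly_xy p = (\<lambda>(x, y). eval2 p (of_real x) (of_real y))"

text \<open>The inclusion of \<open>\<complex>[x,y]\<^sup>Z2((\<hbar>1))((\<hbar>2))\<close> in \<open>C\<^sup>\<infinity>(\<real>\<^sup>2)\<^sup>Z2((\<hbar>1))((\<hbar>2))\<close>, and the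
  isomorphism \<open>f \<mapsto> f e\<close> of the former with the spherical subalgebra of \<open>\<R>\<close>.\<close>

definition even_series :: "poly2 fls fls \<Rightarrow> bool" where
  "even_series h \<longleftrightarrow> (\<forall>n m. even_poly (h $$ n $$ m))"

definition series_fun :: "poly2 fls fls \<Rightarrow> dunkl" where
  "series_fun = map2 (\<lambda>p. Abs_even_smooth (poly_xy p))"

definition series_spherical :: "poly2 fls fls \<Rightarrow> crossed" where
  "series_spherical h = spherical (map2 (ordered (gen GenX) (gen GenY)) h)"

text \<open>The von Neumann bornology of the Frechet space of even smooth functions, and the bornology
  that it induces on iterated Laurent series (an inductive limit of products at each step).\<close>

definition es_bounded :: "even_smooth set \<Rightarrow> bool" where
  "es_bounded S \<longleftrightarrow>
     (\<forall>K i j. compact K \<longrightarrow> bounded {partial i j (es_fun f) p | f p. f \<in> S \<and> p \<in> K})"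

definition dunkl_bounded :: "dunkl set \<Rightarrow> bool" where
  "dunkl_bounded S \<longleftrightarrow>
     (\<exists>N. \<forall>F\<in>S. \<forall>n<N. F $$ n = 0) \<and>
     (\<forall>n. \<exists>M. \<forall>F\<in>S. \<forall>m<M. F $$ n $$ m = 0) \<and>
     (\<forall>n m. es_bounded ((\<lambda>F. F $$ n $$ m) ` S))"

text \<open>The product in \<open>smult\<close> is the commutative one.\<close>

definition smult :: "complex fls fls \<Rightarrow> dunkl \<Rightarrow> dunkl" where
  "smult c F = map2 es_const c * F"

text \<open>The Dunkl--Weyl product: the extension of the product of \<open>\<R>\<close> to smooth coefficients. It is
  bilinear over \<open>\<complex>((\<hbar>1))((\<hbar>2))\<close> and bounded, and agrees with the product of \<open>\<R>\<close> on even
  polynomials. These properties determine it: boundedness makes it compatible with convergent series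
  in \<open>\<hbar>1\<close>, \<open>\<hbar>2\<close> and with limits of polynomials, and polynomials are dense in the smooth functions.
  Rewriting a product of two polynomials in normal order is a finite process, so no completion
  of the ideal generated by the relator is involved.\<close>

definition dunkl_weyl_product :: "(dunkl \<Rightarrow> dunkl \<Rightarrow> dunkl) \<Rightarrow> bool" where
  "dunkl_weyl_product star \<longleftrightarrow>
     (\<forall>F G H. star (F + G) H = star F H + star G H \<and> star H (F + G) = star H F + star H G) \<and>
     (\<forall>c F G. star (smult c F) G = smult c (star F G) \<and> star F (smult c G) = smult c (star F G)) \<and>
     (\<forall>S T. dunkl_bounded S \<longrightarrow> dunkl_bounded T \<longrightarrow> dunkl_bounded {star F G | F G. F \<in> S \<and> G \<in> T}) \<and>
     (\<forall>f g. even_poly f \<longrightarrow> even_poly g \<longrightarrow>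
        (\<exists>h. even_series h \<and>
             series_spherical (const2 f) \<odot> series_spherical (const2 g) \<doteq> series_spherical h \<and>
             star (series_fun (const2 f)) (series_fun (const2 g)) = series_fun h))"


section \<open>Hochschild homology in degree 0, and traces\<close>

text \<open>The image of \<open>b\<close> on the completed bornological tensor square. The elements of that tensor
  square are the sums \<open>\<Sum>i. c i (a i \<otimes> a' i)\<close> with \<open>c\<close> absolutely summable and \<open>a\<close>, \<open>a'\<close> bounded
  sequences, and \<open>b (a \<otimes> a') = a a' - a' a\<close>. The resulting series in the algebra converges
  bornologically, so its sum is found pointwise. Tensoring over the ground ring
  \<open>\<complex>((\<hbar>1))((\<hbar>2))\<close> instead of \<open>\<complex>\<close> is a quotient, and yields the same image.\<close>

definition hochschild_boundaries :: "(dunkl \<Rightarrow> dunkl \<Rightarrow> dunkl) \<Rightarrow> dunkl set" where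
  "hochschild_boundaries star =
     {F. \<exists>(c :: nat \<Rightarrow> complex) a a'.
        summable (\<lambda>i. norm (c i)) \<and> dunkl_bounded (range a) \<and> dunkl_bounded (range a') \<and>
        (\<forall>n m p. (\<lambda>i. c i * es_fun ((star (a i) (a' i) - star (a' i) (a i)) $$ n $$ m) p)
                   sums es_fun (F $$ n $$ m) p)}"

definition HH0_class :: "(dunkl \<Rightarrow> dunkl \<Rightarrow> dunkl) \<Rightarrow> dunkl \<Rightarrow> dunkl set" where
  "HH0_class star F = {G. G - F \<in> hochschild_boundaries star}"

definition is_trace :: "(dunkl \<Rightarrow> dunkl \<Rightarrow> dunkl) \<Rightarrow> (dunkl \<Rightarrow> complex fls fls) \<Rightarrow> bool" where
  "is_trace star \<phi> \<longleftrightarrow>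
     (\<forall>F G. \<phi> (F + G) = \<phi> F + \<phi> G) \<and>
     (\<forall>c F. \<phi> (smult c F) = c * \<phi> F) \<and>
     (\<forall>F G. \<phi> (star F G - star G F) = 0)"


section \<open>Functions of \<open>z\<close> and \<open>zbar\<close> as elements of the algebra\<close>

definition poly_zz :: "poly2 \<Rightarrow> plane_fun" where
  "poly_zz p = (\<lambda>(x, y). eval2 p (of_real x + \<i> * of_real y) (of_real x - \<i> * of_real y))"

definition gen_z :: free_alg where
  "gen_z = gen GenX + scalar \<i> * gen GenY"

definition gen_zbar :: free_alg where
  "gen_zbar = gen GenX - scalar \<i> * gen GenY"

text \<open>\<open>represents f F\<close>: the element F of the algebra is \<open>f(z, zbar)\<close> with the monomials
  \<open>z^a zbar^b\<close> read as products in \<open>\<R>\<close>. The order of the factors matters. For instance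
  \<open>z zbar = x\<^sup>2 + y\<^sup>2 + \<i> [y, x]\<close> in \<open>\<R>\<close>, so the function \<open>z zbar\<close> is represented by
  \<open>x\<^sup>2 + y\<^sup>2 + \<i> \<hbar>1 (1 + 2 \<hbar>2) / 2\<close>, while every trace vanishes on \<open>x\<^sup>2 + y\<^sup>2\<close>: for example
  \<open>x\<^sup>2 \<star> xy - xy \<star> x\<^sup>2 = - \<hbar>1 x\<^sup>2\<close>.

  For a smooth f the substitution is made on the Taylor expansion at the origin. With \<open>\<hbar>1\<close> counted
  as having degree 2 all terms of the normal ordering of a monomial have the degree of the monomial,
  so the expansion of F to order N depends only on the expansion of f to order N.
  By Borel's theorem every even smooth f is represented by some F, which is unique up to functions
  that are flat at the origin; for a polynomial f the element obtained by
  the actual substitution is one such F.\<close>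

definition represents :: "even_smooth \<Rightarrow> dunkl \<Rightarrow> bool" where
  "represents f F \<longleftrightarrow>
     (\<forall>N. \<exists>p h. even_poly p \<and> even_series h \<and>
        (\<forall>i j. i + j \<le> N \<longrightarrow> partial i j (poly_zz p) (0, 0) = partial i j (es_fun f) (0, 0)) \<and>
        spherical (const2 (ordered gen_z gen_zbar p)) \<doteq> series_spherical h \<and>
        (\<forall>n m i j. int i + int j + 2 * m \<le> int N \<longrightarrow>
           partial i j (es_fun (F $$ n $$ m)) (0, 0) =
           partial i j (es_fun (series_fun h $$ n $$ m)) (0, 0)))"

end

theory Submission
  imports Defs
begin

text \<open>
The left module \<open>\<R> e\<close> is realised on the commutative monomials, with \<open>y\<close> acting as a deformed
derivative. This gives normal forms, so the star product of two even polynomials can be computed.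
With \<open>x^a y^b\<close> sent to 0 for \<open>a \<noteq> b\<close> and \<open>x^k y^k\<close> to \<open>(- \<hbar>1/2)^k \<Prod>l=1..k. rr l\<close>, where
\<open>rr l\<close> is the factor in the formula of the theorem, cyclicity with
respect to \<open>y\<^sup>2\<close>, \<open>x\<^sup>2\<close> and \<open>x y + y x\<close> implies cyclicity for all even words. The elements \<open>zbar, z\<close>
satisfy the relation of \<open>y, x\<close> with \<open>\<hbar>1\<close> replaced by \<open>- 2 \<i> \<hbar>1\<close>, hence the formula of the theorem on
polynomials ordered in \<open>z\<close>, \<open>zbar\<close>. Bounded functionals are determined by their values on even
polynomials, because these are dense and because boundedness forces adic continuity; this
carries the trace property over to smooth coefficients.

Uniqueness: the commutators with \<open>x\<^sup>2\<close> and \<open>y\<^sup>2\<close> start with \<open>\<hbar>1 x \<partial>\<^sub>y\<close> and \<open>\<hbar>1 y \<partial>\<^sub>x\<close>, and by Hadamard's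
lemma every even function is its value at 0 plus \<open>x \<partial>\<^sub>y g + y \<partial>\<^sub>x h\<close>. Solving recursively in \<open>\<hbar>1\<close>
writes each element as \<open>c 1\<close> plus two commutators. Finally, the trace may be applied termwise to
the series that define boundaries, so 1 is not a boundary.
\<close>

subsection \<open>Iterated Laurent series\<close>

text \<open>A product of even polynomials is known only through some \<open>h\<close> that agrees
  with it modulo the ideal of the relator, so it has to be read off by functionals that vanish on
  this ideal; the coefficients of the action on e are such functionals. The ideal is generated over
  Laurent series with noncommutative polynomials of unbounded degree as coefficients. The
  functionals are therefore extended exponent by exponent, with finite sums because normal ordering
  creates only nonnegative powers of \<open>hbar1\<close> and \<open>hbar2\<close>. The factor
  \<open>rr\<close> is forced: if x^a y^b goes to 0 for a \<noteq> b, cyclicity of y^2 against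
  x^(k+2) y^k relates the values on x^(k+1) y^(k+1) and x^k y^k. The step with x^2 must give the
  same ratio, which is the identity \<open>dd_Suc\<close>. Up to scaling x^2, y^2 and xy + yx span a
  copy of sl2; they suffice because xy and yx differ from half of xy + yx by a multiple of [y, x],
  which acts as a scalar on the even elements of R e. The trace is defined by x, y normal forms, and
  no change of basis to z, zbar is computed: the values on z^a zbar^b follow from cyclicity and the
  value 1 at the unit.\<close>

lemma fls2_eqI:
  fixes F G :: "'a::zero fls fls"
  shows "(\<And>n m. F $$ n $$ m = G $$ n $$ m) \<Longrightarrow> F = G"
  by (intro fls_eqI) auto

text \<open>The summation range depends only on the bounds \<open>A\<close>, \<open>B\<close>,
  \<open>N\<close>, so that coefficients of several products can be compared and sums
  interchanged.\<close>

lemma fls_times_nth_box: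
  fixes f g :: "'a::semiring_0 fls"
  assumes "\<And>i. i < A \<Longrightarrow> f $$ i = 0" "\<And>i. i < B \<Longrightarrow> g $$ i = 0" "n \<le> N"
  shows "(f * g) $$ n = (\<Sum>i=A..N-B. f $$ i * g $$ (n - i))"
proof (cases "f = 0 \<or> g = 0")
  case False
  then have "A \<le> fls_subdegree f" "B \<le> fls_subdegree g"
    using assms by (auto intro: fls_subdegree_geI)
  then show ?thesis
    unfolding fls_times_nth(2) using assms(3)
    by (intro sum.mono_neutral_left) (auto simp: not_le)
qed auto

lemma fls_sum_nth: "(\<Sum>x\<in>X. f x) $$ n = (\<Sum>x\<in>X. f x $$ n)"
  for f :: "_ \<Rightarrow> 'a::comm_monoid_add fls"
  by (induction X rule: infinite_finite_induct) auto

text \<open>The bound on the exponents of \<open>hbar1\<close> covers only the rows up to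
  \<open>n\<close>: in an iterated Laurent series these exponents may become arbitrarily negative as
  the power of \<open>hbar2\<close> grows.\<close>

definition lower_box :: "int \<Rightarrow> int \<Rightarrow> int \<Rightarrow> 'a::zero fls fls \<Rightarrow> bool" where
  "lower_box A M n F \<longleftrightarrow> (\<forall>i<A. F $$ i = 0) \<and> (\<forall>i\<le>n. \<forall>j<M. F $$ i $$ j = 0)"

lemma lower_boxD:
  "lower_box A M n F \<Longrightarrow> i < A \<Longrightarrow> F $$ i = 0"
  "lower_box A M n F \<Longrightarrow> i \<le> n \<Longrightarrow> j < M \<Longrightarrow> F $$ i $$ j = 0"
  by (auto simp: lower_box_def)

lemma lower_box_mono: "lower_box A M n F \<Longrightarrow> A' \<le> A \<Longrightarrow> M' \<le> M \<Longrightarrow> n' \<le> n \<Longrightarrow> lower_box A' M' n' F"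
  by (auto simp: lower_box_def)

lemma lower_box_exists: "\<exists>A M. lower_box A M n F"
proof -
  define M where "M = Min (insert 0 ((\<lambda>i. fls_subdegree (F $$ i)) ` {fls_subdegree F..n}))"
  have "F $$ i $$ j = 0" if "i \<le> n" "j < M" for i j
  proof (cases "i < fls_subdegree F")
    case False
    then have "M \<le> fls_subdegree (F $$ i)"
      unfolding M_def using that by (intro Min_le) auto
    then show ?thesis using that by auto
  qed auto
  then show ?thesis
    unfolding lower_box_def by (intro exI[of _ "fls_subdegree F"] exI[of _ M]) auto
qed

lemma fls2_times_nth_box:
  fixes F G :: "'a::semiring_0 fls fls"
  assumes F: "lower_box A M (n - B) F" and G: "lower_box B M' (n - A) G"
    and "i \<le> n" "j \<le> m"
  shows "(F * G) $$ i $$ j =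
    (\<Sum>i1=A..n-B. \<Sum>j1=M..m-M'. F $$ i1 $$ j1 * G $$ (i - i1) $$ (j - j1))"
proof -
  have "(F * G) $$ i = (\<Sum>i1=A..n-B. F $$ i1 * G $$ (i - i1))"
    using lower_boxD(1)[OF F] lower_boxD(1)[OF G] assms(3) by (rule fls_times_nth_box)
  moreover have "(F $$ i1 * G $$ (i - i1)) $$ j =
      (\<Sum>j1=M..m-M'. F $$ i1 $$ j1 * G $$ (i - i1) $$ (j - j1))" if "i1 \<in> {A..n-B}" for i1
    using that assms by (intro fls_times_nth_box) (auto intro: lower_boxD)
  ultimately show ?thesis
    by (simp add: fls_sum_nth)
qed

section \<open>Coefficientwise extension of functionals to iterated Laurent series\<close>

definition fls2_of :: "(int \<Rightarrow> int \<Rightarrow> 'a) \<Rightarrow> 'a::zero fls fls" where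
  "fls2_of a = Abs_fls (\<lambda>n. Abs_fls (\<lambda>m. a n m))"

lemma fls2_of_nth:
  assumes "\<And>n m. n < A \<Longrightarrow> a n m = 0" "\<And>n. \<exists>M. \<forall>m<M. a n m = 0"
  shows "fls2_of a $$ n $$ m = a n m"
proof -
  have inner: "Abs_fls (a n) $$ m = a n m" for n m
    using assms(2)[of n] nth_Abs_fls_lower_bound by metis
  have "Abs_fls (a n) = 0" if "n < A" for n
    using assms(1)[OF that] inner by (intro fls_eqI) simp
  then have "fls2_of a $$ n = Abs_fls (\<lambda>m. a n m)"
    unfolding fls2_of_def by (intro nth_Abs_fls_lower_bound[of A]) auto
  then show ?thesis by (simp add: inner)
qed

text \<open>\<open>\<nu> a\<close> is the array of coefficients of a value in C((hbar1))((hbar2)).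
  Nonnegativity of its exponents makes the extension to series a finite sum at each exponent. The
  instances are the coefficients of normal forms and the trace on smooth functions.\<close>

locale coeff_functional =
  fixes \<nu> :: "'v::ring_1 \<Rightarrow> int \<Rightarrow> int \<Rightarrow> complex"
  assumes add: "\<nu> (a + b) n m = \<nu> a n m + \<nu> b n m"
    and nonneg: "n < 0 \<or> m < 0 \<Longrightarrow> \<nu> a n m = 0"
begin

lemma zero [simp]: "\<nu> 0 n m = 0"
  using add[of 0 0 n m] by simp

lemma sum: "\<nu> (\<Sum>x\<in>X. f x) n m = (\<Sum>x\<in>X. \<nu> (f x) n m)"
  by (induction X rule: infinite_finite_induct) (auto simp: add)

text \<open>The sum is finite: only the rows from \<open>fls_subdegree F\<close> to \<open>n\<close>
  contribute, and each of them is bounded below in \<open>hbar1\<close>.\<close>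

definition ext :: "'v fls fls \<Rightarrow> complex fls fls" where
  "ext F = fls2_of (\<lambda>n m. \<Sum>(i,j)\<in>{(i,j). i \<le> n \<and> j \<le> m \<and> F $$ i $$ j \<noteq> 0}. \<nu> (F $$ i $$ j) (n - i) (m - j))"

lemma ext_box:
  assumes "lower_box A M n F" "n \<le> n'" "m \<le> m'"
  shows "ext F $$ n $$ m = (\<Sum>i=A..n'. \<Sum>j=M..m'. \<nu> (F $$ i $$ j) (n - i) (m - j))"
proof -
  let ?a = "\<lambda>n m. \<Sum>(i,j)\<in>{(i,j). i \<le> n \<and> j \<le> m \<and> F $$ i $$ j \<noteq> 0}. \<nu> (F $$ i $$ j) (n - i) (m - j)"
  have *: "ext F $$ n $$ m = ?a n m"
    unfolding ext_def
  proof (rule fls2_of_nth[of "fls_subdegree F"])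
    fix n m assume "n < fls_subdegree F"
    then have e: "{(i,j). i \<le> n \<and> j \<le> m \<and> F $$ i $$ j \<noteq> 0} = {}" by auto
    show "?a n m = 0" by (subst e) simp
  next
    fix n
    obtain A M where B: "lower_box A M n F" using lower_box_exists by blast
    have "?a n m = 0" if "m < M" for m
    proof -
      have e: "{(i,j). i \<le> n \<and> j \<le> m \<and> F $$ i $$ j \<noteq> 0} = {}"
        using lower_boxD(2)[OF B] that by fastforce
      show ?thesis by (subst e) simp
    qed
    then show "\<exists>M. \<forall>m<M. ?a n m = 0" by blast
  qed
  have "?a n m = (\<Sum>(i,j)\<in>{A..n'}\<times>{M..m'}. \<nu> (F $$ i $$ j) (n - i) (m - j))"
  proof (intro sum.mono_neutral_left ballI)
    show "{(i,j). i \<le> n \<and> j \<le> m \<and> F $$ i $$ j \<noteq> 0} \<subseteq> {A..n'}\<times>{M..m'}"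
      using lower_boxD[OF assms(1)] assms(2,3) by (force simp: not_less[symmetric])
    fix x assume "x \<in> {A..n'} \<times> {M..m'} - {(i,j). i \<le> n \<and> j \<le> m \<and> F $$ i $$ j \<noteq> 0}"
    then show "(case x of (i,j) \<Rightarrow> \<nu> (F $$ i $$ j) (n - i) (m - j)) = 0"
      using nonneg by (cases x) (auto simp: not_le)
  qed auto
  then show ?thesis
    by (simp add: * sum.cartesian_product)
qed

lemma ext_eq0: "lower_box A M n F \<Longrightarrow> n < A \<or> m < M \<Longrightarrow> ext F $$ n $$ m = 0"
  using ext_box[of A M n F n m m] by auto

lemma ext_add: "ext (F + G) = ext F + ext G"
proof (rule fls2_eqI)
  fix n m
  obtain A M A' M' where B: "lower_box A M n F" "lower_box A' M' n G"
    using lower_box_exists by metis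
  then have B': "lower_box (min A A') (min M M') n F" "lower_box (min A A') (min M M') n G"
    by (auto elim: lower_box_mono)
  then have "lower_box (min A A') (min M M') n (F + G)"
    by (auto simp: lower_box_def)
  from ext_box[OF this order.refl order.refl] B'[THEN ext_box[OF _ order.refl order.refl]]
  show "ext (F + G) $$ n $$ m = (ext F + ext G) $$ n $$ m"
    by (simp add: sum.distrib add)
qed

lemma ext_zero [simp]: "ext 0 = 0"
  using ext_add[of 0 0] by simp

lemma ext_uminus: "ext (- F) = - ext F"
  using ext_add[of F "- F"] by (simp add: minus_unique)

lemma ext_minus: "ext (F - G) = ext F - ext G"
  using ext_add[of F "- G"] by (simp add: ext_uminus)

lemma ext_const2: "ext (const2 v) $$ n $$ m = \<nu> v n m"
proof -
  \<comment> \<open>For nonnegative \<open>n\<close>, \<open>m\<close> this box reaches down to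
    exponent 0, where the constant sits; otherwise \<open>\<nu>\<close> vanishes by
    nonnegativity.\<close>
  have "lower_box (min n 0) (min m 0) n (const2 v)"
    by (auto simp: lower_box_def const2_def)
  from ext_box[OF this order.refl order.refl]
  have "ext (const2 v) $$ n $$ m =
      (\<Sum>i=min n 0..n. \<Sum>j=min m 0..m. \<nu> (const2 v $$ i $$ j) (n - i) (m - j))" .
  also have "\<dots> = (\<Sum>i=min n 0..n. if i = 0 then \<Sum>j=min m 0..m. if j = 0 then \<nu> v n m else 0 else 0)"
  proof (intro sum.cong refl)
    fix i :: int
    have "\<nu> (const2 v $$ i $$ j) (n - i) (m - j) = (if i = 0 then if j = 0 then \<nu> v n m else 0 else 0)" for j
      by (simp add: const2_def)
    then show "(\<Sum>j=min m 0..m. \<nu> (const2 v $$ i $$ j) (n - i) (m - j)) =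
        (if i = 0 then \<Sum>j=min m 0..m. if j = 0 then \<nu> v n m else 0 else 0)"
      by (cases "i = 0") auto
  qed
  also have "\<dots> = \<nu> v n m"
  proof -
    have "(\<Sum>j=min m 0..m. if j = 0 then \<nu> v n m else 0) = \<nu> v n m"
      using nonneg[of n m] by (simp add: not_le)
    then show ?thesis using nonneg[of n m] by (simp add: not_le)
  qed
  finally show ?thesis .
qed

text \<open>The ranges are given by \<open>n'\<close>, \<open>m'\<close> instead of
  \<open>n\<close>, \<open>m\<close>, so that coefficients at different exponents become sums over
  one index set.\<close>

lemma ext_times_box:
  assumes a: "lower_box A M (n' - B) a" and b: "lower_box B M' (n' - A) b"
    and n: "n \<le> n'" "m \<le> m'"
  shows "ext (a * b) $$ n $$ m = (\<Sum>i=A+B..n'. \<Sum>j=M+M'..m'. \<Sum>i1=A..n'-B. \<Sum>j1=M..m'-M'.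
    \<nu> (a $$ i1 $$ j1 * b $$ (i - i1) $$ (j - j1)) (n - i) (m - j))"
proof -
  note mul = fls2_times_nth_box[OF a b, where m=m']
  have "(a * b) $$ i = 0" if "i < A + B" for i
  proof (cases "a = 0 \<or> b = 0")
    case False
    then have "A \<le> fls_subdegree a" "B \<le> fls_subdegree b"
      using lower_boxD(1)[OF a] lower_boxD(1)[OF b] by (auto intro: fls_subdegree_geI)
    then show ?thesis using that by (intro fls_times_nth_eq0) auto
  qed auto
  moreover have "(a * b) $$ i $$ j = 0" if "i \<le> n'" "j < M + M'" for i j
    using that lower_boxD[OF a] lower_boxD[OF b]
    by (subst fls2_times_nth_box[OF a b that(1) order.refl]) auto
  ultimately have "lower_box (A + B) (M + M') n' (a * b)"
    by (auto simp: lower_box_def)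
  then have "lower_box (A + B) (M + M') n (a * b)"
    using n by (auto elim: lower_box_mono)
  from ext_box[OF this n] have "ext (a * b) $$ n $$ m =
    (\<Sum>i=A+B..n'. \<Sum>j=M+M'..m'. \<nu> ((a * b) $$ i $$ j) (n - i) (m - j))" .
  also have "\<dots> = (\<Sum>i=A+B..n'. \<Sum>j=M+M'..m'. \<Sum>i1=A..n'-B. \<Sum>j1=M..m'-M'.
    \<nu> (a $$ i1 $$ j1 * b $$ (i - i1) $$ (j - j1)) (n - i) (m - j))"
    by (intro sum.cong refl) (simp add: mul sum)
  finally show ?thesis .
qed

text \<open>Multiplication by a series of scalars is a convolution on both sides; moving the inner
  box by the exponents of \<open>c\<close> makes the two fourfold sums equal term by term.\<close>

lemma ext_scale:
  assumes \<iota>: "\<iota> 0 = 0" and lin: "\<And>c v n m. \<nu> (\<iota> c * v) n m = c * \<nu> v n m"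
  shows "ext (map2 \<iota> c * F) = c * ext F"
proof (rule fls2_eqI)
  fix n m
  obtain A1 M1 B1 M1' where "lower_box A1 M1 n c" "lower_box B1 M1' n F"
    using lower_box_exists by metis
  define A B where "A = min A1 0" and "B = min B1 0"
  obtain M where c: "lower_box A M (n - B) c"
  proof -
    obtain A' M where "lower_box A' M (n - B) c" using lower_box_exists by metis
    then have "lower_box A M (n - B) c"
      using \<open>lower_box A1 M1 n c\<close> by (auto simp: lower_box_def A_def)
    then show ?thesis by (rule that)
  qed
  obtain M' where F: "lower_box B M' (n - A) F"
  proof -
    obtain A' M where "lower_box A' M (n - A) F" using lower_box_exists by metis
    then have "lower_box B M (n - A) F"
      using \<open>lower_box B1 M1' n F\<close> by (auto simp: lower_box_def B_def)
    then show ?thesis by (rule that)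
  qed
  have mc: "lower_box A M (n - B) (map2 \<iota> c)"
    using c by (auto simp: lower_box_def map2_nth[of \<iota>, OF \<iota>] \<iota> intro!: fls_eqI)
  have extF: "ext F $$ (n - i1) $$ (m - j1) =
      (\<Sum>i=A+B..n. \<Sum>j=M+M'..m. \<nu> (F $$ (i - i1) $$ (j - j1)) (n - i) (m - j))"
    if "i1 \<in> {A..n-B}" "j1 \<in> {M..m-M'}" for i1 j1
  proof -
    have "lower_box (A + B - i1) (M + M' - j1) (n - i1) F"
      using F that by (auto elim!: lower_box_mono)
    from ext_box[OF this order.refl order.refl, of "m - j1"]
    have "ext F $$ (n - i1) $$ (m - j1) =
      (\<Sum>i=A+B-i1..n-i1. \<Sum>j=M+M'-j1..m-j1. \<nu> (F $$ i $$ j) (n - i1 - i) (m - j1 - j))" .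
    also have "\<dots> = (\<Sum>i=A+B..n. \<Sum>j=M+M'-j1..m-j1. \<nu> (F $$ (i - i1) $$ j) (n - i) (m - j1 - j))"
      by (rule sum.reindex_bij_witness[of _ "\<lambda>i. i - i1" "\<lambda>i. i + i1"]) (auto simp: algebra_simps)
    also have "\<dots> = (\<Sum>i=A+B..n. \<Sum>j=M+M'..m. \<nu> (F $$ (i - i1) $$ (j - j1)) (n - i) (m - j))"
      by (intro sum.cong refl sum.reindex_bij_witness[of _ "\<lambda>i. i - j1" "\<lambda>i. i + j1"])
        (auto simp: algebra_simps)
    finally show ?thesis .
  qed
  have ext0: "lower_box B M' (n - A) (ext F)"
  proof -
    have "ext F $$ i = 0" if "i < B" for i
    proof (rule fls_eqI)
      fix j
      obtain A' M where "lower_box A' M i F" using lower_box_exists by metis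
      then have "lower_box B M i F"
        using F by (auto simp: lower_box_def)
      then show "ext F $$ i $$ j = 0 $$ j" using that by (simp add: ext_eq0)
    qed
    moreover have "ext F $$ i $$ j = 0" if "i \<le> n - A" "j < M'" for i j
      using ext_eq0[OF lower_box_mono[OF F order.refl order.refl that(1)]] that by blast
    ultimately show ?thesis by (auto simp: lower_box_def)
  qed
  have "(c * ext F) $$ n $$ m =
      (\<Sum>i1=A..n-B. \<Sum>j1=M..m-M'. c $$ i1 $$ j1 * ext F $$ (n - i1) $$ (m - j1))"
    by (rule fls2_times_nth_box[OF c ext0 order.refl order.refl])
  also have "\<dots> = (\<Sum>i1=A..n-B. \<Sum>j1=M..m-M'. \<Sum>i=A+B..n. \<Sum>j=M+M'..m.
      c $$ i1 $$ j1 * \<nu> (F $$ (i - i1) $$ (j - j1)) (n - i) (m - j))"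
    by (simp add: extF sum_distrib_left)
  also have "\<dots> = (\<Sum>i1=A..n-B. \<Sum>i=A+B..n. \<Sum>j1=M..m-M'. \<Sum>j=M+M'..m.
      c $$ i1 $$ j1 * \<nu> (F $$ (i - i1) $$ (j - j1)) (n - i) (m - j))"
    by (intro sum.cong refl sum.swap)
  also have "\<dots> = (\<Sum>i=A+B..n. \<Sum>i1=A..n-B. \<Sum>j=M+M'..m. \<Sum>j1=M..m-M'.
      c $$ i1 $$ j1 * \<nu> (F $$ (i - i1) $$ (j - j1)) (n - i) (m - j))"
    by (subst sum.swap) (intro sum.cong refl sum.swap)
  also have "\<dots> = (\<Sum>i=A+B..n. \<Sum>j=M+M'..m. \<Sum>i1=A..n-B. \<Sum>j1=M..m-M'.
      c $$ i1 $$ j1 * \<nu> (F $$ (i - i1) $$ (j - j1)) (n - i) (m - j))"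
    by (intro sum.cong refl sum.swap)
  also have "\<dots> = ext (map2 \<iota> c * F) $$ n $$ m"
    by (simp add: ext_times_box[OF mc F order.refl order.refl] map2_nth[of \<iota>, OF \<iota>] lin)
  finally show "ext (map2 \<iota> c * F) $$ n $$ m = (c * ext F) $$ n $$ m" ..
qed

end

lemma map2_eq:
  assumes "h 0 = 0" and "\<And>n m. h (F $$ n $$ m) = G $$ n $$ m"
  shows "map2 h F = G"
  by (rule fls2_eqI) (simp add: map2_nth assms)

lemma map2_add:
  assumes "h 0 = 0" "\<And>a b. h (a + b) = h a + h b"
  shows "map2 h (F + G) = map2 h F + map2 h G"
  by (rule fls2_eqI) (simp add: map2_nth[of h, OF assms(1)] assms(2))

lemma map2_times:
  fixes \<iota> :: "'c::zero \<Rightarrow> 'v::semiring_0" and \<iota>' :: "'c \<Rightarrow> 'w::semiring_0"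
  assumes 0: "h 0 = 0" "\<iota> 0 = 0" "\<iota>' 0 = 0" and add: "\<And>a b. h (a + b) = h a + h b"
    and mult: "\<And>c a. h (\<iota> c * a) = \<iota>' c * h a"
  shows "map2 h (map2 \<iota> c * F) = map2 \<iota>' c * map2 h F"
proof (rule fls2_eqI)
  fix n m
  have hsum: "h (sum f X) = (\<Sum>x\<in>X. h (f x))" for f and X :: "int set"
    by (induction X rule: infinite_finite_induct) (auto simp: 0 add)
  obtain A1 M1 B1 M1' where b: "lower_box A1 M1 n c" "lower_box B1 M1' n F"
    using lower_box_exists by metis
  obtain A2 M A3 M' where b': "lower_box A2 M (n - B1) c" "lower_box A3 M' (n - A1) F"
    using lower_box_exists by metis
  have c: "lower_box A1 M (n - B1) c" and G: "lower_box B1 M' (n - A1) F"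
    using b b' by (auto simp: lower_box_def)
  have c1: "lower_box A1 M (n - B1) (map2 \<iota> c)" and c2: "lower_box A1 M (n - B1) (map2 \<iota>' c)"
    and G': "lower_box B1 M' (n - A1) (map2 h F)"
    using c G by (auto simp: lower_box_def map2_nth[of h, OF 0(1)] map2_nth[of \<iota>, OF 0(2)] map2_nth[of \<iota>', OF 0(3)] 0 intro!: fls_eqI)
  show "map2 h (map2 \<iota> c * F) $$ n $$ m = (map2 \<iota>' c * map2 h F) $$ n $$ m"
    by (simp add: map2_nth[of h, OF 0(1)] fls2_times_nth_box[OF c1 G order.refl order.refl]
        fls2_times_nth_box[OF c2 G' order.refl order.refl] hsum mult map2_nth[of \<iota>, OF 0(2)] map2_nth[of \<iota>', OF 0(3)])
qed

subsection \<open>Smooth functions on the plane\<close>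

lemma smooth_const [intro]: "smooth (\<lambda>p. c)"
  by (simp add: smooth_def Ck_const)

lemma smooth_add: "smooth f \<Longrightarrow> smooth g \<Longrightarrow> smooth (\<lambda>p. f p + g p)"
  by (simp add: smooth_def Ck_add)

lemma smooth_mult: "smooth f \<Longrightarrow> smooth g \<Longrightarrow> smooth (\<lambda>p. f p * g p)"
  by (simp add: smooth_def Ck_mult)

lemma smooth_cmult: "smooth f \<Longrightarrow> smooth (\<lambda>p. c * f p)"
  by (intro smooth_mult smooth_const)

lemma smooth_diff: "smooth f \<Longrightarrow> smooth g \<Longrightarrow> smooth (\<lambda>p. f p - g p)"
  using smooth_add[of f "\<lambda>p. - 1 * g p"] smooth_cmult[of g "- 1"] by simp

lemma smooth_pdx: "smooth f \<Longrightarrow> smooth (pdx f)"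
  and smooth_pdy: "smooth f \<Longrightarrow> smooth (pdy f)"
  unfolding smooth_def using Ck.simps(2) by blast+

lemma smooth_differentiable: "smooth f \<Longrightarrow> \<forall>p. f differentiable (at p)"
  unfolding smooth_def using Ck.simps(2) by blast

lemma smooth_continuous: "smooth f \<Longrightarrow> continuous_on UNIV f"
  unfolding smooth_def using Ck.simps(1) by blast

lemma pdx_deriv: "smooth f \<Longrightarrow> ((\<lambda>t. f (t, y)) has_vector_derivative pdx f (x, y)) (at x)"
  and pdy_deriv: "smooth f \<Longrightarrow> ((\<lambda>t. f (x, t)) has_vector_derivative pdy f (x, y)) (at y)"
  using has_vector_derivative_sections smooth_differentiable by blast+

lemma smooth_funpow: "smooth f \<Longrightarrow> smooth ((pdx ^^ n) f)" "smooth f \<Longrightarrow> smooth ((pdy ^^ n) f)"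
  by (induction n) (auto intro: smooth_pdx smooth_pdy)

lemma smooth_partial: "smooth f \<Longrightarrow> smooth (partial i j f)"
  by (simp add: partial_def smooth_funpow)

lemma pd_smooth_add:
  assumes "smooth f" "smooth g"
  shows "pdx (\<lambda>p. f p + g p) = (\<lambda>p. pdx f p + pdx g p)" "pdy (\<lambda>p. f p + g p) = (\<lambda>p. pdy f p + pdy g p)"
  using assms by (simp_all add: pd_add smooth_differentiable)

lemma pd_smooth_cmult:
  assumes "smooth f"
  shows "pdx (\<lambda>p. c * f p) = (\<lambda>p. c * pdx f p)" "pdy (\<lambda>p. c * f p) = (\<lambda>p. c * pdy f p)"
  using assms by (simp_all add: pd_mult pd_const smooth_differentiable)

lemma partial_add:
  assumes "smooth f" "smooth g"
  shows "partial i j (\<lambda>p. f p + g p) = (\<lambda>p. partial i j f p + partial i j g p)"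
proof -
  have "(pdy ^^ j) (\<lambda>p. f p + g p) = (\<lambda>p. (pdy ^^ j) f p + (pdy ^^ j) g p)"
    by (induction j) (use assms in \<open>auto simp: pd_smooth_add smooth_funpow\<close>)
  moreover have "(pdx ^^ i) (\<lambda>p. f p + g p) = (\<lambda>p. (pdx ^^ i) f p + (pdx ^^ i) g p)"
    if "smooth f" "smooth g" for f g
    by (induction i) (use that in \<open>auto simp: pd_smooth_add smooth_funpow\<close>)
  ultimately show ?thesis using assms by (simp add: partial_def smooth_funpow)
qed

lemma partial_cmult:
  assumes "smooth f"
  shows "partial i j (\<lambda>p. c * f p) = (\<lambda>p. c * partial i j f p)"
proof -
  have "(pdy ^^ j) (\<lambda>p. c * f p) = (\<lambda>p. c * (pdy ^^ j) f p)"
    by (induction j) (use assms in \<open>auto simp: pd_smooth_cmult smooth_funpow\<close>)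
  moreover have "(pdx ^^ i) (\<lambda>p. c * f p) = (\<lambda>p. c * (pdx ^^ i) f p)"
    if "smooth f" for f
    by (induction i) (use that in \<open>auto simp: pd_smooth_cmult smooth_funpow\<close>)
  ultimately show ?thesis using assms by (simp add: partial_def smooth_funpow)
qed

lemma partial_diff:
  assumes "smooth f" "smooth g"
  shows "partial i j (\<lambda>p. f p - g p) = (\<lambda>p. partial i j f p - partial i j g p)"
  using partial_add[OF assms(1) smooth_cmult[OF assms(2), of "- 1"], of i j]
    partial_cmult[OF assms(2), of i j "- 1"] by simp

lemma smooth_coords: "smooth (\<lambda>(x, y). of_real x)" "smooth (\<lambda>(x, y). of_real y)"
proof -
  have c: "continuous_on UNIV (\<lambda>(x::real, y::real). of_real x :: complex)"
    "continuous_on UNIV (\<lambda>(x::real, y::real). of_real y :: complex)"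
    by (auto simp: case_prod_unfold intro!: continuous_intros)
  have d: "(\<lambda>(x::real, y::real). of_real x :: complex) differentiable at p"
    "(\<lambda>(x::real, y::real). of_real y :: complex) differentiable at p" for p
    by (auto simp: case_prod_unfold differentiable_def intro!: exI derivative_eq_intros)
  have p: "pdx (\<lambda>(x, y). of_real x) = (\<lambda>p. 1)" "pdy (\<lambda>(x, y). of_real x) = (\<lambda>p. 0)"
    "pdx (\<lambda>(x, y). of_real y) = (\<lambda>p. 0)" "pdy (\<lambda>(x, y). of_real y) = (\<lambda>p. 1)"
    by (auto intro!: pdx_eqI pdy_eqI derivative_eq_intros)
  have "Ck k (\<lambda>(x, y). of_real x)" "Ck k (\<lambda>(x, y). of_real y)" for k
    by (cases k; simp add: c d p Ck_const)+
  then show "smooth (\<lambda>(x, y). of_real x)" "smooth (\<lambda>(x, y). of_real y)"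
    by (auto simp: smooth_def)
qed

section \<open>Total differentiability, integrals with a parameter and Hadamard's lemma\<close>

lemma continuous_on_section:
  assumes "continuous_on UNIV f" "continuous_on S a" "continuous_on S b"
  shows "continuous_on S (\<lambda>t. f (a t, b t))"
  using assms by (auto intro!: continuous_on_compose2[OF assms(1)] continuous_intros)

text \<open>Both partial derivatives, together with continuity of one of them, give the total
  differentiability demanded by \<open>Ck\<close>.\<close>

lemma has_derivative_plane:
  assumes dx: "\<And>x y. ((\<lambda>t. f (t, y)) has_vector_derivative fx (x, y)) (at x)"
    and dy: "\<And>x y. ((\<lambda>t. f (x, t)) has_vector_derivative fy (x, y)) (at y)"
    and cont: "continuous_on UNIV fy"
  shows "(f :: plane_fun) differentiable (at p)"
proof (cases p)
  case (Pair x y)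
  have "((\<lambda>(x, y). f (x, y)) has_derivative
      (\<lambda>(tx, ty). tx *\<^sub>R fx (x, y) + blinfun_apply (blinfun_scaleR_left (fy (x, y))) ty)) (at (x, y) within UNIV \<times> UNIV)"
  proof (rule has_derivative_partialsI)
    show "((\<lambda>x. f (x, y)) has_derivative (\<lambda>t. t *\<^sub>R fx (x, y))) (at x within UNIV)"
      using dx by (simp add: has_vector_derivative_def)
    show "((\<lambda>y. f (x, y)) has_derivative blinfun_apply (blinfun_scaleR_left (fy (x, y)))) (at y within UNIV)" for x y
      using dy by (simp add: has_vector_derivative_def)
    have "continuous (at (x, y)) (\<lambda>p. blinfun_scaleR_left (fy p))"
      using cont by (auto intro!: continuous_intros simp: continuous_on_eq_continuous_at)
    then show "continuous (at (x, y) within UNIV \<times> UNIV) (\<lambda>(x, y). blinfun_scaleR_left (fy (x, y)))"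
      by (simp add: case_prod_unfold)
  qed auto
  then show ?thesis unfolding Pair differentiable_def by auto
qed

lemma has_vector_derivative_integral_param:
  fixes g g' :: "real \<Rightarrow> real \<Rightarrow> complex"
  assumes "\<And>x t. ((\<lambda>x. g x t) has_vector_derivative g' x t) (at x)"
    and "\<And>x. continuous_on {a..b} (g x)"
    and "continuous_on UNIV (\<lambda>(x, t). g' x t)"
  shows "((\<lambda>x. integral {a..b} (g x)) has_vector_derivative integral {a..b} (g' x0)) (at x0)"
proof -
  have "continuous_on (UNIV \<times> cbox a b) (\<lambda>(x, t). g' x t)"
    using assms(3) by (rule continuous_on_subset) auto
  then show ?thesis
    using leibniz_rule_vector_derivative[of UNIV a b g g' x0] assms(1,2)
    by (auto intro: integrable_continuous_interval)
qed

lemma has_vector_derivative_scaled_arg: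
  fixes c t :: real
  assumes "(h has_vector_derivative D) (at (c * t))"
  shows "((\<lambda>t. h (c * t)) has_vector_derivative c *\<^sub>R D) (at t)"
proof -
  have "((*) c has_vector_derivative c) (at t)"
    by (auto intro!: derivative_eq_intros simp: has_real_derivative_iff_has_vector_derivative[symmetric])
  from vector_diff_chain_at[OF this assms] show ?thesis by (simp add: o_def)
qed

text \<open>One family for all Hadamard quotients: (\<alpha>, \<beta>) = (t, 1) and (1, t) divide in
  the x and y directions, and (0, t) divides along the y axis. The weight \<open>\<phi>\<close>
  makes the family closed under partial derivatives, which multiply the weight by \<alpha> or
  \<beta>.\<close>

definition param_int :: "(real \<Rightarrow> complex) \<Rightarrow> (real \<Rightarrow> real) \<Rightarrow> (real \<Rightarrow> real) \<Rightarrow> plane_fun \<Rightarrow> plane_fun" where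
  "param_int \<phi> \<alpha> \<beta> f = (\<lambda>p. integral {0..1} (\<lambda>t. \<phi> t * f (\<alpha> t * fst p, \<beta> t * snd p)))"

context
  fixes \<alpha> \<beta> :: "real \<Rightarrow> real"
  assumes cont: "continuous_on UNIV \<alpha>" "continuous_on UNIV \<beta>"
begin

lemma param_int_deriv:
  assumes \<phi>: "continuous_on UNIV \<phi>" and f: "\<forall>p. f differentiable (at p)"
    and fx: "continuous_on UNIV (pdx f)" "continuous_on UNIV (pdy f)"
  shows "((\<lambda>t. param_int \<phi> \<alpha> \<beta> f (t, y)) has_vector_derivative
      param_int (\<lambda>t. \<phi> t * of_real (\<alpha> t)) \<alpha> \<beta> (pdx f) (x, y)) (at x)" (is ?A)
    and "((\<lambda>t. param_int \<phi> \<alpha> \<beta> f (x, t)) has_vector_derivative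
      param_int (\<lambda>t. \<phi> t * of_real (\<beta> t)) \<alpha> \<beta> (pdy f) (x, y)) (at y)" (is ?B)
proof -
  have fc: "continuous_on UNIV f"
    using f by (auto intro!: differentiable_imp_continuous_on differentiable_at_imp_differentiable_on)
  note [continuous_intros] = continuous_on_section[OF fc] continuous_on_section[OF fx(1)] continuous_on_section[OF fx(2)]
    continuous_on_compose2[OF cont(1)] continuous_on_compose2[OF cont(2)] continuous_on_compose2[OF \<phi>]
    cont[THEN continuous_on_subset] \<phi>[THEN continuous_on_subset]
  show ?A unfolding param_int_def fst_conv snd_conv
  proof (rule has_vector_derivative_integral_param)
    fix x t
    have "((\<lambda>s. f (s, \<beta> t * y)) has_vector_derivative pdx f (\<alpha> t * x, \<beta> t * y)) (at (\<alpha> t * x))"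
      using has_vector_derivative_sections f by blast
    from has_vector_derivative_scaled_arg[OF this] have "((\<lambda>x. f (\<alpha> t * x, \<beta> t * y)) has_vector_derivative \<alpha> t *\<^sub>R pdx f (\<alpha> t * x, \<beta> t * y)) (at x)" .
    then show "((\<lambda>x. \<phi> t * f (\<alpha> t * x, \<beta> t * y)) has_vector_derivative
        \<phi> t * complex_of_real (\<alpha> t) * pdx f (\<alpha> t * x, \<beta> t * y)) (at x)"
      by (auto intro!: derivative_eq_intros simp: scaleR_conv_of_real)
  qed (auto simp: case_prod_unfold intro!: continuous_intros)
  show ?B unfolding param_int_def fst_conv snd_conv
  proof (rule has_vector_derivative_integral_param)
    fix y t
    have "((\<lambda>s. f (\<alpha> t * x, s)) has_vector_derivative pdy f (\<alpha> t * x, \<beta> t * y)) (at (\<beta> t * y))"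
      using has_vector_derivative_sections f by blast
    from has_vector_derivative_scaled_arg[OF this] have "((\<lambda>y. f (\<alpha> t * x, \<beta> t * y)) has_vector_derivative \<beta> t *\<^sub>R pdy f (\<alpha> t * x, \<beta> t * y)) (at y)" .
    then show "((\<lambda>y. \<phi> t * f (\<alpha> t * x, \<beta> t * y)) has_vector_derivative
        \<phi> t * complex_of_real (\<beta> t) * pdy f (\<alpha> t * x, \<beta> t * y)) (at y)"
      by (auto intro!: derivative_eq_intros simp: scaleR_conv_of_real)
  qed (auto simp: case_prod_unfold intro!: continuous_intros)
qed

lemma param_int_continuous:
  assumes \<phi>: "continuous_on UNIV \<phi>" and f: "continuous_on UNIV f"
  shows "continuous_on UNIV (param_int \<phi> \<alpha> \<beta> f)"
proof -
  note [continuous_intros] = continuous_on_section[OF f]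
    continuous_on_compose2[OF cont(1)] continuous_on_compose2[OF cont(2)] continuous_on_compose2[OF \<phi>]
  have "continuous_on (UNIV \<times> cbox 0 1)
      (\<lambda>(p, t). \<phi> t * f (\<alpha> t * fst p, \<beta> t * snd p))"
    by (auto simp: case_prod_unfold intro!: continuous_intros)
  from integral_continuous_on_param[OF this] show ?thesis
    by (simp add: param_int_def)
qed

lemma Ck_param_int:
  assumes "continuous_on UNIV \<phi>" "Ck k f"
  shows "Ck k (param_int \<phi> \<alpha> \<beta> f)"
  using assms
proof (induction k arbitrary: \<phi> f)
  case (Suc k)
  have c0: "continuous_on UNIV g" if "Ck k g" for g
  proof -
    have "Ck 0 g" using that by (induction k) (auto dest: Ck_Suc_imp simp del: Ck.simps)
    then show ?thesis by simp
  qed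
  have f: "\<forall>p. f differentiable (at p)" "Ck k (pdx f)" "Ck k (pdy f)"
    using Suc.prems by auto
  note d = param_int_deriv[OF Suc.prems(1) f(1) c0[OF f(2)] c0[OF f(3)]]
  have \<phi>': "continuous_on UNIV (\<lambda>t. \<phi> t * of_real (\<alpha> t))" "continuous_on UNIV (\<lambda>t. \<phi> t * of_real (\<beta> t))"
    using Suc.prems(1) cont by (auto intro!: continuous_intros)
  have "pdx (param_int \<phi> \<alpha> \<beta> f) = param_int (\<lambda>t. \<phi> t * of_real (\<alpha> t)) \<alpha> \<beta> (pdx f)"
    "pdy (param_int \<phi> \<alpha> \<beta> f) = param_int (\<lambda>t. \<phi> t * of_real (\<beta> t)) \<alpha> \<beta> (pdy f)"
    using d by (auto intro!: pdx_eqI pdy_eqI)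
  moreover have "param_int \<phi> \<alpha> \<beta> f differentiable (at p)" for p
    using has_derivative_plane[OF d] param_int_continuous[OF \<phi>'(2) c0[OF f(3)]] by blast
  ultimately show ?case using Suc.IH \<phi>' f by simp
qed (simp add: param_int_continuous)

lemma smooth_param_int: "continuous_on UNIV \<phi> \<Longrightarrow> smooth f \<Longrightarrow> smooth (param_int \<phi> \<alpha> \<beta> f)"
  by (simp add: smooth_def Ck_param_int)

end

text \<open>Fundamental theorem of calculus along the horizontal segment from (0, y) to (x,
  y).\<close>

lemma hadamard_x:
  assumes "smooth f"
  shows "f (x, y) = f (0, y) + of_real x * param_int (\<lambda>t. 1) (\<lambda>t. t) (\<lambda>t. 1) (pdx f) (x, y)"
proof -
  have "((\<lambda>t. f (x * t, y)) has_vector_derivative x *\<^sub>R pdx f (x * t, y)) (at t)" for t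
    by (rule has_vector_derivative_scaled_arg[of "\<lambda>t. f (t, y)", OF pdx_deriv[OF assms]])
  then have "((\<lambda>t. x *\<^sub>R pdx f (x * t, y)) has_integral (f (x * 1, y) - f (x * 0, y))) {0..1}"
    by (intro fundamental_theorem_of_calculus[of 0 1 "\<lambda>t. f (x * t, y)"]) (simp_all add: has_vector_derivative_at_within)
  then have "((\<lambda>t. x *\<^sub>R pdx f (t * x, y)) has_integral (f (x, y) - f (0, y))) {0..1}"
    by (simp add: mult.commute)
  then have "x *\<^sub>R integral {0..1} (\<lambda>t. pdx f (t * x, y)) = f (x, y) - f (0, y)"
    by (simp only: integral_cmul[symmetric] integral_unique)
  then show ?thesis
    by (simp add: param_int_def scaleR_conv_of_real)
qed

lemma hadamard_y:
  assumes "smooth f"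
  shows "f (x, y) = f (x, 0) + of_real y * param_int (\<lambda>t. 1) (\<lambda>t. 1) (\<lambda>t. t) (pdy f) (x, y)"
proof -
  have "((\<lambda>t. f (x, y * t)) has_vector_derivative y *\<^sub>R pdy f (x, y * t)) (at t)" for t
    by (rule has_vector_derivative_scaled_arg[of "\<lambda>t. f (x, t)", OF pdy_deriv[OF assms]])
  then have "((\<lambda>t. y *\<^sub>R pdy f (x, y * t)) has_integral (f (x, y * 1) - f (x, y * 0))) {0..1}"
    by (intro fundamental_theorem_of_calculus[of 0 1 "\<lambda>t. f (x, y * t)"]) (simp_all add: has_vector_derivative_at_within)
  then have "((\<lambda>t. y *\<^sub>R pdy f (x, t * y)) has_integral (f (x, y) - f (x, 0))) {0..1}"
    by (simp add: mult.commute)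
  then have "y *\<^sub>R integral {0..1} (\<lambda>t. pdy f (x, t * y)) = f (x, y) - f (x, 0)"
    by (simp only: integral_cmul[symmetric] integral_unique)
  then show ?thesis
    by (simp add: param_int_def scaleR_conv_of_real)
qed

text \<open>The formula f(x, y) = f(x, y1) + integral of \<open>pdy f\<close> from y1 to y is
  differentiated in x under the integral sign, then in y by the fundamental theorem.\<close>

lemma pdx_pdy_commute:
  assumes f: "smooth f"
  shows "pdy (pdx f) = pdx (pdy f)"
proof (rule pdy_eqI)
  fix x y0 :: real
  \<comment> \<open>With \<open>y0\<close> in the interior of the interval, the derivative within
    the interval is the two-sided one.\<close>
  define y1 where "y1 = y0 - 1"
  note fy = smooth_pdy[OF f] and fxy = smooth_pdx[OF smooth_pdy[OF f]]
  have FTC: "f (x, y) = f (x, y1) + integral {y1..y} (\<lambda>t. pdy f (x, t))" if "y1 \<le> y" for x y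
  proof -
    have "((\<lambda>t. pdy f (x, t)) has_integral (f (x, y) - f (x, y1))) {y1..y}"
      using that by (intro fundamental_theorem_of_calculus[of y1 y "\<lambda>t. f (x, t)"]) (simp_all add: pdy_deriv f has_vector_derivative_at_within)
    from integral_unique[OF this] show ?thesis by simp
  qed
  have cont: "continuous_on S (\<lambda>t. g (a t, b t))"
    if "smooth g" "continuous_on S a" "continuous_on S b" for g a b and S :: "'a::topological_space set"
    using continuous_on_section[OF smooth_continuous[OF that(1)] that(2,3)] .
  have eq: "pdx f (x, y) = pdx f (x, y1) + integral {y1..y} (\<lambda>t. pdx (pdy f) (x, t))" if "y1 \<le> y" for y
  proof -
    have "((\<lambda>x. integral {y1..y} (\<lambda>t. pdy f (x, t))) has_vector_derivative
        integral {y1..y} (\<lambda>t. pdx (pdy f) (x, t))) (at x)"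
    proof (rule has_vector_derivative_integral_param[where g="\<lambda>x t. pdy f (x, t)" and g'="\<lambda>x t. pdx (pdy f) (x, t)"])
      show "continuous_on UNIV (\<lambda>(x, t). pdx (pdy f) (x, t))"
        using smooth_continuous[OF fxy] by simp
      show "continuous_on {y1..y} (\<lambda>t. pdy f (x, t))" for x
        by (rule cont[OF fy]) (intro continuous_intros)+
    qed (rule pdx_deriv[OF fy])
    from has_vector_derivative_add[OF pdx_deriv[OF f, of y1] this]
    have "((\<lambda>x. f (x, y)) has_vector_derivative pdx f (x, y1) + integral {y1..y} (\<lambda>t. pdx (pdy f) (x, t))) (at x)"
      using FTC[OF that] by simp
    from vector_derivative_unique_at[OF this pdx_deriv[OF f]] show ?thesis by simp
  qed
  have "((\<lambda>y. pdx f (x, y1) + integral {y1..y} (\<lambda>t. pdx (pdy f) (x, t)))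
      has_vector_derivative 0 + pdx (pdy f) (x, y0)) (at y0 within {y1..y0+1})"
  proof (rule has_vector_derivative_add[OF has_vector_derivative_const])
    have "continuous_on {y1..y0+1} (\<lambda>t. pdx (pdy f) (x, t))"
      by (rule cont[OF fxy]) (intro continuous_intros)+
    then show "((\<lambda>y. integral {y1..y} (\<lambda>t. pdx (pdy f) (x, t))) has_vector_derivative pdx (pdy f) (x, y0))
        (at y0 within {y1..y0+1})"
      by (rule integral_has_vector_derivative) (simp add: y1_def)
  qed
  then have "((\<lambda>y. pdx f (x, y)) has_vector_derivative 0 + pdx (pdy f) (x, y0)) (at y0 within {y1..y0+1})"
    by (rule has_vector_derivative_transform[rotated 2]) (auto simp: y1_def intro!: eq[unfolded y1_def])
  then show "((\<lambda>y. pdx f (x, y)) has_vector_derivative pdx (pdy f) (x, y0)) (at y0)"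
    by (simp add: at_within_Icc_at y1_def)
qed

lemma partial_Suc_right: "partial i (Suc j) f = partial i j (pdy f)"
  by (simp add: partial_def funpow_swap1)

lemma pdy_funpow_pdx: "smooth f \<Longrightarrow> (pdy ^^ j) (pdx f) = pdx ((pdy ^^ j) f)"
  by (induction j) (auto simp: pdx_pdy_commute smooth_funpow)

lemma partial_Suc_left: "smooth f \<Longrightarrow> partial (Suc i) j f = partial i j (pdx f)"
  by (simp add: partial_def funpow_swap1 pdy_funpow_pdx)

lemma partial_0_0 [simp]: "partial 0 0 f = f"
  by (simp add: partial_def)

lemma pd_minus:
  assumes "smooth f"
  shows "pdx (\<lambda>p. f (- p)) = (\<lambda>p. - pdx f (- p))" "pdy (\<lambda>p. f (- p)) = (\<lambda>p. - pdy f (- p))"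
proof (rule pdx_eqI)
  fix x y
  show "((\<lambda>t. f (- (t, y))) has_vector_derivative - pdx f (- (x, y))) (at x)"
    using has_vector_derivative_scaled_arg[of "\<lambda>t. f (t, - y)" _ "- 1" x] pdx_deriv[OF assms, of "- y" "- x"]
    by simp
next
  show "pdy (\<lambda>p. f (- p)) = (\<lambda>p. - pdy f (- p))"
  proof (rule pdy_eqI)
    fix x y
    show "((\<lambda>t. f (- (x, t))) has_vector_derivative - pdy f (- (x, y))) (at y)"
      using has_vector_derivative_scaled_arg[of "\<lambda>t. f (- x, t)" _ "- 1" y] pdy_deriv[OF assms, of "- x" "- y"]
      by simp
  qed
qed

lemma smooth_minus_arg:
  assumes "smooth f" shows "smooth (\<lambda>p. f (- p))"
proof -
  have "Ck k (\<lambda>p. c * f (- p))" if "smooth f" for k c f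
    using that
  proof (induction k arbitrary: c f)
    case 0
    then show ?case
      using continuous_on_compose2[OF smooth_continuous[OF 0], of UNIV uminus]
      by (auto intro!: continuous_on_mult simp: continuous_on_minus continuous_on_id)
  next
    case (Suc k)
    have d: "(\<lambda>p. f (- p)) differentiable (at p)" for p
      using differentiable_chain_at[of uminus p f] smooth_differentiable[OF Suc.prems]
      by (simp add: o_def)
    have "pdx (\<lambda>p. c * f (- p)) = (\<lambda>p. (- c) * pdx f (- p))"
      "pdy (\<lambda>p. c * f (- p)) = (\<lambda>p. (- c) * pdy f (- p))"
      using d by (simp_all add: pd_mult pd_const pd_minus[OF Suc.prems])
    then show ?case
      using d Suc.IH[OF smooth_pdx[OF Suc.prems], of "- c"] Suc.IH[OF smooth_pdy[OF Suc.prems], of "- c"] by simp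
  qed
  from this[OF assms, of _ 1] show ?thesis by (simp add: smooth_def)
qed

lemma partial_minus_arg:
  assumes "smooth f"
  shows "partial i j (\<lambda>p. f (- p)) = (\<lambda>p. (- 1) ^ (i + j) * partial i j f (- p))"
proof -
  have y: "(pdy ^^ j) (\<lambda>p. f (- p)) = (\<lambda>p. (- 1) ^ j * (pdy ^^ j) f (- p))"
    by (induction j) (use assms in \<open>auto simp: pd_minus pd_smooth_cmult smooth_minus_arg smooth_funpow\<close>)
  have x: "(pdx ^^ i) (\<lambda>p. c * f (- p)) = (\<lambda>p. (- 1) ^ i * c * (pdx ^^ i) f (- p))" if "smooth f" for f c
    by (induction i) (use that in \<open>auto simp: pd_minus pd_smooth_cmult smooth_minus_arg smooth_funpow\<close>)
  show ?thesis using assms by (simp add: partial_def y x smooth_funpow power_add)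
qed

subsection \<open>Polynomial functions\<close>

abbreviation lookup where "lookup \<equiv> Poly_Mapping.lookup"

lemma poly2_eqI:
  fixes p q :: poly2
  shows "(\<And>a b. lookup p (a, b) = lookup q (a, b)) \<Longrightarrow> p = q"
  by (rule poly_mapping_eqI) auto

lemma eval2_superset:
  assumes "finite S" "Poly_Mapping.keys p \<subseteq> S"
  shows "eval2 p u v = (\<Sum>k\<in>S. lookup p k * u ^ fst k * v ^ snd k)"
  unfolding eval2_def using assms by (intro sum.mono_neutral_left) (auto simp: in_keys_iff)

lemma eval2_zero [simp]: "eval2 0 u v = 0"
  by (simp add: eval2_def)

lemma eval2_add: "eval2 (p + q) u v = eval2 p u v + eval2 q u v"
proof -
  let ?S = "Poly_Mapping.keys p \<union> Poly_Mapping.keys q"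
  have "Poly_Mapping.keys (p + q) \<subseteq> ?S" by (rule keys_add)
  then show ?thesis
    by (simp add: eval2_superset[of ?S] lookup_add sum.distrib[symmetric] algebra_simps)
qed

lemma eval2_sum: "eval2 (\<Sum>x\<in>X. p x) u v = (\<Sum>x\<in>X. eval2 (p x) u v)"
  by (induction X rule: infinite_finite_induct) (auto simp: eval2_add)

lemma eval2_single: "eval2 (Poly_Mapping.single k c) u v = c * u ^ fst k * v ^ snd k"
  by (subst eval2_superset[of "{k}"]) auto

text \<open>At exponent 0 the truncated \<open>fst k - 1\<close> does no harm, as the coefficient is
  0.\<close>

definition dX :: "poly2 \<Rightarrow> poly2" where
  "dX p = (\<Sum>k\<in>Poly_Mapping.keys p. Poly_Mapping.single (fst k - 1, snd k) (of_nat (fst k) * lookup p k))"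

definition dY :: "poly2 \<Rightarrow> poly2" where
  "dY p = (\<Sum>k\<in>Poly_Mapping.keys p. Poly_Mapping.single (fst k, snd k - 1) (of_nat (snd k) * lookup p k))"

lemma lookup_dX: "lookup (dX p) (a, b) = of_nat (Suc a) * lookup p (Suc a, b)"
proof -
  have "lookup (dX p) (a, b) = (\<Sum>k\<in>Poly_Mapping.keys p.
      if k = (Suc a, b) then of_nat (Suc a) * lookup p (Suc a, b) else 0)"
    unfolding dX_def lookup_sum
  proof (rule sum.cong[OF refl])
    fix k :: "nat \<times> nat"
    show "lookup (Poly_Mapping.single (fst k - 1, snd k) (of_nat (fst k) * lookup p k)) (a, b) =
      (if k = (Suc a, b) then of_nat (Suc a) * lookup p (Suc a, b) else 0)"
      by (cases k; cases "fst k") (auto simp: lookup_single when_def)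
  qed
  then show ?thesis by (simp add: in_keys_iff)
qed

lemma lookup_dY: "lookup (dY p) (a, b) = of_nat (Suc b) * lookup p (a, Suc b)"
proof -
  have "lookup (dY p) (a, b) = (\<Sum>k\<in>Poly_Mapping.keys p.
      if k = (a, Suc b) then of_nat (Suc b) * lookup p (a, Suc b) else 0)"
    unfolding dY_def lookup_sum
  proof (rule sum.cong[OF refl])
    fix k :: "nat \<times> nat"
    show "lookup (Poly_Mapping.single (fst k, snd k - 1) (of_nat (snd k) * lookup p k)) (a, b) =
      (if k = (a, Suc b) then of_nat (Suc b) * lookup p (a, Suc b) else 0)"
      by (cases k; cases "snd k") (auto simp: lookup_single when_def)
  qed
  then show ?thesis by (simp add: in_keys_iff)
qed

text \<open>Stated along arbitrary curves so that it serves the coordinates x, y as well as z,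
  zbar.\<close>

lemma eval2_chain_rule:
  fixes u v :: "real \<Rightarrow> complex"
  assumes "(u has_vector_derivative u') (at t)" "(v has_vector_derivative v') (at t)"
  shows "((\<lambda>t. eval2 p (u t) (v t)) has_vector_derivative
    u' * eval2 (dX p) (u t) (v t) + v' * eval2 (dY p) (u t) (v t)) (at t)"
proof -
  have pow: "((\<lambda>t. w t ^ n) has_vector_derivative of_nat n * w' * w t ^ (n - 1)) (at t)"
    if "(w has_vector_derivative w') (at t)" for w :: "real \<Rightarrow> complex" and w' n
    using that unfolding has_vector_derivative_def
    by (rule has_derivative_power[THEN has_derivative_eq_rhs]) (auto simp: fun_eq_iff algebra_simps)
  have "((\<lambda>t. eval2 p (u t) (v t)) has_vector_derivative
    (\<Sum>k\<in>Poly_Mapping.keys p. lookup p k * u t ^ fst k * (of_nat (snd k) * v' * v t ^ (snd k - 1)) +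
       lookup p k * (of_nat (fst k) * u' * u t ^ (fst k - 1)) * v t ^ snd k)) (at t)"
    unfolding eval2_def
    by (rule has_vector_derivative_sum) (rule has_vector_derivative_mult has_vector_derivative_mult_right pow assms)+
  moreover have "(\<Sum>k\<in>Poly_Mapping.keys p. lookup p k * u t ^ fst k * (of_nat (snd k) * v' * v t ^ (snd k - 1)) +
       lookup p k * (of_nat (fst k) * u' * u t ^ (fst k - 1)) * v t ^ snd k) =
    u' * eval2 (dX p) (u t) (v t) + v' * eval2 (dY p) (u t) (v t)"
    by (simp add: dX_def dY_def eval2_sum eval2_single sum_distrib_left sum.distrib[symmetric] algebra_simps)
  ultimately show ?thesis by simp
qed

lemma pd_poly_xy: "pdx (poly_xy p) = poly_xy (dX p)" "pdy (poly_xy p) = poly_xy (dY p)"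
proof -
  have r: "(complex_of_real has_vector_derivative 1) (at t)" for t
    by (auto intro!: derivative_eq_intros)
  show "pdx (poly_xy p) = poly_xy (dX p)"
    unfolding poly_xy_def
    by (rule pdx_eqI) (use eval2_chain_rule[OF r has_vector_derivative_const] in simp)
  show "pdy (poly_xy p) = poly_xy (dY p)"
    unfolding poly_xy_def
    by (rule pdy_eqI) (use eval2_chain_rule[OF has_vector_derivative_const r] in simp)
qed

lemma pd_poly_zz:
  "pdx (poly_zz p) = (\<lambda>q. poly_zz (dX p) q + poly_zz (dY p) q)"
  "pdy (poly_zz p) = (\<lambda>q. \<i> * poly_zz (dX p) q - \<i> * poly_zz (dY p) q)"
proof -
  have x: "((\<lambda>x. complex_of_real x + c) has_vector_derivative 1) (at t)"
    "((\<lambda>x. complex_of_real x - c) has_vector_derivative 1) (at t)" for t c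
    by (auto intro!: derivative_eq_intros)
  have y: "((\<lambda>y. c + \<i> * complex_of_real y) has_vector_derivative \<i>) (at t)"
    "((\<lambda>y. c - \<i> * complex_of_real y) has_vector_derivative - \<i>) (at t)" for t c
    by (auto intro!: derivative_eq_intros)
  show "pdx (poly_zz p) = (\<lambda>q. poly_zz (dX p) q + poly_zz (dY p) q)"
    by (rule pdx_eqI) (use eval2_chain_rule[OF x] in \<open>simp add: poly_zz_def\<close>)
  show "pdy (poly_zz p) = (\<lambda>q. \<i> * poly_zz (dX p) q - \<i> * poly_zz (dY p) q)"
    by (rule pdy_eqI) (use eval2_chain_rule[OF y] in \<open>simp add: poly_zz_def\<close>)
qed

lemma smooth_sum: "(\<And>x. x \<in> X \<Longrightarrow> smooth (f x)) \<Longrightarrow> smooth (\<lambda>p. \<Sum>x\<in>X. f x p)"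
  by (induction X rule: infinite_finite_induct) (auto intro: smooth_add)

lemma smooth_power: "smooth f \<Longrightarrow> smooth (\<lambda>p. f p ^ n)"
  by (induction n) (auto intro: smooth_mult)

lemma smooth_poly_xy: "smooth (poly_xy p)"
proof -
  have "smooth (\<lambda>q. \<Sum>k\<in>Poly_Mapping.keys p. lookup p k *
      (case q of (x, y) \<Rightarrow> of_real x) ^ fst k * (case q of (x, y) \<Rightarrow> of_real y) ^ snd k)"
    by (intro smooth_sum smooth_mult smooth_power smooth_const smooth_coords)
  then show ?thesis by (simp add: poly_xy_def eval2_def case_prod_unfold)
qed

lemma smooth_poly_zz: "smooth (poly_zz p)"
proof -
  have "smooth (\<lambda>q. \<Sum>k\<in>Poly_Mapping.keys p. lookup p k *
      ((case q of (x, y) \<Rightarrow> of_real x) + \<i> * (case q of (x, y) \<Rightarrow> of_real y)) ^ fst k *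
      ((case q of (x, y) \<Rightarrow> of_real x) - \<i> * (case q of (x, y) \<Rightarrow> of_real y)) ^ snd k)"
    by (intro smooth_sum smooth_mult smooth_power smooth_const smooth_coords smooth_add smooth_diff)
  then show ?thesis by (simp add: poly_zz_def eval2_def case_prod_unfold)
qed

lemma dz_poly_zz: "dz (poly_zz p) = poly_zz (dX p)" "dzbar (poly_zz p) = poly_zz (dY p)"
  by (auto simp: dz_def dzbar_def pd_poly_zz fun_eq_iff field_simps)

lemma eval2_0_0: "eval2 p 0 0 = lookup p (0, 0)"
proof -
  have "eval2 p 0 0 = (\<Sum>k\<in>insert (0,0) (Poly_Mapping.keys p). if k = (0,0) then lookup p (0,0) else 0)"
    unfolding eval2_superset[of "insert (0,0) (Poly_Mapping.keys p)" p, OF _ subset_insertI, simplified]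
    by (intro sum.cong) (auto simp: zero_power_eq)
  then show ?thesis by simp
qed

lemma lookup_dX_funpow: "lookup ((dX ^^ n) p) (a, b) = fact (a + n) / fact a * lookup p (a + n, b)"
  by (induction n arbitrary: p) (simp_all add: funpow_Suc_right lookup_dX divide_simps del: funpow.simps)

lemma lookup_dY_funpow: "lookup ((dY ^^ n) p) (a, b) = fact (b + n) / fact b * lookup p (a, b + n)"
  by (induction n arbitrary: p) (simp_all add: funpow_Suc_right lookup_dY divide_simps del: funpow.simps)

lemma funpow_pd_poly_xy: "(pdx ^^ n) (poly_xy p) = poly_xy ((dX ^^ n) p)" "(pdy ^^ n) (poly_xy p) = poly_xy ((dY ^^ n) p)"
  by (induction n) (auto simp: pd_poly_xy)

lemma partial_poly_xy: "partial i j (poly_xy p) = poly_xy ((dX ^^ i) ((dY ^^ j) p))"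
  by (simp add: partial_def funpow_pd_poly_xy)

lemma partial_poly_xy_0: "partial i j (poly_xy p) (0, 0) = fact i * fact j * lookup p (i, j)"
  unfolding partial_poly_xy unfolding poly_xy_def
  by (simp add: eval2_0_0 lookup_dX_funpow lookup_dY_funpow)

lemma funpow_dz_poly_zz: "(dz ^^ n) (poly_zz p) = poly_zz ((dX ^^ n) p)" "(dzbar ^^ n) (poly_zz p) = poly_zz ((dY ^^ n) p)"
  by (induction n) (auto simp: dz_poly_zz)

lemma dz_dzbar_poly_zz_0: "(dz ^^ k) ((dzbar ^^ k) (poly_zz p)) (0, 0) = (fact k)\<^sup>2 * lookup p (k, k)"
  unfolding funpow_dz_poly_zz unfolding poly_zz_def
  by (simp add: eval2_0_0 lookup_dX_funpow lookup_dY_funpow power2_eq_square)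

subsection \<open>Approximation by polynomials with all derivatives\<close>

lemma mvt_x:
  assumes "smooth h" "\<bar>x\<bar> \<le> R" "\<And>x. \<bar>x\<bar> \<le> R \<Longrightarrow> cmod (pdx h (x, y)) \<le> B"
  shows "cmod (h (x, y) - h (0, y)) \<le> B * R"
proof -
  have "0 \<le> B" using order_trans[OF norm_ge_zero assms(3)[OF assms(2)]] .
  have "cmod (h (x, y) - h (0, y)) \<le> B * norm (x - 0)"
  proof (rule differentiable_bound[of "{-R..R}" "\<lambda>t. h (t, y)"])
    fix t assume "t \<in> {-R..R}"
    then have "\<bar>t\<bar> \<le> R" by auto
    show "((\<lambda>t. h (t, y)) has_derivative (\<lambda>s. s *\<^sub>R pdx h (t, y))) (at t within {-R..R})"
      using pdx_deriv[OF assms(1)] by (simp add: has_vector_derivative_def has_derivative_at_withinI)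
    show "onorm (\<lambda>s. s *\<^sub>R pdx h (t, y)) \<le> B"
      using assms(3)[OF \<open>\<bar>t\<bar> \<le> R\<close>] by (intro onorm_le) (simp add: mult.commute[of B] mult_left_mono)
  qed (use assms(2) in auto)
  also have "\<dots> \<le> B * R" using \<open>0 \<le> B\<close> assms(2) by (intro mult_left_mono) auto
  finally show ?thesis .
qed

lemma mvt_y:
  assumes "smooth h" "\<bar>y\<bar> \<le> R" "\<And>y. \<bar>y\<bar> \<le> R \<Longrightarrow> cmod (pdy h (x, y)) \<le> B"
  shows "cmod (h (x, y) - h (x, 0)) \<le> B * R"
proof -
  have "0 \<le> B" using order_trans[OF norm_ge_zero assms(3)[OF assms(2)]] .
  have "cmod (h (x, y) - h (x, 0)) \<le> B * norm (y - 0)"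
  proof (rule differentiable_bound[of "{-R..R}" "\<lambda>t. h (x, t)"])
    fix t assume "t \<in> {-R..R}"
    then have "\<bar>t\<bar> \<le> R" by auto
    show "((\<lambda>t. h (x, t)) has_derivative (\<lambda>s. s *\<^sub>R pdy h (x, t))) (at t within {-R..R})"
      using pdy_deriv[OF assms(1)] by (simp add: has_vector_derivative_def has_derivative_at_withinI)
    show "onorm (\<lambda>s. s *\<^sub>R pdy h (x, t)) \<le> B"
      using assms(3)[OF \<open>\<bar>t\<bar> \<le> R\<close>] by (intro onorm_le) (simp add: mult.commute[of B] mult_left_mono)
  qed (use assms(2) in auto)
  also have "\<dots> \<le> B * R" using \<open>0 \<le> B\<close> assms(2) by (intro mult_left_mono) auto
  finally show ?thesis .
qed

lemma poly2_of_fun: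
  fixes c :: "nat \<times> nat \<Rightarrow> complex"
  assumes "finite {k. c k \<noteq> 0}"
  shows "\<exists>p :: poly2. \<forall>k. lookup p k = c k"
  using assms by (metis lookup_Abs_poly_mapping)

text \<open>An antiderivative of \<open>q\<close> in x; the terms free of x, which \<open>dX\<close>
  does not see, are taken from \<open>r\<close>.\<close>

lemma poly2_extension_x:
  fixes q r :: poly2
  obtains P where "dX P = q" "\<forall>b. lookup P (0, b) = lookup r (0, b)"
proof -
  define c where "c = (\<lambda>(a, b). if a = 0 then lookup r (0, b) else lookup q (a - 1, b) / of_nat a)"
  have "{k. c k \<noteq> 0} \<subseteq> Poly_Mapping.keys r \<union> (\<lambda>(a, b). (Suc a, b)) ` Poly_Mapping.keys q"
  proof
    fix k assume "k \<in> {k. c k \<noteq> 0}"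
    then show "k \<in> Poly_Mapping.keys r \<union> (\<lambda>(a, b). (Suc a, b)) ` Poly_Mapping.keys q"
      by (cases k; cases "fst k") (auto simp: c_def in_keys_iff image_iff intro!: bexI[of _ "(fst k - 1, snd k)"])
  qed
  then have "finite {k. c k \<noteq> 0}" by (rule finite_subset) auto
  then obtain P where "\<And>k. lookup P k = c k" using poly2_of_fun by blast
  then show ?thesis by (intro that[of P] poly2_eqI) (auto simp: lookup_dX c_def simp del: of_nat_Suc)
qed

lemma poly2_extension_y:
  fixes q r :: poly2
  obtains P where "dY P = q" "\<forall>a. lookup P (a, 0) = lookup r (a, 0)"
proof -
  define c where "c = (\<lambda>(a, b). if b = 0 then lookup r (a, 0) else lookup q (a, b - 1) / of_nat b)"
  have "{k. c k \<noteq> 0} \<subseteq> Poly_Mapping.keys r \<union> (\<lambda>(a, b). (a, Suc b)) ` Poly_Mapping.keys q"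
  proof
    fix k assume "k \<in> {k. c k \<noteq> 0}"
    then show "k \<in> Poly_Mapping.keys r \<union> (\<lambda>(a, b). (a, Suc b)) ` Poly_Mapping.keys q"
      by (cases k; cases "snd k") (auto simp: c_def in_keys_iff image_iff intro!: bexI[of _ "(fst k, snd k - 1)"])
  qed
  then have "finite {k. c k \<noteq> 0}" by (rule finite_subset) auto
  then obtain P where "\<And>k. lookup P k = c k" using poly2_of_fun by blast
  then show ?thesis by (intro that[of P] poly2_eqI) (auto simp: lookup_dY c_def simp del: of_nat_Suc)
qed

lemma eval2_cong_0:
  "(\<And>b. lookup p (0, b) = lookup r (0, b)) \<Longrightarrow> eval2 p 0 v = eval2 r 0 v"
  "(\<And>a. lookup p (a, 0) = lookup r (a, 0)) \<Longrightarrow> eval2 p u 0 = eval2 r u 0"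
proof -
  have S: "finite (Poly_Mapping.keys p \<union> Poly_Mapping.keys r)" by simp
  show "(\<And>b. lookup p (0, b) = lookup r (0, b)) \<Longrightarrow> eval2 p 0 v = eval2 r 0 v"
    by (subst (1 2) eval2_superset[OF S]) (auto simp: zero_power_eq intro!: sum.cong)
  show "(\<And>a. lookup p (a, 0) = lookup r (a, 0)) \<Longrightarrow> eval2 p u 0 = eval2 r u 0"
    by (subst (1 2) eval2_superset[OF S]) (auto simp: zero_power_eq intro!: sum.cong)
qed

text \<open>The orders in x and in y are bounded separately, so that an induction can integrate in
  one variable at a time.\<close>

definition poly_approximable :: "nat \<Rightarrow> nat \<Rightarrow> plane_fun \<Rightarrow> bool" where
  "poly_approximable n m f \<longleftrightarrow> (\<forall>\<epsilon>>0. \<forall>R>0. \<exists>p. \<forall>i\<le>n. \<forall>j\<le>m. \<forall>x y. \<bar>x\<bar> \<le> R \<longrightarrow> \<bar>y\<bar> \<le> R \<longrightarrow>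
     cmod (partial i j (poly_xy p) (x, y) - partial i j f (x, y)) \<le> \<epsilon>)"

lemma poly_approximableE:
  assumes "poly_approximable n m f" "\<epsilon> > 0" "R > 0"
  obtains p where "\<And>i j x y. i \<le> n \<Longrightarrow> j \<le> m \<Longrightarrow> \<bar>x\<bar> \<le> R \<Longrightarrow> \<bar>y\<bar> \<le> R \<Longrightarrow>
    cmod (partial i j (poly_xy p) (x, y) - partial i j f (x, y)) \<le> \<epsilon>"
  using assms unfolding poly_approximable_def by meson

text \<open>An approximation of the x-derivative is integrated, with an approximation of
  \<open>f\<close> on the y axis as initial value. The mean value inequality bounds the error by
  \<open>\<delta> * R\<close> plus the error \<open>\<delta>\<close> on the axis.\<close>

lemma poly_approximable_step_x:
  assumes f: "smooth f" and "poly_approximable n m (pdx f)" "poly_approximable 0 m f"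
  shows "poly_approximable (Suc n) m f"
  unfolding poly_approximable_def
proof (intro allI impI)
  fix \<epsilon> R :: real assume "\<epsilon> > 0" "R > 0"
  define \<delta> where "\<delta> = \<epsilon> / (1 + R)"
  have \<delta>: "\<delta> > 0" "\<delta> \<le> \<epsilon>" "\<delta> * (1 + R) = \<epsilon>" using \<open>\<epsilon> > 0\<close> \<open>R > 0\<close> by (simp_all add: \<delta>_def field_simps)
  obtain q where q: "\<And>i j x y. i \<le> n \<Longrightarrow> j \<le> m \<Longrightarrow> \<bar>x\<bar> \<le> R \<Longrightarrow> \<bar>y\<bar> \<le> R \<Longrightarrow>
    cmod (partial i j (poly_xy q) (x, y) - partial i j (pdx f) (x, y)) \<le> \<delta>"
    using poly_approximableE[OF assms(2) \<delta>(1) \<open>R > 0\<close>] by blast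
  obtain r where r: "\<And>i j x y. i \<le> 0 \<Longrightarrow> j \<le> m \<Longrightarrow> \<bar>x\<bar> \<le> R \<Longrightarrow> \<bar>y\<bar> \<le> R \<Longrightarrow>
    cmod (partial i j (poly_xy r) (x, y) - partial i j f (x, y)) \<le> \<delta>"
    using poly_approximableE[OF assms(3) \<delta>(1) \<open>R > 0\<close>] by blast
  obtain P where P: "dX P = q" "\<And>b. lookup P (0, b) = lookup r (0, b)" by (rule poly2_extension_x[of q r]) blast
  have dxP: "partial (Suc i) j (poly_xy P) = partial i j (poly_xy q)" for i j
    by (simp add: partial_Suc_left smooth_poly_xy pd_poly_xy P)
  have "cmod (partial i j (poly_xy P) (x, y) - partial i j f (x, y)) \<le> \<epsilon>"
    if ij: "i \<le> Suc n" "j \<le> m" and xy: "\<bar>x\<bar> \<le> R" "\<bar>y\<bar> \<le> R" for i j x y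
  proof (cases i)
    case (Suc i')
    then show ?thesis
      using q[of i' j x y] ij xy \<delta>(2) by (simp add: dxP partial_Suc_left[OF f])
  next
    case 0
    define h where "h = partial 0 j (\<lambda>p. poly_xy P p - f p)"
    have h: "smooth h" unfolding h_def by (intro smooth_partial smooth_diff smooth_poly_xy f)
    have h_eq: "h = (\<lambda>p. partial 0 j (poly_xy P) p - partial 0 j f p)"
      unfolding h_def by (rule partial_diff[OF smooth_poly_xy f])
    have "pdx h = partial (Suc 0) j (\<lambda>p. poly_xy P p - f p)"
      by (simp add: h_def partial_def)
    also have "\<dots> = (\<lambda>p. partial 0 j (poly_xy q) p - partial 0 j (pdx f) p)"
      by (simp add: partial_diff[OF smooth_poly_xy f] dxP partial_Suc_left[OF f])
    finally have dh: "pdx h = (\<lambda>p. partial 0 j (poly_xy q) p - partial 0 j (pdx f) p)" .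
    have "cmod (h (x, y) - h (0, y)) \<le> \<delta> * R"
      by (rule mvt_x[OF h xy(1)]) (use q[of 0 j _ y] ij xy in \<open>simp add: dh\<close>)
    moreover have "cmod (h (0, y)) \<le> \<delta>"
    proof -
      have "partial 0 j (poly_xy P) (0, y) = partial 0 j (poly_xy r) (0, y)"
        unfolding partial_poly_xy unfolding poly_xy_def
        by (simp, rule eval2_cong_0, simp add: lookup_dY_funpow P)
      then show ?thesis using r[of 0 j 0 y] ij xy \<open>R > 0\<close> by (simp add: h_eq)
    qed
    ultimately have "cmod (h (x, y)) \<le> \<delta> * R + \<delta>"
      using norm_triangle_ineq[of "h (x, y) - h (0, y)" "h (0, y)"] by simp
    then show ?thesis using 0 \<delta>(3) by (simp add: h_eq algebra_simps)
  qed
  then show "\<exists>p. \<forall>i\<le>Suc n. \<forall>j\<le>m. \<forall>x y. \<bar>x\<bar> \<le> R \<longrightarrow> \<bar>y\<bar> \<le> R \<longrightarrow>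
     cmod (partial i j (poly_xy p) (x, y) - partial i j f (x, y)) \<le> \<epsilon>" by blast
qed

lemma poly_approximable_step_y:
  assumes f: "smooth f" and "poly_approximable 0 m (pdy f)" "poly_approximable 0 0 f"
  shows "poly_approximable 0 (Suc m) f"
  unfolding poly_approximable_def
proof (intro allI impI)
  fix \<epsilon> R :: real assume "\<epsilon> > 0" "R > 0"
  define \<delta> where "\<delta> = \<epsilon> / (1 + R)"
  have \<delta>: "\<delta> > 0" "\<delta> \<le> \<epsilon>" "\<delta> * (1 + R) = \<epsilon>" using \<open>\<epsilon> > 0\<close> \<open>R > 0\<close> by (simp_all add: \<delta>_def field_simps)
  obtain q where q: "\<And>i j x y. i \<le> 0 \<Longrightarrow> j \<le> m \<Longrightarrow> \<bar>x\<bar> \<le> R \<Longrightarrow> \<bar>y\<bar> \<le> R \<Longrightarrow>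
    cmod (partial i j (poly_xy q) (x, y) - partial i j (pdy f) (x, y)) \<le> \<delta>"
    using poly_approximableE[OF assms(2) \<delta>(1) \<open>R > 0\<close>] by blast
  obtain r where r: "\<And>i j x y. i \<le> 0 \<Longrightarrow> j \<le> 0 \<Longrightarrow> \<bar>x\<bar> \<le> R \<Longrightarrow> \<bar>y\<bar> \<le> R \<Longrightarrow>
    cmod (partial i j (poly_xy r) (x, y) - partial i j f (x, y)) \<le> \<delta>"
    using poly_approximableE[OF assms(3) \<delta>(1) \<open>R > 0\<close>] by blast
  obtain P where P: "dY P = q" "\<And>a. lookup P (a, 0) = lookup r (a, 0)" by (rule poly2_extension_y[of q r]) blast
  have "cmod (partial i j (poly_xy P) (x, y) - partial i j f (x, y)) \<le> \<epsilon>"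
    if ij: "i \<le> 0" "j \<le> Suc m" and xy: "\<bar>x\<bar> \<le> R" "\<bar>y\<bar> \<le> R" for i j x y
  proof (cases j)
    case (Suc j')
    then show ?thesis
      using q[of i j' x y] ij xy \<delta>(2) by (simp add: partial_Suc_right pd_poly_xy P)
  next
    case 0
    define h where "h = (\<lambda>p. poly_xy P p - f p)"
    have h: "smooth h" unfolding h_def by (intro smooth_diff smooth_poly_xy f)
    have "pdy h = partial 0 (Suc 0) (\<lambda>p. poly_xy P p - f p)"
      by (simp add: h_def partial_def)
    also have "\<dots> = (\<lambda>p. poly_xy q p - pdy f p)"
      by (simp add: partial_diff[OF smooth_poly_xy f] partial_Suc_right pd_poly_xy P)
    finally have dh: "pdy h = (\<lambda>p. poly_xy q p - pdy f p)" .
    have "cmod (h (x, y) - h (x, 0)) \<le> \<delta> * R"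
      by (rule mvt_y[OF h xy(2)]) (use q[of 0 0 x] ij xy in \<open>simp add: dh\<close>)
    moreover have "cmod (h (x, 0)) \<le> \<delta>"
    proof -
      have "poly_xy P (x, 0) = poly_xy r (x, 0)"
        by (simp add: poly_xy_def) (rule eval2_cong_0, simp add: P)
      then show ?thesis using r[of 0 0 x 0] ij xy \<open>R > 0\<close> by (simp add: h_def)
    qed
    ultimately have "cmod (h (x, y)) \<le> \<delta> * R + \<delta>"
      using norm_triangle_ineq[of "h (x, y) - h (x, 0)" "h (x, 0)"] by simp
    then show ?thesis using 0 ij \<delta>(3) by (simp add: h_def algebra_simps)
  qed
  then show "\<exists>p. \<forall>i\<le>0. \<forall>j\<le>Suc m. \<forall>x y. \<bar>x\<bar> \<le> R \<longrightarrow> \<bar>y\<bar> \<le> R \<longrightarrow>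
     cmod (partial i j (poly_xy p) (x, y) - partial i j f (x, y)) \<le> \<epsilon>" by blast
qed

lemma range_poly_xy_add:
  assumes "f \<in> range poly_xy" "g \<in> range poly_xy" shows "(\<lambda>p. f p + g p) \<in> range poly_xy"
proof -
  obtain p q where "f = poly_xy p" "g = poly_xy q" using assms by blast
  then have "(\<lambda>p. f p + g p) = poly_xy (p + q)"
    by (auto simp: poly_xy_def eval2_add)
  then show ?thesis by simp
qed

lemma range_poly_xy_monomial: "(\<lambda>(x, y). c * of_real x ^ a * of_real y ^ b) \<in> range poly_xy"
  by (rule image_eqI[of _ _ "Poly_Mapping.single (a, b) c"]) (auto simp: poly_xy_def eval2_single)

lemma range_poly_xy_sum: "(\<And>x. x \<in> X \<Longrightarrow> f x \<in> range poly_xy) \<Longrightarrow> (\<lambda>p. \<Sum>x\<in>X. f x p) \<in> range poly_xy"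
proof -
  have "(\<lambda>p. 0) \<in> range poly_xy" using range_poly_xy_monomial[of 0 0 0] by (simp add: case_prod_unfold)
  then show "(\<And>x. x \<in> X \<Longrightarrow> f x \<in> range poly_xy) \<Longrightarrow> (\<lambda>p. \<Sum>x\<in>X. f x p) \<in> range poly_xy"
    by (induction X rule: infinite_finite_induct) (auto intro!: range_poly_xy_add)
qed

lemma range_poly_xy_mult:
  assumes "f \<in> range poly_xy" "g \<in> range poly_xy" shows "(\<lambda>p. f p * g p) \<in> range poly_xy"
proof -
  obtain p q where fg: "f = poly_xy p" "g = poly_xy q" using assms by blast
  have "(\<lambda>z. f z * g z) = (\<lambda>z. \<Sum>k\<in>Poly_Mapping.keys p. \<Sum>l\<in>Poly_Mapping.keys q.
      (\<lambda>(x, y). (lookup p k * lookup q l) * of_real x ^ (fst k + fst l) * of_real y ^ (snd k + snd l)) z)"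
    by (simp add: fun_eq_iff fg poly_xy_def eval2_def sum_product power_add ac_simps)
  also have "\<dots> \<in> range poly_xy"
    by (intro range_poly_xy_sum range_poly_xy_monomial)
  finally show ?thesis .
qed

text \<open>Stone-Weierstrass; it remains to see that the real and imaginary parts of a polynomial
  function on the plane are of the form \<open>poly_xy\<close>.\<close>

lemma poly_approximable_0_0:
  assumes "continuous_on UNIV f" shows "poly_approximable 0 0 f"
  unfolding poly_approximable_def
proof (intro allI impI)
  fix \<epsilon> R :: real assume "\<epsilon> > 0" "R > 0"
  have real: "(\<lambda>z. complex_of_real (g z)) \<in> range poly_xy" if "real_polynomial_function g" for g :: "real \<times> real \<Rightarrow> real"
    using that
  proof induction
    case (linear g)
    interpret bounded_linear g by fact
    have lin: "g (x, y) = x * g (1, 0) + y * g (0, 1)" for x y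
      using add[of "x *\<^sub>R (1, 0)" "y *\<^sub>R (0, 1)"] scaleR[of x "(1,0)"] scaleR[of y "(0,1)"] by simp
    have "(\<lambda>z. complex_of_real (g z)) = (\<lambda>z. (\<lambda>(x, y). complex_of_real (g (1, 0)) * complex_of_real x ^ 1 * complex_of_real y ^ 0) z +
        (\<lambda>(x, y). complex_of_real (g (0, 1)) * complex_of_real x ^ 0 * complex_of_real y ^ 1) z)"
    proof (rule ext, clarify)
      fix a b :: real
      show "complex_of_real (g (a, b)) = complex_of_real (g (1, 0)) * complex_of_real a ^ 1 * complex_of_real b ^ 0 +
          complex_of_real (g (0, 1)) * complex_of_real a ^ 0 * complex_of_real b ^ 1"
        unfolding lin[of a b] by (simp add: mult.commute)
    qed
    moreover have "\<dots> \<in> range poly_xy" by (rule range_poly_xy_add; rule range_poly_xy_monomial)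
    ultimately show ?case by (simp only:)
  next
    case (const c)
    have "(\<lambda>(x, y). of_real c * of_real x ^ 0 * of_real y ^ 0) = (\<lambda>z. complex_of_real c)" by auto
    then show ?case using range_poly_xy_monomial[of "of_real c" 0 0] by metis
  next
    case (add f g)
    then show ?case using range_poly_xy_add by simp
  next
    case (mult f g)
    then show ?case using range_poly_xy_mult by simp
  qed
  have "compact ({-R..R} \<times> {-R..R})" by (intro compact_Times compact_Icc)
  moreover have "continuous_on ({-R..R} \<times> {-R..R}) f" using assms by (rule continuous_on_subset) simp
  ultimately have "\<exists>g. polynomial_function g \<and> (\<forall>z\<in>{-R..R} \<times> {-R..R}. cmod (f z - g z) < \<epsilon>)"
    using \<open>\<epsilon> > 0\<close> by (rule Stone_Weierstrass_polynomial_function)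
  then obtain g where g: "polynomial_function g" "\<And>z. z \<in> {-R..R} \<times> {-R..R} \<Longrightarrow> cmod (f z - g z) < \<epsilon>"
    by meson
  have "real_polynomial_function (\<lambda>z. Re (g z))" "real_polynomial_function (\<lambda>z. Im (g z))"
    using g(1) bounded_linear_Re bounded_linear_Im unfolding polynomial_function_def comp_def by blast+
  then have "(\<lambda>z. complex_of_real (Re (g z)) + (\<lambda>(x, y). \<i> * of_real x ^ 0 * of_real y ^ 0) z * complex_of_real (Im (g z))) \<in> range poly_xy"
    by (rule range_poly_xy_add[OF real range_poly_xy_mult[OF range_poly_xy_monomial real]])
  also have "(\<lambda>z. complex_of_real (Re (g z)) + (\<lambda>(x, y). \<i> * of_real x ^ 0 * of_real y ^ 0) z * complex_of_real (Im (g z))) = g"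
    by (rule ext) (simp add: complex_eq[symmetric] case_prod_unfold)
  finally obtain p where "g = poly_xy p" by blast
  then show "\<exists>p. \<forall>i\<le>0. \<forall>j\<le>0. \<forall>x y. \<bar>x\<bar> \<le> R \<longrightarrow> \<bar>y\<bar> \<le> R \<longrightarrow>
     cmod (partial i j (poly_xy p) (x, y) - partial i j f (x, y)) \<le> \<epsilon>"
  proof (intro exI[of _ p] allI impI)
    fix i j :: nat and x y :: real
    assume "i \<le> 0" "j \<le> 0" "\<bar>x\<bar> \<le> R" "\<bar>y\<bar> \<le> R"
    then show "cmod (partial i j (poly_xy p) (x, y) - partial i j f (x, y)) \<le> \<epsilon>"
      using g(2)[of "(x, y)"] \<open>g = poly_xy p\<close> by (simp add: norm_minus_commute abs_le_iff less_imp_le)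
  qed
qed

lemma poly_approximable:
  assumes "smooth f" shows "poly_approximable n m f"
proof -
  have "poly_approximable 0 m f" if "smooth f" for m f
    using that
  proof (induction m arbitrary: f)
    case 0
    then show ?case by (intro poly_approximable_0_0 smooth_continuous)
  next
    case (Suc m)
    then show ?case by (simp add: poly_approximable_step_y smooth_pdy poly_approximable_0_0 smooth_continuous)
  qed
  then show ?thesis using assms
    by (induction n arbitrary: f) (auto intro: poly_approximable_step_x smooth_pdx)
qed

lemma poly_xy_minus:
  assumes "even_poly p" shows "poly_xy p (- q) = poly_xy p q"
proof -
  have "(- 1) ^ fst k * (- 1 :: complex) ^ snd k = 1" if "k \<in> Poly_Mapping.keys p" for k
    using assms that by (auto simp: even_poly_def power_add[symmetric])
  then have "lookup p k * (- u) ^ fst k * (- v) ^ snd k = lookup p k * u ^ fst k * v ^ snd k"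
    if "k \<in> Poly_Mapping.keys p" for k u v
    using that unfolding power_minus[of u] power_minus[of v] by (simp add: algebra_simps)
  then show ?thesis
    by (cases q) (auto simp: poly_xy_def eval2_def intro!: sum.cong)
qed

text \<open>The even part of an approximating polynomial is used. Averaging does not increase the
  error, because the square is symmetric and the derivatives of an even function of order i + j have
  parity (-1)^(i + j).\<close>

lemma even_poly_approximation:
  assumes f: "smooth f" and even: "\<And>p. f (- p) = f p" and "\<epsilon> > 0" "R > 0"
  obtains p where "even_poly p" "\<And>i j x y. i \<le> n \<Longrightarrow> j \<le> n \<Longrightarrow> \<bar>x\<bar> \<le> R \<Longrightarrow> \<bar>y\<bar> \<le> R \<Longrightarrow>
    cmod (partial i j (poly_xy p) (x, y) - partial i j f (x, y)) \<le> \<epsilon>"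
proof -
  obtain q where q: "\<And>i j x y. i \<le> n \<Longrightarrow> j \<le> n \<Longrightarrow> \<bar>x\<bar> \<le> R \<Longrightarrow> \<bar>y\<bar> \<le> R \<Longrightarrow>
    cmod (partial i j (poly_xy q) (x, y) - partial i j f (x, y)) \<le> \<epsilon>"
    using poly_approximableE[OF poly_approximable[OF f] assms(3,4)] by blast
  have "finite {k. (if even (fst k + snd k) then lookup q k else 0) \<noteq> 0}"
    by (rule finite_subset[of _ "Poly_Mapping.keys q"]) (rule subsetI, simp add: in_keys_iff, metis, simp)
  from poly2_of_fun[OF this]
  obtain p where p: "\<And>k. lookup p k = (if even (fst k + snd k) then lookup q k else 0)"
    by blast
  have "even_poly p" unfolding even_poly_def by (metis in_keys_iff p)
  have kp: "Poly_Mapping.keys p \<subseteq> Poly_Mapping.keys q" by (metis in_keys_iff p subsetI)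
  have "poly_xy p = (\<lambda>z. 1/2 * (poly_xy q z + poly_xy q (- z)))"
  proof (safe intro!: ext)
    fix x y
    have "2 * eval2 p (of_real x) (of_real y) = eval2 q (of_real x) (of_real y) + eval2 q (- of_real x) (- of_real y)"
    proof -
      have "2 * (lookup p k * u ^ fst k * v ^ snd k) =
          lookup q k * u ^ fst k * v ^ snd k + lookup q k * (- u) ^ fst k * (- v) ^ snd k" for k and u v :: complex
      proof -
        have "(- 1) ^ fst k * (- 1 :: complex) ^ snd k = (if even (fst k + snd k) then 1 else - 1)"
          by (simp add: power_add[symmetric] minus_one_power_iff)
        then have eq: "lookup q k * (- u) ^ fst k * (- v) ^ snd k =
            (if even (fst k + snd k) then 1 else - 1) * (lookup q k * u ^ fst k * v ^ snd k)"
          unfolding power_minus[of u] power_minus[of v] by (simp add: algebra_simps)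
        show ?thesis unfolding eq p by (cases "even (fst k + snd k)") simp_all
      qed
      then show ?thesis
        unfolding eval2_superset[OF finite_keys kp] eval2_def[of q] sum_distrib_left sum.distrib[symmetric] by simp
    qed
    then show "poly_xy p (x, y) = 1/2 * (poly_xy q (x, y) + poly_xy q (- (x, y)))"
      by (simp add: poly_xy_def mult.commute)
  qed
  then have pq: "partial i j (poly_xy p) z = 1/2 * (partial i j (poly_xy q) z + (- 1) ^ (i + j) * partial i j (poly_xy q) (- z))" for i j z
    by (simp only: partial_cmult partial_add smooth_add smooth_minus_arg smooth_poly_xy partial_minus_arg)
  have ff: "partial i j f z = 1/2 * (partial i j f z + (- 1) ^ (i + j) * partial i j f (- z))" for i j z
    using fun_cong[OF partial_minus_arg[OF f, of i j], of z] by (simp only: even) simp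
  have "cmod (partial i j (poly_xy p) (x, y) - partial i j f (x, y)) \<le> \<epsilon>"
    if "i \<le> n" "j \<le> n" "\<bar>x\<bar> \<le> R" "\<bar>y\<bar> \<le> R" for i j x y
  proof -
    define D where "D = (\<lambda>z. partial i j (poly_xy q) z - partial i j f z)"
    have "partial i j (poly_xy p) (x, y) - partial i j f (x, y) = 1/2 * (D (x, y) + (- 1) ^ (i + j) * D (- (x, y)))"
      by (subst ff, subst pq) (simp add: D_def algebra_simps)
    also have "cmod \<dots> \<le> 1/2 * (cmod (D (x, y)) + cmod (D (- (x, y))))"
      using norm_triangle_ineq[of "D (x, y)" "(- 1) ^ (i + j) * D (- (x, y))"]
      by (simp add: norm_mult norm_power)
    also have "\<dots> \<le> \<epsilon>" using q[OF that] q[of i j "- x" "- y"] that by (simp add: D_def)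
    finally show ?thesis .
  qed
  with \<open>even_poly p\<close> show ?thesis by (rule that)
qed

section \<open>Even smooth functions, bounded sets and density of polynomials\<close>

lemma es_fun_smooth: "smooth (es_fun f)" and es_fun_even: "es_fun f (- p) = es_fun f p"
  using es_fun[of f] by (auto simp del: split_paired_All)

lemma es_fun_Abs: "smooth f \<Longrightarrow> (\<And>p. f (- p) = f p) \<Longrightarrow> es_fun (Abs_even_smooth f) = f"
  by (rule Abs_even_smooth_inverse) (simp del: split_paired_All)

lemma es_eqI: "(\<And>p. es_fun f p = es_fun g p) \<Longrightarrow> f = g"
  by (simp add: es_fun_inject[symmetric] fun_eq_iff)

lemmas es_fun_simps = plus_even_smooth.rep_eq times_even_smooth.rep_eq minus_even_smooth.rep_eq
  uminus_even_smooth.rep_eq zero_even_smooth.rep_eq one_even_smooth.rep_eq es_const.rep_eq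

definition es_poly :: "poly2 \<Rightarrow> even_smooth" where
  "es_poly p = Abs_even_smooth (poly_xy p)"

lemma es_fun_es_poly: "even_poly p \<Longrightarrow> es_fun (es_poly p) = poly_xy p"
  unfolding es_poly_def by (intro es_fun_Abs smooth_poly_xy poly_xy_minus)

lemma es_const_0 [simp]: "es_const 0 = 0" and es_const_add: "es_const (a + b) = es_const a + es_const b"
  and es_const_mult: "es_const (a * b) = es_const a * es_const b" and es_const_1 [simp]: "es_const 1 = 1"
  by (auto intro!: es_eqI simp: es_fun_simps)

lemma partial_es_cmult: "partial i j (es_fun (es_const c * f)) = (\<lambda>p. c * partial i j (es_fun f) p)"
proof -
  have "es_fun (es_const c * f) = (\<lambda>p. c * es_fun f p)" by (auto simp: es_fun_simps)
  then show ?thesis by (simp add: partial_cmult es_fun_smooth)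
qed

lemma partial_es_add: "partial i j (es_fun (f + g)) p = partial i j (es_fun f) p + partial i j (es_fun g) p"
  and partial_es_diff: "partial i j (es_fun (f - g)) p = partial i j (es_fun f) p - partial i j (es_fun g) p"
  using partial_add[of "es_fun f" "es_fun g" i j] partial_diff[of "es_fun f" "es_fun g" i j]
  by (simp_all add: es_fun_smooth plus_even_smooth.rep_eq[abs_def] minus_even_smooth.rep_eq[abs_def])

lemma es_bounded_iff:
  "es_bounded S \<longleftrightarrow> (\<forall>K i j. compact K \<longrightarrow> (\<exists>B. \<forall>f\<in>S. \<forall>p\<in>K. cmod (partial i j (es_fun f) p) \<le> B))"
proof -
  have "(\<forall>x\<in>{partial i j (es_fun f) p | f p. f \<in> S \<and> p \<in> K}. cmod x \<le> B) \<longleftrightarrow>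
      (\<forall>f\<in>S. \<forall>p\<in>K. cmod (partial i j (es_fun f) p) \<le> B)" for i j K B
    by blast
  then show ?thesis unfolding es_bounded_def bounded_iff by (simp only:)
qed

lemma es_bounded_finite: "finite S \<Longrightarrow> es_bounded S"
proof (unfold es_bounded_iff, intro allI impI)
  fix K :: "(real \<times> real) set" and i j assume S: "finite S" and K: "compact K"
  have "\<exists>B. \<forall>p\<in>K. cmod (partial i j (es_fun f) p) \<le> B" for f
  proof -
    have "compact (partial i j (es_fun f) ` K)"
      using K smooth_continuous[OF smooth_partial[OF es_fun_smooth]]
      by (intro compact_continuous_image) (auto intro: continuous_on_subset)
    then show ?thesis using compact_imp_bounded bounded_iff by (metis image_eqI)
  qed
  then obtain B where B: "\<And>f p. p \<in> K \<Longrightarrow> cmod (partial i j (es_fun f) p) \<le> B f" by metis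
  have "B f \<le> (\<Sum>g\<in>S. \<bar>B g\<bar>)" if "f \<in> S" for f
    using member_le_sum[of f S "\<lambda>g. \<bar>B g\<bar>"] that S by auto
  then show "\<exists>B. \<forall>f\<in>S. \<forall>p\<in>K. cmod (partial i j (es_fun f) p) \<le> B" using B order_trans by blast
qed

lemma es_bounded_mono: "es_bounded T \<Longrightarrow> S \<subseteq> T \<Longrightarrow> es_bounded S"
  unfolding es_bounded_iff by (meson subsetD)

lemma es_bounded_Un: "es_bounded S \<Longrightarrow> es_bounded T \<Longrightarrow> es_bounded (S \<union> T)"
proof (unfold es_bounded_iff, intro allI impI)
  fix K :: "(real \<times> real) set" and i j assume K: "compact K"
  assume "\<forall>K i j. compact K \<longrightarrow> (\<exists>B. \<forall>f\<in>S. \<forall>p\<in>K. cmod (partial i j (es_fun f) p) \<le> B)"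
    "\<forall>K i j. compact K \<longrightarrow> (\<exists>B. \<forall>f\<in>T. \<forall>p\<in>K. cmod (partial i j (es_fun f) p) \<le> B)"
  with K obtain B B' where "\<forall>f\<in>S. \<forall>p\<in>K. cmod (partial i j (es_fun f) p) \<le> B"
    "\<forall>f\<in>T. \<forall>p\<in>K. cmod (partial i j (es_fun f) p) \<le> B'" by metis
  then show "\<exists>B. \<forall>f\<in>S\<union>T. \<forall>p\<in>K. cmod (partial i j (es_fun f) p) \<le> B"
    by (intro exI[of _ "max B B'"]) (fastforce simp: le_max_iff_disj)
qed

text \<open>Even polynomials are sequentially dense in the Mackey sense: the errors tend to zero faster
  than the elements of a bounded sequence are scaled up.\<close>

lemma es_poly_Mackey_dense:
  obtains p where "\<And>k. even_poly (p k)" "es_bounded (range (\<lambda>k. es_const (2 ^ k) * (f - es_poly (p k))))"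
proof -
  have "\<exists>p. even_poly p \<and> (\<forall>i\<le>k. \<forall>j\<le>k. \<forall>x y. \<bar>x\<bar> \<le> real (Suc k) \<longrightarrow> \<bar>y\<bar> \<le> real (Suc k) \<longrightarrow>
    cmod (partial i j (poly_xy p) (x, y) - partial i j (es_fun f) (x, y)) \<le> (1/2) ^ k)" for k
  proof -
    have pos: "(0 :: real) < (1/2) ^ k" "0 < real (Suc k)" by auto
    show ?thesis
      by (rule even_poly_approximation[OF es_fun_smooth[of f] es_fun_even[of f] pos, of k]) blast
  qed
  then obtain p where p: "\<And>k. even_poly (p k)" "\<And>k i j x y. i \<le> k \<Longrightarrow> j \<le> k \<Longrightarrow> \<bar>x\<bar> \<le> real (Suc k) \<Longrightarrow> \<bar>y\<bar> \<le> real (Suc k) \<Longrightarrow>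
    cmod (partial i j (poly_xy (p k)) (x, y) - partial i j (es_fun f) (x, y)) \<le> (1/2) ^ k"
    by metis
  define g where "g = (\<lambda>k. es_const (2 ^ k) * (f - es_poly (p k)))"
  have "es_bounded (range g)"
    unfolding es_bounded_iff
  proof (intro allI impI)
    fix K :: "(real \<times> real) set" and i j assume K: "compact K"
    then obtain R where R: "\<And>z. z \<in> K \<Longrightarrow> norm z \<le> R" using compact_imp_bounded bounded_iff by metis
    \<comment> \<open>From \<open>k0\<close> on, the k-th square contains \<open>K\<close> and the
      orders \<open>i\<close>, \<open>j\<close> are at most k; the earlier terms are finitely
      many.\<close>
    define k0 where "k0 = max (max i j) (nat \<lceil>R\<rceil>)"
    have "es_bounded (g ` {..<k0})" by (rule es_bounded_finite) simp
    then obtain B where B: "\<And>k z. k < k0 \<Longrightarrow> z \<in> K \<Longrightarrow> cmod (partial i j (es_fun (g k)) z) \<le> B"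
      using K unfolding es_bounded_iff by (metis imageI lessThan_iff)
    have "cmod (partial i j (es_fun (g k)) z) \<le> 1" if k: "k \<ge> k0" and "z \<in> K" for k z
    proof (cases z)
      case (Pair x y)
      have "R \<le> real (Suc k)" "i \<le> k" "j \<le> k" using k unfolding k0_def by linarith+
      then have "\<bar>x\<bar> \<le> real (Suc k)" "\<bar>y\<bar> \<le> real (Suc k)"
        using R[OF \<open>z \<in> K\<close>] norm_fst_le[of x y] norm_snd_le[of y x] Pair by auto
      from p(2)[OF \<open>i \<le> k\<close> \<open>j \<le> k\<close> this]
      have "2 ^ k * cmod (partial i j (es_fun f) z - partial i j (poly_xy (p k)) z) \<le> 2 ^ k * (1/2) ^ k"
        by (intro mult_left_mono) (simp_all add: Pair norm_minus_commute)
      then show ?thesis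
        by (simp add: g_def partial_es_cmult partial_es_diff es_fun_es_poly[OF p(1)] norm_mult norm_power power_mult_distrib[symmetric])
    qed
    then have "cmod (partial i j (es_fun (g k)) z) \<le> max B 1" if "z \<in> K" for k z
      using B[of k z] that unfolding le_max_iff_disj by (cases "k < k0") auto
    then show "\<exists>B. \<forall>f\<in>range g. \<forall>p\<in>K. cmod (partial i j (es_fun f) p) \<le> B" by blast
  qed
  with p(1) show ?thesis unfolding g_def by (rule that)
qed

text \<open>On the bounded sequence of scaled approximation errors the values are
  \<open>2 ^ k * u f\<close>, and these stay bounded only if \<open>u f = 0\<close>.\<close>

lemma bounded_functional_eq_0:
  fixes u :: "even_smooth \<Rightarrow> complex"
  assumes add: "\<And>f g. u (f + g) = u f + u g" and cmult: "\<And>c f. u (es_const c * f) = c * u f"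
    and bdd: "\<And>S. es_bounded S \<Longrightarrow> bounded (u ` S)"
    and poly: "\<And>p. even_poly p \<Longrightarrow> u (es_poly p) = 0"
  shows "u f = 0"
proof -
  obtain p where p: "\<And>k. even_poly (p k)" "es_bounded (range (\<lambda>k. es_const (2 ^ k) * (f - es_poly (p k))))"
    using es_poly_Mackey_dense by blast
  have "u (f - g) = u f - u g" for f g using add[of "f - g" g] by simp
  then have u: "u (es_const (2 ^ k) * (f - es_poly (p k))) = 2 ^ k * u f" for k
    by (simp add: cmult poly p(1))
  from bdd[OF p(2)] obtain B where B: "\<And>k. cmod (2 ^ k * u f) \<le> B"
    unfolding bounded_iff by (auto simp: u)
  show ?thesis
  proof (rule ccontr)
    assume "u f \<noteq> 0"
    then obtain k where "B / cmod (u f) < 2 ^ k" using real_arch_pow[of 2 "B / cmod (u f)"] by auto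
    then show False using B[of k] \<open>u f \<noteq> 0\<close> by (simp add: norm_mult norm_power divide_less_eq)
  qed
qed

subsection \<open>Structure constants\<close>

type_synonym coeffs = "complex fls fls"
type_synonym dunkl_module = "nat \<Rightarrow> nat \<Rightarrow> coeffs"

text \<open>The scalar part of the commutator [y, x].\<close>

definition hh :: coeffs where "hh = const2 (1/2) * hbar1"
definition h2 :: coeffs where "h2 = hbar2"

lemma const2_0 [simp]: "const2 0 = 0" and const2_1 [simp]: "const2 1 = 1"
  by (simp_all add: const2_def)

lemma const2_add: "const2 (a + b) = const2 a + const2 b" for a b :: "'a::comm_monoid_add"
  by (rule fls2_eqI) (simp add: const2_def)

lemma const2_uminus: "const2 (- a) = - const2 a" for a :: "'a::ab_group_add"
  by (rule fls2_eqI) (simp add: const2_def)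

lemma const2_mult: "const2 (a * b) = const2 a * const2 b" for a b :: "'a::semiring_0"
  by (simp add: const2_def)

lemma const2_of_nat: "const2 (of_nat n) = of_nat n"
  by (simp add: const2_def fls_of_nat)

lemma const2_numeral: "const2 (numeral n) = numeral n" for n
  using const2_of_nat[of "numeral n"] by simp

lemma const2_nth: "const2 c $$ n $$ m = (if n = 0 \<and> m = 0 then c else 0)"
  by (simp add: const2_def)

lemma const2_eq_0_iff [simp]: "const2 c = 0 \<longleftrightarrow> c = 0"
  by (metis const2_0 const2_nth)

lemma two_hh: "hbar1 = 2 * hh"
proof -
  have "2 * const2 (1/2 :: complex) = 1"
    by (simp add: const2_numeral[symmetric] const2_mult[symmetric])
  then show ?thesis by (simp add: hh_def mult.assoc[symmetric])
qed

lemma hh_nonzero [simp]: "hh \<noteq> 0"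
  by (simp add: hh_def)

text \<open>\<open>y x^a y^b e = x^a y^(b+1) e + (\<hbar>1/2) (cc a b) x^(a-1) y^b e\<close>\<close>

definition cc :: "nat \<Rightarrow> nat \<Rightarrow> coeffs" where
  "cc a b = of_nat a + (if odd a then 2 * h2 * (- 1) ^ b else 0)"

definition rr :: "nat \<Rightarrow> coeffs" where
  "rr l = of_nat l / 2 + (- 1) ^ (l + 1) * (2 * of_int \<lfloor>(real l + 1) / 2\<rfloor> * hbar2) / (of_nat l + 1)"

text \<open>\<open>x^a y^b e x^2 = x^(a+2) y^b e + \<hbar>1 b x^(a+1) y^(b-1) e + (\<hbar>1^2/2) (dd b) x^a y^(b-2) e\<close>\<close>

definition dd :: "nat \<Rightarrow> coeffs" where
  "dd b = of_nat (b * (b - 1)) / 2 + 2 * h2 * (- 1) ^ b * of_nat (b div 2)"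

lemma of_nat_Suc_nonzero: "of_nat k + 1 \<noteq> (0 :: coeffs)"
  using of_nat_neq_0[of k, where 'a=coeffs] by (simp add: add.commute)

lemma rr_eq: "(of_nat l + 1) * rr l = of_nat l * (of_nat l + 1) / 2 + 2 * h2 * (- 1) ^ (l + 1) * of_nat ((l + 1) div 2)"
proof -
  have fl: "\<lfloor>(real l + 1) / 2\<rfloor> = int ((l + 1) div 2)"
    using floor_divide_of_nat_eq[of "l + 1" 2, where 'a=real] by (simp add: add.commute)
  show ?thesis
    unfolding rr_def h2_def fl distrib_left[of "of_nat l + 1"] times_divide_eq_right
      nonzero_mult_div_cancel_left[OF of_nat_Suc_nonzero[of l]]
    by (simp add: algebra_simps)
qed

text \<open>With this identity the recursion of \<open>tau\<close> makes the trace cyclic in x^2;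
  \<open>cc_cc\<close> is the counterpart for y^2.\<close>

lemma dd_Suc: "dd (Suc l) = (of_nat l + 1) * rr l"
  unfolding rr_eq dd_def by (simp add: algebra_simps)

text \<open>The parity hypothesis replaces the sign (-1)^b, which \<gamma> produces on y^b e, by
  (-1)^a. Exactly one of a + 1 and a + 2 is odd, so the product is linear in
  \<open>h2\<close>.\<close>

lemma cc_cc: 
  assumes "even (a + b)"
  shows "cc (Suc a) b * cc (Suc (Suc a)) b = 2 * (of_nat (Suc (Suc a)) * rr (Suc a))"
proof -
  have "(- 1) ^ b = ((- 1) ^ a :: coeffs)" using assms by (auto simp: minus_one_power_iff)
  then have "cc (Suc a) b * cc (Suc (Suc a)) b = cc (Suc a) a * cc (Suc (Suc a)) a"
    by (simp add: cc_def)
  also have "\<dots> = 2 * (of_nat (Suc a) * (of_nat (Suc a) + 1) / 2 + 2 * h2 * (- 1) ^ (Suc a + 1) * of_nat ((Suc a + 1) div 2))"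
  proof (cases "even a")
    case True
    then obtain k where "a = 2 * k" by (elim evenE)
    then show ?thesis by (simp add: cc_def algebra_simps)
  next
    case False
    then obtain k where "a = 2 * k + 1" by (elim oddE)
    then show ?thesis by (simp add: cc_def algebra_simps)
  qed
  also have "\<dots> = 2 * (of_nat (Suc (Suc a)) * rr (Suc a))"
    unfolding rr_eq[symmetric] by (simp add: algebra_simps)
  finally show ?thesis .
qed

lemma cc_0 [simp]: "cc 0 b = 0"
  by (simp add: cc_def)

text \<open>Moving y past one more x adds 1 + 2 \<open>h2\<close> \<gamma>, evaluated on x^a y^b
  e.\<close>

lemma cc_Suc: "cc (Suc a) b = cc a b + 1 + 2 * h2 * (- 1) ^ (a + b)"
  by (auto simp: cc_def power_add)

lemma cc_add: "cc a (Suc b) + cc a b = 2 * of_nat a"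
  by (simp add: cc_def)

subsection \<open>The left regular module of the spherical subalgebra\<close>

text \<open>The function \<open>v\<close> stands for \<open>\<Sum>a b. v a b x^a y^b e\<close>.\<close>

definition XO :: "dunkl_module \<Rightarrow> dunkl_module" where
  "XO v a b = (case a of 0 \<Rightarrow> 0 | Suc a \<Rightarrow> v a b)"

definition YO :: "dunkl_module \<Rightarrow> dunkl_module" where
  "YO v a b = (case b of 0 \<Rightarrow> 0 | Suc b \<Rightarrow> v a b) + hh * cc (Suc a) b * v (Suc a) b"

text \<open>The action of \<gamma>, which fixes e.\<close>

definition PO :: "dunkl_module \<Rightarrow> dunkl_module" where
  "PO v a b = (- 1) ^ (a + b) * v a b"

definition klinear :: "(dunkl_module \<Rightarrow> dunkl_module) \<Rightarrow> bool" where
  "klinear T \<longleftrightarrow> (\<forall>c v w. T (\<lambda>a b. c * v a b + w a b) = (\<lambda>a b. c * T v a b + T w a b))"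

lemma klinear_XO: "klinear XO"
  by (auto simp: klinear_def XO_def fun_eq_iff split: nat.split)

lemma klinear_YO: "klinear YO"
  by (auto simp: klinear_def YO_def fun_eq_iff algebra_simps split: nat.split)

lemma klinearD:
  assumes "klinear T"
  shows "T (\<lambda>a b. v a b + w a b) = (\<lambda>a b. T v a b + T w a b)"
    and "T (\<lambda>a b. c * v a b) = (\<lambda>a b. c * T v a b)"
    and "T (\<lambda>a b. 0) = (\<lambda>a b. 0)"
    and "T (\<lambda>a b. v a b - w a b) = (\<lambda>a b. T v a b - T w a b)"
proof -
  note lin = assms[unfolded klinear_def, rule_format]
  show add: "T (\<lambda>a b. v a b + w a b) = (\<lambda>a b. T v a b + T w a b)" for v w
    using lin[of 1 v w] by simp
  show zero: "T (\<lambda>a b. 0) = (\<lambda>a b. 0)"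
    using lin[of "- 1" "\<lambda>a b. 0" "\<lambda>a b. 0"] by (simp add: fun_eq_iff)
  show cm: "T (\<lambda>a b. c * v a b) = (\<lambda>a b. c * T v a b)" for c v
    using lin[of c v "\<lambda>a b. 0"] by (simp add: zero)
  show "T (\<lambda>a b. v a b - w a b) = (\<lambda>a b. T v a b - T w a b)"
    using lin[of "- 1" w v] by simp
qed

text \<open>The defining relation of the quotient, now for operators; it comes down to
  \<open>cc_Suc\<close>.\<close>

lemma YO_XO: "YO (XO v) = (\<lambda>a b. XO (YO v) a b + hh * (v a b + 2 * h2 * PO v a b))"
proof (intro ext)
  fix a b
  show "YO (XO v) a b = XO (YO v) a b + hh * (v a b + 2 * h2 * PO v a b)"
    by (cases a; cases b; simp add: YO_def XO_def PO_def cc_Suc algebra_simps)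
qed

lemma PO_XO: "PO (XO v) = (\<lambda>a b. - XO (PO v) a b)" and PO_YO: "PO (YO v) = (\<lambda>a b. - YO (PO v) a b)"
  by (auto simp: PO_def XO_def YO_def fun_eq_iff algebra_simps split: nat.split)

fun act_gen :: "gen \<Rightarrow> dunkl_module \<Rightarrow> dunkl_module" where
  "act_gen GenX = XO" | "act_gen GenY = YO"

fun act_word :: "gen list \<Rightarrow> dunkl_module \<Rightarrow> dunkl_module" where
  "act_word [] v = v" | "act_word (g # w) v = act_gen g (act_word w v)"

lemma act_word_append: "act_word (u @ w) v = act_word u (act_word w v)"
  by (induction u) auto

lemma klinear_act_gen: "klinear (act_gen g)"
  by (cases g) (auto simp: klinear_XO klinear_YO)

lemma klinear_act_word: "klinear (act_word w)"
proof (induction w)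
  case (Cons g w)
  then show ?case using klinear_act_gen[of g] by (simp add: klinear_def)
qed (simp add: klinear_def)

definition act :: "free_alg \<Rightarrow> dunkl_module \<Rightarrow> dunkl_module" where
  "act p v a b = (\<Sum>w\<in>Poly_Mapping.keys p. const2 (lookup p w) * act_word (letters w) v a b)"

lemma act_superset:
  assumes "finite S" "Poly_Mapping.keys p \<subseteq> S"
  shows "act p v a b = (\<Sum>w\<in>S. const2 (lookup p w) * act_word (letters w) v a b)"
  unfolding act_def using assms by (intro sum.mono_neutral_left) (auto simp: in_keys_iff)

lemma act_add: "act (p + q) v = (\<lambda>a b. act p v a b + act q v a b)"
proof (intro ext)
  fix a b
  let ?S = "Poly_Mapping.keys p \<union> Poly_Mapping.keys q"
  have "Poly_Mapping.keys (p + q) \<subseteq> ?S" by (rule keys_add)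
  then show "act (p + q) v a b = act p v a b + act q v a b"
    by (simp add: act_superset[of ?S] lookup_add const2_add sum.distrib[symmetric] algebra_simps)
qed

lemma act_single: "act (Poly_Mapping.single w c) v = (\<lambda>a b. const2 c * act_word (letters w) v a b)"
  by (intro ext, subst act_superset[of "{w}"]) auto

lemma act_0: "act 0 v = (\<lambda>a b. 0)"
  by (intro ext) (simp add: act_def)

lemma act_uminus: "act (- p) v = (\<lambda>a b. - act p v a b)"
  using act_add[of p "- p" v] by (simp add: act_0 fun_eq_iff eq_neg_iff_add_eq_0 add.commute)

lemma act_minus: "act (p - q) v = (\<lambda>a b. act p v a b - act q v a b)"
  using act_add[of p "- q" v] by (simp add: act_uminus)

lemma klinear_act: "klinear (act p)"
  unfolding klinear_def fun_eq_iff act_def klinear_act_word[unfolded klinear_def, rule_format]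
  by (simp add: sum.distrib sum_distrib_left algebra_simps)

lemma poly_mapping_additive_induct [case_names zero single add]:
  assumes "P 0" "\<And>w c. P (Poly_Mapping.single w c)" "\<And>p q. P p \<Longrightarrow> P q \<Longrightarrow> P (p + q)"
  shows "P (p :: 'a \<Rightarrow>\<^sub>0 'b::comm_monoid_add)"
proof -
  have "p = (\<Sum>w\<in>Poly_Mapping.keys p. Poly_Mapping.single w (lookup p w))"
    by (rule poly_mapping_eqI) (simp add: lookup_sum lookup_single when_def in_keys_iff)
  moreover have "P (\<Sum>w\<in>S. Poly_Mapping.single w (lookup p w))" for S
    by (induction S rule: infinite_finite_induct) (use assms in auto)
  ultimately show ?thesis by metis
qed

lemma act_mult: "act (p * q) v = act p (act q v)"
proof (induction p rule: poly_mapping_additive_induct)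
  case (single w c)
  show ?case
  proof (induction q rule: poly_mapping_additive_induct)
    case (single w' c')
    show ?case
      by (simp add: mult_single act_single plus_word_def act_word_append const2_mult
          klinearD(2)[OF klinear_act_word] mult.assoc)
  next
    case (add p q)
    then show ?case by (simp add: distrib_left act_add klinearD(1)[OF klinear_act])
  qed (simp add: act_0 klinearD(3)[OF klinear_act])
qed (simp_all add: act_0 distrib_right act_add)

lemma letters_zero [simp]: "letters 0 = []"
  by (simp add: zero_word_def)

lemma act_scalar: "act (scalar c) v = (\<lambda>a b. const2 c * v a b)"
  by (simp add: scalar_def act_single)

lemma act_gens: "act (gen GenX) v = XO v" "act (gen GenY) v = YO v"
  by (auto simp: gen_def act_single)

lemma act_1: "act 1 v = v"
  using act_scalar[of 1 v] by (simp add: scalar_def)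

lemma act_power: "act (p ^ n) v = (act p ^^ n) v"
  by (induction n) (auto simp: act_1 act_mult)

definition unitM :: dunkl_module where
  "unitM a b = (if a = 0 \<and> b = 0 then 1 else 0)"

text \<open>The coefficients of \<open>p\<close> e in the basis x^a y^b e.\<close>

definition nf :: "free_alg \<Rightarrow> dunkl_module" where
  "nf p = act p unitM"

lemma nf_mult: "nf (p * q) = act p (nf q)"
  by (simp add: nf_def act_mult)

lemma PO_unitM [simp]: "PO unitM = unitM"
  by (auto simp: PO_def unitM_def fun_eq_iff)

lemma lookup_gamma_act: "lookup (gamma_act p) w = (- 1) ^ length (letters w) * lookup p w"
  by (simp add: gamma_act_def lookup_mapp in_keys_iff when_def)

lemma gamma_act_add: "gamma_act (p + q) = gamma_act p + gamma_act q"
  by (rule poly_mapping_eqI) (simp add: lookup_gamma_act lookup_add algebra_simps)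

lemma gamma_act_single: "gamma_act (Poly_Mapping.single w c) = Poly_Mapping.single w ((- 1) ^ length (letters w) * c)"
  by (rule poly_mapping_eqI) (auto simp: lookup_gamma_act lookup_single when_def)

lemma gamma_act_0 [simp]: "gamma_act 0 = 0"
  by (rule poly_mapping_eqI) (simp add: lookup_gamma_act)

lemma gamma_act_gamma_act [simp]: "gamma_act (gamma_act p) = p"
  by (rule poly_mapping_eqI) (simp add: lookup_gamma_act power_mult_distrib[symmetric] mult.assoc[symmetric])

lemma gamma_act_mult: "gamma_act (p * q) = gamma_act p * gamma_act q"
proof (induction p rule: poly_mapping_additive_induct)
  case (single w c)
  show ?case
    by (induction q rule: poly_mapping_additive_induct)
      (auto simp: mult_single gamma_act_single plus_word_def power_add algebra_simps gamma_act_add)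
qed (simp_all add: gamma_act_add distrib_right)

lemma PO_act_word: "PO (act_word w v) = (\<lambda>a b. (- 1) ^ length w * act_word w (PO v) a b)"
proof (induction w)
  case (Cons g w)
  have "PO (act_gen g u) = (\<lambda>a b. - act_gen g (PO u) a b)" for u
    by (cases g) (simp_all add: PO_XO PO_YO)
  then show ?case by (simp add: Cons klinearD(2)[OF klinear_act_gen])
qed simp

lemma PO_act: "PO (act p v) = act (gamma_act p) (PO v)"
proof (induction p rule: poly_mapping_additive_induct)
  case zero
  then show ?case by (simp add: act_0) (simp add: PO_def)
next
  case (single w c)
  have "PO (\<lambda>a b. const2 c * act_word (letters w) v a b) = (\<lambda>a b. const2 c * PO (act_word (letters w) v) a b)"
    by (simp add: PO_def fun_eq_iff)
  moreover have "const2 ((- 1) ^ n * c) = (- 1) ^ n * const2 c" for n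
    by (cases "even n") (simp_all add: const2_uminus)
  ultimately show ?case
    by (simp add: act_single gamma_act_single PO_act_word mult.assoc mult.left_commute)
next
  case (add p q)
  have "PO (\<lambda>a b. u a b + w a b) = (\<lambda>a b. PO u a b + PO w a b)" for u w
    by (simp add: PO_def fun_eq_iff algebra_simps)
  then show ?case by (simp add: act_add gamma_act_add add)
qed

definition kappa :: free_alg where
  "kappa = gen GenY * gen GenX - gen GenX * gen GenY"

lemma act_kappa: "act kappa v = (\<lambda>a b. hh * (v a b + 2 * h2 * PO v a b))"
  by (simp add: kappa_def act_minus act_mult act_gens YO_XO)

text \<open>The \<gamma> in the commutator is moved to the right through \<open>q\<close> and
  absorbed by e.\<close>

lemma nf_kappa: "nf (p * kappa * q) = (\<lambda>a b. hh * (nf (p * q) a b + 2 * h2 * nf (p * gamma_act q) a b))"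
proof -
  have "nf (p * kappa * q) = act p (\<lambda>a b. hh * (nf q a b + 2 * h2 * nf (gamma_act q) a b))"
    by (simp add: nf_mult mult.assoc act_kappa) (simp add: nf_def PO_act)
  then show ?thesis by (simp add: klinearD[OF klinear_act] nf_mult)
qed

lemma nf_add: "nf (p + q) = (\<lambda>a b. nf p a b + nf q a b)" and nf_minus: "nf (p - q) = (\<lambda>a b. nf p a b - nf q a b)"
  and nf_scalar_mult: "nf (scalar c * p) = (\<lambda>a b. const2 c * nf p a b)"
  and nf_0: "nf 0 = (\<lambda>a b. 0)"
  by (simp_all add: nf_def act_add act_minus act_mult act_scalar act_0)

lemma nf_sum: "nf (\<Sum>x\<in>X. f x) = (\<lambda>a b. \<Sum>x\<in>X. nf (f x) a b)"
  by (induction X rule: infinite_finite_induct) (simp_all add: nf_add nf_0)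

section \<open>Exponents of \<open>hbar1\<close> and \<open>hbar2\<close> in structure constants and
  trace values\<close>

definition nonnegK :: "coeffs \<Rightarrow> bool" where
  "nonnegK c \<longleftrightarrow> (\<forall>n m. n < 0 \<or> m < 0 \<longrightarrow> c $$ n $$ m = 0)"

lemma nonnegK_mult: "nonnegK c \<Longrightarrow> nonnegK d \<Longrightarrow> nonnegK (c * d)"
  unfolding nonnegK_def
proof (intro allI impI)
  fix n m :: int
  assume "\<forall>n m. n < 0 \<or> m < 0 \<longrightarrow> c $$ n $$ m = 0" "\<forall>n m. n < 0 \<or> m < 0 \<longrightarrow> d $$ n $$ m = 0"
    and nm: "n < 0 \<or> m < 0"
  then have "lower_box 0 0 (n - 0) c" "lower_box 0 0 (n - 0) d"
    by (auto simp: lower_box_def intro!: fls_eqI)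
  from fls2_times_nth_box[OF this order.refl order.refl, of m] show "(c * d) $$ n $$ m = 0"
    using nm by auto
qed

lemma nonnegK_add: "nonnegK c \<Longrightarrow> nonnegK d \<Longrightarrow> nonnegK (c + d)"
  by (auto simp: nonnegK_def)

lemma nonnegK_const2: "nonnegK (const2 c)"
  by (auto simp: nonnegK_def const2_nth)

lemma nonnegK_sum: "(\<And>x. x \<in> X \<Longrightarrow> nonnegK (f x)) \<Longrightarrow> nonnegK (\<Sum>x\<in>X. f x)"
  using nonnegK_const2[of 0]
  by (induction X rule: infinite_finite_induct) (auto intro: nonnegK_add)

text \<open>Homogeneity of degree k in \<open>hbar1\<close>, with nonnegative powers of
  \<open>hbar2\<close>. For the values of the trace it makes the exponent of \<open>hbar1\<close>
  determine the diagonal term.\<close>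

definition pureK :: "nat \<Rightarrow> coeffs \<Rightarrow> bool" where
  "pureK k c \<longleftrightarrow> (\<forall>n m. n < 0 \<or> m \<noteq> int k \<longrightarrow> c $$ n $$ m = 0)"

lemma pureK_mult: 
  assumes "pureK k c" "pureK l d" shows "pureK (k + l) (c * d)"
  unfolding pureK_def
proof (intro allI impI)
  fix n m :: int
  assume nm: "n < 0 \<or> m \<noteq> int (k + l)"
  have "lower_box 0 0 (n - 0) c" "lower_box 0 0 (n - 0) d"
    using assms by (auto simp: lower_box_def pureK_def intro!: fls_eqI)
  note box = fls2_times_nth_box[OF this order.refl order.refl, of m]
  show "(c * d) $$ n $$ m = 0"
    unfolding box
  proof (intro sum.neutral ballI)
    fix i j assume "i \<in> {0..n - 0}" "j \<in> {0..m - 0}"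
    then show "c $$ i $$ j * d $$ (n - i) $$ (m - j) = 0"
      using assms nm unfolding pureK_def by (cases "j = int k") auto
  qed
qed

lemma pureK_add: "pureK k c \<Longrightarrow> pureK k d \<Longrightarrow> pureK k (c + d)"
  by (auto simp: pureK_def)

lemma pureK_uminus: "pureK k c \<Longrightarrow> pureK k (- c)"
  by (auto simp: pureK_def)

lemma pureK_const2: "pureK 0 (const2 c)" and pureK_h2: "pureK 0 h2" and pureK_hh: "pureK 1 hh"
proof -
  show "pureK 0 (const2 c)" for c by (auto simp: pureK_def const2_nth)
  moreover have "pureK 1 hbar1" by (auto simp: pureK_def)
  ultimately show "pureK 1 hh" unfolding hh_def using pureK_mult by fastforce
  show "pureK 0 h2" by (auto simp: pureK_def h2_def)
qed

lemma pureK_nonnegK: "pureK k c \<Longrightarrow> nonnegK c"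
  by (auto simp: pureK_def nonnegK_def)

lemma nonnegK_cc: "nonnegK (cc a b)"
proof -
  have "(- 1) ^ b = const2 ((- 1) ^ b :: complex)"
    by (cases "even b") (simp_all add: const2_uminus)
  then show ?thesis
    unfolding cc_def const2_of_nat[symmetric] const2_numeral[symmetric]
    by (auto intro!: nonnegK_add nonnegK_mult nonnegK_const2 pureK_nonnegK[OF pureK_h2])
qed

lemma nonnegK_nf: "nonnegK (nf p a b)"
proof -
  have "\<forall>a b. nonnegK (act_word w unitM a b)" for w
  proof (induction w)
    case Nil
    then show ?case using nonnegK_const2[of 0] nonnegK_const2[of 1] by (simp add: unitM_def)
  next
    case (Cons g w)
    then show ?case using nonnegK_const2[of 0]
      by (cases g) (auto simp: XO_def YO_def split: nat.split
        intro!: nonnegK_add nonnegK_mult nonnegK_cc pureK_nonnegK[OF pureK_hh])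
  qed
  then show ?thesis
    unfolding nf_def act_def by (intro nonnegK_sum nonnegK_mult nonnegK_const2) blast
qed

definition tau :: "nat \<Rightarrow> coeffs" where
  "tau k = (- hh) ^ k * (\<Prod>l=1..k. rr l)"

lemma tau_0 [simp]: "tau 0 = 1"
  by (simp add: tau_def)

lemma tau_Suc: "tau (Suc k) = - (hh * rr (Suc k) * tau k)"
  by (simp add: tau_def)

lemma pureK_rr: "pureK 0 (rr l)"
proof -
  have sign: "((- 1) ^ (l + 1) :: coeffs) = const2 ((- 1) ^ (l + 1))"
    by (cases "even l") (simp_all add: const2_uminus)
  \<comment> \<open>Division in \<open>coeffs\<close> is division of Laurent series; identifying the
    inverse as a constant shows that it contributes no powers of the parameters.\<close>
  have inv: "inverse (of_nat l + 1 :: coeffs) = const2 (inverse (of_nat l + 1))"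
  proof (rule inverse_unique)
    have "const2 (of_nat (Suc l) * inverse (of_nat l + 1) :: complex) = 1"
      using of_nat_neq_0[of l, where 'a=complex] by (simp add: add.commute)
    then show "(of_nat l + 1 :: coeffs) * const2 (inverse (of_nat l + 1)) = 1"
      unfolding const2_mult const2_of_nat by (simp add: add.commute)
  qed
  have half: "of_nat l / (2 :: coeffs) = const2 (of_nat l / 2)"
    by (simp add: nonzero_divide_eq_eq const2_of_nat[symmetric] const2_numeral[symmetric] const2_mult[symmetric])
  have fl: "\<lfloor>(real l + 1) / 2\<rfloor> = int ((l + 1) div 2)"
    using floor_divide_of_nat_eq[of "l + 1" 2, where 'a=real] by (simp add: add.commute)
  have "rr l = const2 (of_nat l / 2) + const2 ((- 1) ^ (l + 1)) *
      (const2 2 * const2 (of_nat ((l + 1) div 2)) * h2) * const2 (inverse (of_nat l + 1))"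
    unfolding rr_def h2_def[symmetric] fl sign half inv divide_inverse[of _ "of_nat l + 1"]
      const2_numeral const2_of_nat of_int_of_nat_eq ..
  moreover note m = pureK_mult[of 0 _ 0, simplified]
  ultimately show ?thesis by (simp only:) (intro pureK_add m pureK_const2 pureK_h2)
qed

lemma pureK_tau: "pureK k (tau k)"
proof (induction k)
  case 0
  then show ?case using pureK_const2[of 1] by simp
next
  case (Suc k)
  have "pureK (1 + 0 + k) (hh * rr (Suc k) * tau k)"
    by (intro pureK_mult pureK_hh pureK_rr Suc)
  then show ?case by (simp add: tau_Suc pureK_uminus)
qed

section \<open>The functional on normal forms\<close>

definition finM :: "nat \<Rightarrow> dunkl_module \<Rightarrow> bool" where
  "finM n v \<longleftrightarrow> (\<forall>a b. n < a + b \<longrightarrow> v a b = 0)"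

text \<open>Summing over the support avoids a degree parameter. The functional is meant for elements
  of bounded degree, such as normal forms, where \<open>phiM_eq\<close> gives an ordinary finite
  range.\<close>

definition phiM :: "dunkl_module \<Rightarrow> coeffs" where
  "phiM v = (\<Sum>k\<in>{k. v k k \<noteq> 0}. v k k * tau k)"

lemma phiM_eq: "finM n v \<Longrightarrow> n \<le> m \<Longrightarrow> phiM v = (\<Sum>k\<le>m. v k k * tau k)"
  unfolding phiM_def
proof (intro sum.mono_neutral_left)
  assume "finM n v" "n \<le> m"
  then show "{k. v k k \<noteq> 0} \<subseteq> {..m}"
    by (force simp: finM_def not_le[symmetric])
qed auto

lemma finM_XO: "finM n v \<Longrightarrow> finM (Suc n) (XO v)"
  by (auto simp: finM_def XO_def split: nat.split)

lemma finM_YO: "finM n v \<Longrightarrow> finM (Suc n) (YO v)"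
  by (auto simp: finM_def YO_def split: nat.split)

lemma finM_add: "finM n v \<Longrightarrow> finM m w \<Longrightarrow> finM (max n m) (\<lambda>a b. v a b + w a b)"
  by (auto simp: finM_def)

lemma finM_nf: "\<exists>n. finM n (nf p)"
proof -
  have "finM (length w) (act_word w unitM)" for w
  proof (induction w)
    case (Cons g w)
    then show ?case by (cases g) (auto simp: finM_XO finM_YO)
  qed (auto simp: finM_def unitM_def)
  then have "finM n (\<lambda>a b. const2 c * act_word w unitM a b)" if "length w \<le> n" for n w c
    using that by (auto simp: finM_def)
  then show ?thesis
  proof (induction p rule: poly_mapping_additive_induct)
    case (single w c)
    then show ?case unfolding nf_def act_single by blast
  next
    case (add p q)
    then show ?case unfolding nf_add by (metis finM_add)
  qed (auto simp: nf_0 finM_def)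
qed

lemma phiM_add:
  assumes "finM n v" "finM m w"
  shows "phiM (\<lambda>a b. v a b + w a b) = phiM v + phiM w"
  using phiM_eq[OF finM_add[OF assms] order.refl] phiM_eq[OF assms(1), of "max n m"] phiM_eq[OF assms(2), of "max n m"]
  by (simp add: sum.distrib[symmetric] distrib_right)

lemma phiM_cmult: "phiM (\<lambda>a b. c * v a b) = c * phiM v"
  by (cases "c = 0") (simp_all add: phiM_def sum_distrib_left mult.assoc)

lemma phiM_nf_add: "phiM (nf (p + q)) = phiM (nf p) + phiM (nf q)"
  using finM_nf[of p] finM_nf[of q] phiM_add by (auto simp: nf_add)

lemma phiM_0 [simp]: "phiM (\<lambda>a b. 0) = 0"
  by (simp add: phiM_def)

lemma phiM_nf_0 [simp]: "phiM (nf 0) = 0"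
  by (simp add: nf_0)

lemma phiM_nf_minus: "phiM (nf (p - q)) = phiM (nf p) - phiM (nf q)"
  using phiM_nf_add[of "p - q" q] by simp

subsection \<open>Right multiplication by the squares of the generators\<close>

text \<open>Right multiplication by y^2. It preserves the left ideal R e because y^2 commutes with
  e; right multiplication by a single generator does not, which is why cyclicity starts from
  squares.\<close>

definition RY :: "dunkl_module \<Rightarrow> dunkl_module" where
  "RY v a b = (case b of Suc (Suc b) \<Rightarrow> v a b | _ \<Rightarrow> 0)"

definition RX :: "dunkl_module \<Rightarrow> dunkl_module" where
  "RX v a b = XO (XO v) a b + 2 * hh * of_nat (Suc b) * (case a of 0 \<Rightarrow> 0 | Suc a \<Rightarrow> v a (Suc b)) +
     2 * hh * hh * dd (Suc (Suc b)) * v a (Suc (Suc b))"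

text \<open>When y passes twice, the \<open>h2\<close> parts of the two first order terms have
  opposite signs, so that the first order term is undeformed (\<open>cc_add\<close>).\<close>

lemma YO_YO: "YO (YO v) a b = RY v a b + 2 * hh * of_nat (Suc a) * (case b of 0 \<Rightarrow> 0 | Suc b \<Rightarrow> v (Suc a) b) +
    hh * hh * (cc (Suc a) b * cc (Suc (Suc a)) b) * v (Suc (Suc a)) b"
proof (cases b)
  case (Suc c)
  have "YO (YO v) a b = RY v a b + hh * (cc (Suc a) (Suc c) + cc (Suc a) c) * v (Suc a) c +
      hh * hh * (cc (Suc a) b * cc (Suc (Suc a)) b) * v (Suc (Suc a)) b"
    by (simp add: Suc YO_def RY_def algebra_simps split: nat.split)
  then show ?thesis by (simp add: cc_add Suc del: of_nat_Suc)
qed (simp add: YO_def RY_def)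

text \<open>Only the coefficients \<open>v (k + 2) k\<close> contribute to the difference. After an
  index shift the first order term carries \<open>tau (k + 1)\<close> and the second order term
  \<open>tau k\<close>; by \<open>cc_cc\<close> the recursion of \<open>tau\<close> is exactly what
  cancels them.\<close>

lemma phiM_YO_YO:
  assumes "finM n v" shows "phiM (YO (YO v)) = phiM (RY v)"
proof -
  have RY: "finM (Suc (Suc n)) (RY v)"
    using assms by (auto simp: finM_def RY_def split: nat.split)
  have YY: "finM (Suc (Suc n)) (YO (YO v))" by (intro finM_YO assms)
  have "phiM (YO (YO v)) - phiM (RY v) =
    (\<Sum>k\<le>Suc (Suc n). 2 * hh * of_nat (Suc k) * (case k of 0 \<Rightarrow> 0 | Suc b \<Rightarrow> v (Suc k) b) * tau k) +
    (\<Sum>k\<le>Suc (Suc n). hh * hh * (cc (Suc k) k * cc (Suc (Suc k)) k) * v (Suc (Suc k)) k * tau k)"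
    unfolding phiM_eq[OF RY order.refl] phiM_eq[OF YY order.refl] YO_YO
    by (simp only: distrib_right sum.distrib) simp
  also have "(\<Sum>k\<le>Suc (Suc n). 2 * hh * of_nat (Suc k) * (case k of 0 \<Rightarrow> 0 | Suc b \<Rightarrow> v (Suc k) b) * tau k) =
    (\<Sum>k\<le>Suc n. 2 * hh * of_nat (Suc (Suc k)) * v (Suc (Suc k)) k * tau (Suc k))"
    unfolding sum.atMost_Suc_shift[of _ "Suc n"] by simp
  also have "(\<Sum>k\<le>Suc (Suc n). hh * hh * (cc (Suc k) k * cc (Suc (Suc k)) k) * v (Suc (Suc k)) k * tau k) =
    (\<Sum>k\<le>Suc n. hh * hh * (cc (Suc k) k * cc (Suc (Suc k)) k) * v (Suc (Suc k)) k * tau k)"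
    using assms by (simp add: finM_def)
  also have "(\<Sum>k\<le>Suc n. 2 * hh * of_nat (Suc (Suc k)) * v (Suc (Suc k)) k * tau (Suc k)) +
    (\<Sum>k\<le>Suc n. hh * hh * (cc (Suc k) k * cc (Suc (Suc k)) k) * v (Suc (Suc k)) k * tau k) = 0"
    unfolding sum.distrib[symmetric]
    by (intro sum.neutral) (simp add: cc_cc tau_Suc algebra_simps)
  finally show ?thesis by simp
qed

lemma phiM_RX:
  assumes "finM n v" shows "phiM (RX v) = phiM (XO (XO v))"
proof -
  have XX: "finM (Suc (Suc n)) (XO (XO v))" by (intro finM_XO assms)
  have RX: "finM (Suc (Suc n)) (RX v)"
    using assms XX by (auto simp: finM_def RX_def split: nat.split)
  have "phiM (RX v) - phiM (XO (XO v)) =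
    (\<Sum>k\<le>Suc (Suc n). 2 * hh * of_nat (Suc k) * (case k of 0 \<Rightarrow> 0 | Suc a \<Rightarrow> v a (Suc k)) * tau k) +
    (\<Sum>k\<le>Suc (Suc n). 2 * hh * hh * dd (Suc (Suc k)) * v k (Suc (Suc k)) * tau k)"
    unfolding phiM_eq[OF RX order.refl] phiM_eq[OF XX order.refl] RX_def
    by (simp only: distrib_right sum.distrib) simp
  also have "(\<Sum>k\<le>Suc (Suc n). 2 * hh * of_nat (Suc k) * (case k of 0 \<Rightarrow> 0 | Suc a \<Rightarrow> v a (Suc k)) * tau k) =
    (\<Sum>k\<le>Suc n. 2 * hh * of_nat (Suc (Suc k)) * v k (Suc (Suc k)) * tau (Suc k))"
    unfolding sum.atMost_Suc_shift[of _ "Suc n"] by simp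
  also have "(\<Sum>k\<le>Suc (Suc n). 2 * hh * hh * dd (Suc (Suc k)) * v k (Suc (Suc k)) * tau k) =
    (\<Sum>k\<le>Suc n. 2 * hh * hh * dd (Suc (Suc k)) * v k (Suc (Suc k)) * tau k)"
    using assms by (simp add: finM_def)
  also have "(\<Sum>k\<le>Suc n. 2 * hh * of_nat (Suc (Suc k)) * v k (Suc (Suc k)) * tau (Suc k)) +
    (\<Sum>k\<le>Suc n. 2 * hh * hh * dd (Suc (Suc k)) * v k (Suc (Suc k)) * tau k) = 0"
    unfolding sum.distrib[symmetric]
    by (intro sum.neutral) (simp add: dd_Suc[of "Suc _"] tau_Suc algebra_simps)
  finally show ?thesis by simp
qed

lemma klinear_RY: "klinear RY"
  by (auto simp: klinear_def RY_def fun_eq_iff split: nat.split)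

lemma klinear_RX: "klinear RX"
  by (auto simp: klinear_def RX_def XO_def fun_eq_iff algebra_simps split: nat.split)

lemma RY_XO: "RY (XO v) = XO (RY v)" and RY_YO: "RY (YO v) = YO (RY v)" and RX_XO: "RX (XO v) = XO (RX v)"
  by (auto simp: RX_def RY_def XO_def YO_def cc_def fun_eq_iff split: nat.split)

text \<open>The floors of (b + 2)/2 and (b + 1)/2 add up to b + 1, which turns the alternating term
  into a commutator coefficient.\<close>

lemma dd_diff: "dd (Suc (Suc b)) = dd (Suc b) + of_nat (Suc b) * (1 + 2 * h2 * (- 1) ^ b)"
proof -
  have "of_nat (Suc (Suc b) div 2) + of_nat (Suc b div 2) = (of_nat (Suc b) :: coeffs)"
    unfolding of_nat_add[symmetric] by (rule arg_cong[of _ _ of_nat]) presburger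
  then have "of_nat (Suc (Suc b) div 2) = (of_nat (Suc b) :: coeffs) - of_nat (Suc b div 2)"
    by (simp add: eq_diff_eq)
  then show ?thesis unfolding dd_def by (simp only:) (simp add: field_simps)
qed

text \<open>Associativity for the explicit right multiplication: comparing coefficients, it amounts
  to the increments of \<open>cc\<close> and \<open>dd\<close>. Small exponents are separate cases
  because terms with negative exponents are absent.\<close>

lemma RX_YO: "RX (YO v) = YO (RX v)"
proof (intro ext)
  fix a b
  have c: "cc (Suc a) b = cc a (Suc b) + 1 + 2 * h2 * (- 1) ^ b" for a b
    by (simp add: cc_def)
  have c3: "cc a (Suc (Suc b)) = cc a b" for a b by (simp add: cc_def)
  have d1: "dd (Suc 0) = 0" by (simp add: dd_def)
  show "RX (YO v) a b = YO (RX v) a b"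
  proof (cases a)
    case 0
    then show ?thesis
      by (cases b) (simp_all add: RX_def YO_def XO_def c3 c dd_diff d1 algebra_simps)
  next
    case (Suc a')
    show ?thesis
      by (cases b; cases a') (simp_all add: Suc RX_def YO_def XO_def c3 c dd_diff d1 algebra_simps)
  qed
qed

text \<open>An endomorphism of the left module is determined by the image of e; in this way
  \<open>RX\<close> and \<open>RY\<close> are recognised as right multiplications.\<close>

lemma right_mult_commute:
  assumes R: "klinear R" "\<And>v. R (XO v) = XO (R v)" "\<And>v. R (YO v) = YO (R v)"
  shows "R (act p v) = act p (R v)"
proof (induction p rule: poly_mapping_additive_induct)
  case (single w c)
  have "R (act_gen g v) = act_gen g (R v)" for g v by (cases g) (simp_all add: R)
  then have "R (act_word w v) = act_word w (R v)" for w by (induction w) simp_all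
  then show ?case by (simp add: act_single klinearD(2)[OF R(1)])
qed (simp_all add: act_0 act_add klinearD[OF R(1)])

abbreviation "gX \<equiv> gen GenX"
abbreviation "gY \<equiv> gen GenY"

lemma nf_gens: "nf (gX * p) = XO (nf p)" "nf (gY * p) = YO (nf p)"
  by (simp_all add: nf_def act_mult act_gens)

lemma nf_times_gX_gX: "nf (p * (gX * gX)) = RX (nf p)"
proof -
  have "nf (gX * gX) = RX unitM"
    by (auto simp: nf_def act_mult act_gens RX_def unitM_def fun_eq_iff split: nat.split)
  then show ?thesis
    by (simp add: nf_mult right_mult_commute[OF klinear_RX RX_XO RX_YO, symmetric]) (simp add: nf_def)
qed

lemma nf_times_gY_gY: "nf (p * (gY * gY)) = RY (nf p)"
proof -
  have "nf (gY * gY) = RY unitM"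
    by (auto simp: nf_def act_mult act_gens YO_YO RY_def unitM_def fun_eq_iff split: nat.split)
  then show ?thesis
    by (simp add: nf_mult right_mult_commute[OF klinear_RY RY_XO RY_YO, symmetric]) (simp add: nf_def)
qed

subsection \<open>The trace property on words of even length\<close>

definition evenF :: "free_alg \<Rightarrow> bool" where
  "evenF p \<longleftrightarrow> gamma_act p = p"

definition tracial :: "free_alg \<Rightarrow> bool" where
  "tracial p \<longleftrightarrow> (\<forall>q. evenF q \<longrightarrow> phiM (nf (p * q)) = phiM (nf (q * p)))"

lemma evenF_mult: "evenF p \<Longrightarrow> evenF q \<Longrightarrow> evenF (p * q)"
  by (simp add: evenF_def gamma_act_mult)

lemma evenF_add: "evenF p \<Longrightarrow> evenF q \<Longrightarrow> evenF (p + q)"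
  by (simp add: evenF_def gamma_act_add)

lemma gamma_act_minus: "gamma_act (p - q) = gamma_act p - gamma_act q"
  by (rule poly_mapping_eqI) (simp add: lookup_gamma_act lookup_minus right_diff_distrib)

lemma evenF_minus: "evenF p \<Longrightarrow> evenF q \<Longrightarrow> evenF (p - q)"
  by (simp add: evenF_def gamma_act_minus)

lemma evenF_single: "even (length (letters w)) \<Longrightarrow> evenF (Poly_Mapping.single w c)"
  by (simp add: evenF_def gamma_act_single)

lemma evenF_gens: "evenF (gen g * gen g')"
  by (simp add: gen_def mult_single evenF_single plus_word_def)

text \<open>\<open>p\<close> and \<open>q\<close> are moved to the right end one after the other,
  which uses that q r and r p are even.\<close>

lemma tracial_mult:
  assumes "tracial p" "tracial q" "evenF p" "evenF q" shows "tracial (p * q)"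
  unfolding tracial_def
proof (intro allI impI)
  fix r assume r: "evenF r"
  have "phiM (nf (p * (q * r))) = phiM (nf (q * r * p))"
    using assms(1,4) r by (simp add: tracial_def evenF_mult)
  also have "\<dots> = phiM (nf (q * (r * p)))" by (simp add: mult.assoc)
  also have "\<dots> = phiM (nf (r * p * q))"
    using assms(2,3) r by (simp add: tracial_def evenF_mult)
  finally show "phiM (nf (p * q * r)) = phiM (nf (r * (p * q)))" by (simp add: mult.assoc)
qed

lemma tracial_add: "tracial p \<Longrightarrow> tracial q \<Longrightarrow> tracial (p + q)"
  by (simp add: tracial_def distrib_left distrib_right phiM_nf_add)

lemma tracial_minus: "tracial p \<Longrightarrow> tracial q \<Longrightarrow> tracial (p - q)"
  by (simp add: tracial_def left_diff_distrib right_diff_distrib phiM_nf_minus)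

lemma tracial_0: "tracial 0"
  by (simp add: tracial_def)

lemma scalar_commute: "scalar c * p = p * scalar c"
  by (induction p rule: poly_mapping_additive_induct)
    (simp_all add: scalar_def mult_single distrib_left distrib_right mult.commute)

lemma tracial_scalar: "tracial (scalar c)"
  by (simp add: tracial_def scalar_commute)

lemma tracial_gX_gX: "tracial (gX * gX)"
  unfolding tracial_def
proof (intro allI impI)
  fix q
  obtain n where "finM n (nf q)" using finM_nf by blast
  then show "phiM (nf (gX * gX * q)) = phiM (nf (q * (gX * gX)))"
    by (simp add: mult.assoc nf_gens) (simp add: nf_times_gX_gX phiM_RX)
qed

lemma tracial_gY_gY: "tracial (gY * gY)"
  unfolding tracial_def
proof (intro allI impI)
  fix q
  obtain n where "finM n (nf q)" using finM_nf by blast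
  then show "phiM (nf (gY * gY * q)) = phiM (nf (q * (gY * gY)))"
    by (simp add: mult.assoc nf_gens) (simp add: nf_times_gY_gY phiM_YO_YO)
qed

text \<open>On even elements \<gamma> is absorbed by e, so [y, x] acts as the same scalar from both
  sides.\<close>

lemma nf_kappa_even:
  assumes "evenF q"
  shows "nf (kappa * q) = (\<lambda>a b. hh * (1 + 2 * h2) * nf q a b)" "nf (q * kappa) = (\<lambda>a b. hh * (1 + 2 * h2) * nf q a b)"
  using nf_kappa[of 1 q] nf_kappa[of q 1] assms PO_act[of q unitM]
  by (simp_all add: evenF_def fun_eq_iff algebra_simps, simp_all add: nf_def gamma_act_single[of 0 1, simplified] algebra_simps)

lemma tracial_kappa: "tracial kappa"
  by (simp add: tracial_def nf_kappa_even phiM_cmult)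

text \<open>Since x \<gamma> = - \<gamma> x, the \<gamma> terms cancel in y x^2 - x^2 y =
  \<open>hbar1\<close> x; a second y turns x into the anticommutator.\<close>

lemma act_YYXX: "act (gY * gY * (gX * gX) - gX * gX * (gY * gY)) v = (\<lambda>a b. 2 * hh * act (gY * gX + gX * gY) v a b)"
proof -
  have a: "YO (XO (XO v)) = (\<lambda>a b. XO (XO (YO v)) a b + 2 * hh * XO v a b)" for v
    unfolding YO_XO klinearD[OF klinear_XO] PO_XO by (simp add: fun_eq_iff algebra_simps)
  have "YO (YO (XO (XO v))) = (\<lambda>a b. XO (XO (YO (YO v))) a b + 2 * hh * XO (YO v) a b + 2 * hh * YO (XO v) a b)"
    unfolding a[of v] klinearD[OF klinear_YO] a[of "YO v"] ..
  then show ?thesis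
    by (simp add: act_minus act_add act_mult act_gens fun_eq_iff algebra_simps)
qed

text \<open>The commutator of y^2 and x^2 is cyclic because products are; the nonzero factor
  \<open>2 * hh\<close> is then cancelled.\<close>

lemma tracial_YX_XY: "tracial (gY * gX + gX * gY)"
  unfolding tracial_def
proof (intro allI impI)
  fix q assume q: "evenF q"
  let ?w = "gY * gY * (gX * gX) - gX * gX * (gY * gY)"
  have "tracial ?w"
    by (intro tracial_minus tracial_mult tracial_gX_gX tracial_gY_gY evenF_gens)
  then have "phiM (nf (?w * q)) = phiM (nf (q * ?w))" using q by (simp add: tracial_def)
  moreover have "nf (?w * q) = (\<lambda>a b. 2 * hh * nf ((gY * gX + gX * gY) * q) a b)"
    unfolding nf_mult act_YYXX ..
  moreover have "nf (q * ?w) = (\<lambda>a b. 2 * hh * nf (q * (gY * gX + gX * gY)) a b)"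
    unfolding nf_mult nf_def[of ?w] nf_def[of "gY * gX + gX * gY"] act_YYXX klinearD(2)[OF klinear_act] ..
  ultimately show "phiM (nf ((gY * gX + gX * gY) * q)) = phiM (nf (q * (gY * gX + gX * gY)))"
    by (simp add: phiM_cmult)
qed

lemma tracial_gens: "tracial (gen g * gen g')"
proof -
  have half: "tracial (scalar c * p)" if "tracial p" for c p
    unfolding tracial_def
  proof (intro allI impI)
    fix q assume "evenF q"
    moreover have "q * (scalar c * p) = scalar c * (q * p)"
      by (metis mult.assoc scalar_commute)
    ultimately show "phiM (nf (scalar c * p * q)) = phiM (nf (q * (scalar c * p)))"
      using that by (simp add: tracial_def mult.assoc nf_scalar_mult phiM_cmult)
  qed
  have s: "scalar (1/2) * p + scalar (1/2) * p = p" for p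
    by (simp add: distrib_right[symmetric] scalar_def single_add[symmetric])
  have "gY * gX = scalar (1/2) * ((gY * gX + gX * gY) + kappa)"
    "gX * gY = scalar (1/2) * ((gY * gX + gX * gY) - kappa)"
    using s[of "gY * gX"] s[of "gX * gY"] by (simp_all add: kappa_def distrib_left right_diff_distrib)
  then have "tracial (gY * gX)" "tracial (gX * gY)"
    using half tracial_add[OF tracial_YX_XY tracial_kappa] tracial_minus[OF tracial_YX_XY tracial_kappa] by metis+
  then show ?thesis using tracial_gX_gX tracial_gY_gY by (cases g; cases g') auto
qed

text \<open>A word of even length is a product of pairs of generators.\<close>

lemma tracial_even:
  assumes "evenF p" shows "tracial p"
proof -
  have word: "tracial (Poly_Mapping.single (Word w) c)" if "even (length w)" for w c
    using that
  proof (induction "length w" arbitrary: w rule: less_induct)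
    case less
    show ?case
    proof (cases w)
      case Nil
      then show ?thesis using tracial_scalar[of c] by (simp add: scalar_def zero_word_def)
    next
      case (Cons g1 w1)
      then obtain g2 w2 where w: "w = g1 # g2 # w2" using less.prems by (cases w1) auto
      have "Poly_Mapping.single (Word w) c = gen g1 * gen g2 * Poly_Mapping.single (Word w2) c"
        by (simp add: w gen_def mult_single plus_word_def)
      also have "tracial \<dots>"
        using less w by (intro tracial_mult tracial_gens evenF_gens evenF_single) auto
      finally show ?thesis .
    qed
  qed
  have p: "p = (\<Sum>w\<in>Poly_Mapping.keys p. Poly_Mapping.single w (lookup p w))"
    by (rule poly_mapping_eqI) (simp add: lookup_sum lookup_single when_def in_keys_iff)
  have "tracial (\<Sum>w\<in>S. Poly_Mapping.single w (lookup p w))" if "S \<subseteq> Poly_Mapping.keys p" for S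
    using that
  proof (induction S rule: infinite_finite_induct)
    case (insert w S)
    \<comment> \<open>A word of odd length in the support would change sign under
      \<open>gamma_act\<close>, which fixes \<open>p\<close>.\<close>
    have "even (length (letters w))"
    proof (rule ccontr)
      assume "odd (length (letters w))"
      then have "- lookup p w = lookup p w"
        using lookup_gamma_act[of p w] assms by (simp add: evenF_def)
      then show False using insert.prems by (simp add: in_keys_iff)
    qed
    then show ?case using insert word[of "letters w"] by (auto intro!: tracial_add)
  qed (auto simp: tracial_0)
  from this[OF order.refl] show ?thesis using p by simp
qed

subsection \<open>Monomials in \<open>z\<close> and \<open>zbar\<close>\<close>

definition iK :: coeffs where "iK = const2 \<i>"

lemma iK_iK: "iK * iK = - 1"
  by (simp add: iK_def const2_mult[symmetric] const2_uminus)

lemma iK_iK': "iK * (iK * x) = - x"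
  by (simp add: mult.assoc[symmetric] iK_iK)

abbreviation "AO \<equiv> act gen_z"
abbreviation "BO \<equiv> act gen_zbar"

lemma AO_def: "AO v = (\<lambda>a b. XO v a b + iK * YO v a b)" and BO_def: "BO v = (\<lambda>a b. XO v a b - iK * YO v a b)"
  by (simp_all add: gen_z_def gen_zbar_def act_add act_minus act_mult act_scalar act_gens iK_def)

text \<open>[zbar, z] = -2i [y, x], so \<open>kap\<close> takes the place of
  \<open>hh\<close>.\<close>

definition kap :: coeffs where "kap = - (2 * iK * hh)"

lemma kap_nonzero: "kap \<noteq> 0"
  by (simp add: kap_def iK_def)

lemma BO_AO: "BO (AO v) = (\<lambda>a b. AO (BO v) a b + kap * (v a b + 2 * h2 * PO v a b))"
  unfolding AO_def BO_def klinearD[OF klinear_XO] klinearD[OF klinear_YO] YO_XO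
  by (simp add: fun_eq_iff kap_def algebra_simps iK_iK')

lemma PO_AO: "PO (AO v) = (\<lambda>a b. - AO (PO v) a b)" and PO_BO: "PO (BO v) = (\<lambda>a b. - BO (PO v) a b)"
proof -
  have P: "PO (\<lambda>a b. v a b + c * w a b) = (\<lambda>a b. PO v a b + c * PO w a b)" for v w c
    by (simp add: PO_def fun_eq_iff algebra_simps)
  show "PO (AO v) = (\<lambda>a b. - AO (PO v) a b)"
    unfolding AO_def P PO_XO PO_YO by (simp add: fun_eq_iff)
  show "PO (BO v) = (\<lambda>a b. - BO (PO v) a b)"
    using P[of "XO v" "- iK" "YO v"] unfolding BO_def by (simp add: PO_XO PO_YO fun_eq_iff)
qed

lemmas AO_lin = klinearD[OF klinear_act[of gen_z]]
lemmas BO_lin = klinearD[OF klinear_act[of gen_zbar]]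

lemma PO_BO_funpow: "PO ((BO ^^ b) unitM) = (\<lambda>i j. (- 1) ^ b * (BO ^^ b) unitM i j)"
proof (induction b)
  case (Suc b)
  show ?case by (simp add: PO_BO Suc BO_lin(2))
qed simp

text \<open>Only the commutation relation and the sign of \<gamma> enter, so the coefficients
  \<open>cc\<close> are the same as for y and x^a.\<close>

lemma BO_AO_funpow:
  assumes v: "PO v = (\<lambda>i j. (- 1) ^ b * v i j)"
  shows "BO ((AO ^^ a) v) = (\<lambda>i j. (AO ^^ a) (BO v) i j + kap * cc a b * (AO ^^ (a - 1)) v i j)"
proof (induction a)
  case (Suc a)
  have PA: "PO ((AO ^^ a) v) = (\<lambda>i j. (- 1) ^ (a + b) * (AO ^^ a) v i j)" for a
  proof (induction a)
    case (Suc a)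
    show ?case by (simp add: PO_AO Suc AO_lin(2))
  qed (simp add: v)
  have shift: "AO (\<lambda>i j. kap * cc a b * (AO ^^ (a - 1)) v i j) = (\<lambda>i j. kap * cc a b * (AO ^^ a) v i j)"
    by (cases a) (simp_all add: AO_lin)
  show ?case
    unfolding funpow.simps comp_def BO_AO Suc AO_lin(1) shift PA
    by (simp add: fun_eq_iff cc_Suc algebra_simps)
qed simp

definition zz_basis :: "nat \<Rightarrow> nat \<Rightarrow> dunkl_module" where
  "zz_basis a b = (AO ^^ a) ((BO ^^ b) unitM)"

lemma nf_zz: "nf (gen_z ^ a * gen_zbar ^ b) = zz_basis a b"
  by (simp add: nf_def act_mult act_power zz_basis_def)

lemma AO_zz: "AO (zz_basis a b) = zz_basis (Suc a) b"
  by (simp add: zz_basis_def)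

text \<open>At \<open>a = 0\<close> the truncated index \<open>a - 1\<close> is harmless, as
  \<open>cc 0 b = 0\<close>.\<close>

lemma BO_zz: "BO (zz_basis a b) = (\<lambda>i j. zz_basis a (Suc b) i j + kap * cc a b * zz_basis (a - 1) b i j)"
  unfolding zz_basis_def BO_AO_funpow[OF PO_BO_funpow] by simp

lemma gamma_act_gen: "gamma_act (gen g) = - gen g"
  unfolding gen_def gamma_act_single single_uminus[symmetric] by simp

lemma gamma_act_scalar: "gamma_act (scalar c) = scalar c"
  by (simp add: scalar_def gamma_act_single)

lemma gamma_act_gen_z: "gamma_act gen_z = - gen_z" and gamma_act_gen_zbar: "gamma_act gen_zbar = - gen_zbar"
  by (simp_all add: gen_z_def gen_zbar_def gamma_act_add gamma_act_minus gamma_act_mult gamma_act_gen gamma_act_scalar)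

lemma gamma_act_power_odd: "gamma_act p = - p \<Longrightarrow> gamma_act (p ^ n) = (- 1) ^ n * p ^ n"
proof (induction n)
  case 0
  then show ?case using gamma_act_scalar[of 1] by (simp add: scalar_def)
next
  case (Suc n)
  then show ?case by (cases "even n") (simp_all add: gamma_act_mult)
qed

lemma evenF_zz: "even (a + b) \<Longrightarrow> evenF (gen_z ^ a * gen_zbar ^ b)"
  unfolding evenF_def gamma_act_mult gamma_act_power_odd[OF gamma_act_gen_z] gamma_act_power_odd[OF gamma_act_gen_zbar]
  by (cases "even a"; cases "even b") auto

definition zz_trace :: "nat \<Rightarrow> nat \<Rightarrow> coeffs" where
  "zz_trace a b = phiM (zz_basis a b)"

lemma finM_zz: "\<exists>n. finM n (zz_basis a b)"
  unfolding nf_zz[symmetric] by (rule finM_nf)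

lemma phiM_add': 
  assumes "\<exists>n. finM n v" "\<exists>n. finM n w"
  shows "phiM (\<lambda>a b. v a b + c * w a b) = phiM v + c * phiM w"
proof -
  obtain n m where n: "finM n v" "finM m w" using assms by blast
  then have "finM m (\<lambda>a b. c * w a b)" by (simp add: finM_def)
  from phiM_add[OF n(1) this] show ?thesis by (simp add: phiM_cmult)
qed

text \<open>Cyclicity of zbar^2 against z^a zbar^b: the leading terms cancel and the rest is divided
  by \<open>kap\<close>. For \<open>a = 1\<close> the right side is 0, for larger \<open>a\<close>
  this is the recursion for the trace.\<close>

lemma zz_trace_BB:
  assumes "even (a + b)"
  shows "2 * of_nat a * zz_trace (a - 1) (Suc b) = - kap * cc a b * cc (a - 1) b * zz_trace (a - 2) b"
proof -
  let ?q = "gen_z ^ a * gen_zbar ^ b" and ?zb2 = "gen_zbar ^ 2"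
  have e: "evenF ?zb2" using evenF_zz[of 0 2] by simp
  have "phiM (nf (?zb2 * ?q)) = phiM (nf (?q * ?zb2))"
    using tracial_even[OF e] evenF_zz[OF assms] by (simp add: tracial_def)
  also have "?q * ?zb2 = gen_z ^ a * gen_zbar ^ (Suc (Suc b))"
    by (simp only: mult.assoc power_add[symmetric]) simp
  also have "phiM (nf \<dots>) = zz_trace a (Suc (Suc b))" by (simp only: nf_zz zz_trace_def)
  also have "nf (?zb2 * ?q) = BO (BO (zz_basis a b))"
    by (subst nf_mult[of ?zb2], subst nf_zz, simp only: power2_eq_square act_mult)
  also have "\<dots> = (\<lambda>i j. (zz_basis a (Suc (Suc b)) i j + kap * (cc a (Suc b) + cc a b) * zz_basis (a - 1) (Suc b) i j)
      + kap * cc a b * kap * cc (a - 1) b * zz_basis (a - 2) b i j)"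
    unfolding BO_zz[of a b] BO_lin(1) BO_lin(2) unfolding BO_zz
    by (simp add: fun_eq_iff algebra_simps diff_diff_eq numeral_2_eq_2)
  also have "phiM \<dots> = zz_trace a (Suc (Suc b)) + kap * (cc a (Suc b) + cc a b) * zz_trace (a - 1) (Suc b)
      + kap * cc a b * kap * cc (a - 1) b * zz_trace (a - 2) b"
  proof -
    obtain n m where n: "finM n (zz_basis a (Suc (Suc b)))" "finM m (zz_basis (a - 1) (Suc b))" using finM_zz by blast
    then have "finM m (\<lambda>i j. kap * (cc a (Suc b) + cc a b) * zz_basis (a - 1) (Suc b) i j)" by (simp add: finM_def)
    from finM_add[OF n(1) this] show ?thesis
      unfolding zz_trace_def by (subst phiM_add'; (subst phiM_add')?; blast intro: finM_zz)
  qed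
  finally have "kap * (2 * of_nat a * zz_trace (a - 1) (Suc b) + kap * cc a b * cc (a - 1) b * zz_trace (a - 2) b) = 0"
    unfolding cc_add by (simp add: algebra_simps)
  then show ?thesis using kap_nonzero by (simp add: eq_neg_iff_add_eq_0)
qed

text \<open>The recursion \<open>zz_trace_BB\<close> does not determine pure powers of z. These are
  killed by cyclicity of z^2 against zbar z^a, where moving zbar through two more factors z costs
  \<open>2 * kap\<close>.\<close>

lemma zz_trace_0_right:
  assumes "odd a" shows "zz_trace (Suc a) 0 = 0"
proof -
  let ?q = "gen_zbar * gen_z ^ a" and ?z2 = "gen_z ^ 2"
  have e: "evenF ?z2" using evenF_zz[of 2 0] by simp
  have "evenF ?q"
  proof -
    obtain k where "a = Suc (2 * k)" using assms by (elim oddE) simp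
    moreover have "evenF (gen_z ^ (2 * k))" using evenF_zz[of "2 * k" 0] by simp
    ultimately show ?thesis by (simp add: evenF_def gamma_act_mult gamma_act_gen_z gamma_act_gen_zbar)
  qed
  then have "phiM (nf (?z2 * ?q)) = phiM (nf (?q * ?z2))"
    using tracial_even[OF e] by (simp add: tracial_def)
  also have "nf (?q * ?z2) = BO (zz_basis (Suc (Suc a)) 0)"
  proof -
    have "?q * ?z2 = gen_zbar * (gen_z ^ Suc (Suc a) * gen_zbar ^ 0)"
      by (simp only: mult.assoc power_add[symmetric]) simp
    then show ?thesis by (simp only: nf_mult[of gen_zbar] nf_zz)
  qed
  also have "nf (?z2 * ?q) = AO (AO (BO (zz_basis a 0)))"
    using nf_zz[of a 0] by (simp add: nf_mult power2_eq_square act_mult)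
  also have "\<dots> = (\<lambda>i j. zz_basis (Suc (Suc a)) 1 i j + kap * cc a 0 * zz_basis (Suc a) 0 i j)"
    using assms by (cases a) (simp_all add: BO_zz AO_lin(1) AO_lin(2) AO_zz)
  finally have "zz_trace (Suc (Suc a)) 1 + kap * cc a 0 * zz_trace (Suc a) 0 =
      zz_trace (Suc (Suc a)) 1 + kap * cc (Suc (Suc a)) 0 * zz_trace (Suc a) 0"
    unfolding BO_zz by (simp add: phiM_add'[OF finM_zz finM_zz] zz_trace_def)
  then have "kap * (cc (Suc (Suc a)) 0 - cc a 0) * zz_trace (Suc a) 0 = 0"
    by (auto simp: algebra_simps)
  moreover have "cc (Suc (Suc a)) 0 - cc a 0 = 2" by (simp add: cc_def)
  ultimately show ?thesis using kap_nonzero by simp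
qed

lemma zz_trace_Suc_Suc:
  assumes "even (a + b)"
  shows "zz_trace (Suc a) (Suc b) = iK * hbar1 * rr (Suc a) * zz_trace a b"
proof -
  have "2 * of_nat (Suc (Suc a)) * zz_trace (Suc a) (Suc b) =
      - kap * (cc (Suc a) b * cc (Suc (Suc a)) b) * zz_trace a b"
    using zz_trace_BB[of "Suc (Suc a)" b] assms by (simp add: mult.assoc mult.commute[of "cc (Suc a) b"])
  also have "\<dots> = 2 * of_nat (Suc (Suc a)) * (- kap * rr (Suc a) * zz_trace a b)"
    unfolding cc_cc[OF assms] by (simp only: mult.assoc mult.commute mult.left_commute)
  finally have "2 * of_nat (Suc (Suc a)) * zz_trace (Suc a) (Suc b) =
      2 * of_nat (Suc (Suc a)) * (- kap * rr (Suc a) * zz_trace a b)" .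
  moreover have "2 * of_nat (Suc (Suc a)) \<noteq> (0 :: coeffs)" by (simp del: of_nat_Suc)
  ultimately have "zz_trace (Suc a) (Suc b) = - kap * rr (Suc a) * zz_trace a b"
    using mult_left_cancel by blast
  then show ?thesis by (simp add: kap_def two_hh mult.assoc mult.commute mult.left_commute)
qed

text \<open>The recursion lowers both exponents until one of them is 0; there the trace vanishes
  unless both are 0.\<close>

lemma zz_trace_eq:
  assumes "even (a + b)"
  shows "zz_trace a b = (if a = b then (iK * hbar1) ^ a * (\<Prod>l=1..a. rr l) else 0)"
  using assms
proof (induction a arbitrary: b)
  case 0
  show ?case
  proof (cases b)
    case 0
    have "phiM unitM = 1"
    proof -
      have "{k. unitM k k \<noteq> 0} = {0}" by (auto simp: unitM_def)
      then show ?thesis by (simp add: phiM_def) (simp add: unitM_def)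
    qed
    then show ?thesis using 0 by (simp add: zz_trace_def zz_basis_def)
  next
    case (Suc c)
    then have "even (1 + c)" using 0 by simp
    from zz_trace_BB[OF this] show ?thesis by (simp add: Suc)
  qed
next
  case (Suc a)
  show ?case
  proof (cases b)
    case 0
    then show ?thesis using Suc.prems zz_trace_0_right[of a] by simp
  next
    case (Suc c)
    then have "even (a + c)" using Suc.prems by simp
    then show ?thesis using Suc zz_trace_Suc_Suc[of a c] Suc.IH[of c] by (simp add: ac_simps)
  qed
qed

lemma phiM_nf_sum: "phiM (nf (\<Sum>x\<in>X. f x)) = (\<Sum>x\<in>X. phiM (nf (f x)))"
  by (induction X rule: infinite_finite_induct) (simp_all add: phiM_nf_add)

lemma phiM_nf_ordered_zz:
  assumes "even_poly p"
  shows "phiM (nf (ordered gen_z gen_zbar p)) =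
    (\<Sum>k\<in>Poly_Mapping.keys p. if fst k = snd k
      then const2 (lookup p k) * ((iK * hbar1) ^ fst k * (\<Prod>l=1..fst k. rr l)) else 0)"
  unfolding ordered_def phiM_nf_sum
proof (intro sum.cong refl)
  fix k assume "k \<in> Poly_Mapping.keys p"
  then have "even (fst k + snd k)" using assms by (auto simp: even_poly_def)
  then show "phiM (nf (scalar (lookup p k) * gen_z ^ fst k * gen_zbar ^ snd k)) =
    (if fst k = snd k then const2 (lookup p k) * ((iK * hbar1) ^ fst k * (\<Prod>l=1..fst k. rr l)) else 0)"
    by (simp add: mult.assoc[of "scalar _"] nf_scalar_mult nf_zz phiM_cmult zz_trace_def[symmetric] zz_trace_eq)
qed

lemma nf_ordered_xy: "nf (ordered gX gY p) a b = const2 (lookup p (a, b))"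
proof -
  have YO: "(YO ^^ m) unitM = (\<lambda>a b. if a = 0 \<and> b = m then 1 else 0)" for m
    by (induction m) (auto simp: unitM_def YO_def fun_eq_iff split: nat.split)
  have "(XO ^^ n) ((YO ^^ m) unitM) = (\<lambda>a b. if a = n \<and> b = m then 1 else 0)" for n m
    by (induction n) (auto simp: YO XO_def fun_eq_iff split: nat.split)
  then have mono: "nf (gX ^ n * gY ^ m) = (\<lambda>a b. if a = n \<and> b = m then 1 else 0)" for n m
    by (simp add: nf_def act_mult act_power act_gens[abs_def])
  have "nf (ordered gX gY p) a b = (\<Sum>k\<in>Poly_Mapping.keys p. if k = (a, b) then const2 (lookup p (a, b)) else 0)"
    unfolding ordered_def nf_sum
    by (intro sum.cong) (auto simp: mult.assoc[of "scalar _"] nf_scalar_mult mono)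
  then show ?thesis by (simp add: in_keys_iff)
qed

lemma evenF_0: "evenF 0"
  by (simp add: evenF_def)

lemma evenF_ordered_xy:
  assumes "even_poly p" shows "evenF (ordered gX gY p)"
proof -
  have "evenF (scalar c * gX ^ a * gY ^ b)" if "even (a + b)" for a b c
    using that unfolding evenF_def gamma_act_mult gamma_act_power_odd[OF gamma_act_gen] gamma_act_scalar
    by (cases "even a"; cases "even b") auto
  then have "evenF (\<Sum>k\<in>S. scalar (lookup p k) * gX ^ fst k * gY ^ snd k)" if "S \<subseteq> Poly_Mapping.keys p" for S
    using that assms
    by (induction S rule: infinite_finite_induct) (auto simp: even_poly_def evenF_add evenF_0)
  then show ?thesis by (simp add: ordered_def)
qed

subsection \<open>The quotient \<open>\<R>\<close> acts on the left regular module\<close>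

text \<open>The coefficient of x^a y^b e in F e, for a series F of noncommutative
  polynomials.\<close>

definition Lam :: "nat \<Rightarrow> nat \<Rightarrow> free_alg fls fls \<Rightarrow> coeffs" where
  "Lam a b = coeff_functional.ext (\<lambda>p n m. nf p a b $$ n $$ m)"

lemma coeff_functional_nf: "coeff_functional (\<lambda>p n m. nf p a b $$ n $$ m)"
  using nonnegK_nf by unfold_locales (auto simp: nf_add nonnegK_def)

lemmas Lam_add = coeff_functional.ext_add[OF coeff_functional_nf, folded Lam_def]
lemmas Lam_minus = coeff_functional.ext_minus[OF coeff_functional_nf, folded Lam_def]
lemmas Lam_box = coeff_functional.ext_box[OF coeff_functional_nf, folded Lam_def]
lemmas Lam_times_box = coeff_functional.ext_times_box[OF coeff_functional_nf, folded Lam_def]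
lemmas Lam_const2_nth = coeff_functional.ext_const2[OF coeff_functional_nf, folded Lam_def]
lemmas Lam_scale' = coeff_functional.ext_scale[OF coeff_functional_nf, folded Lam_def]

lemma scalar_0 [simp]: "scalar 0 = 0" and scalar_1 [simp]: "scalar 1 = 1"
  and scalar_add: "scalar (c + d) = scalar c + scalar d"
  and scalar_mult: "scalar (c * d) = scalar c * scalar d"
  by (simp_all add: scalar_def single_add mult_single)

lemma const2_mult_nth:
  fixes c d :: "'a::semiring_1"
  shows "(const2 c * F) $$ n $$ m = c * F $$ n $$ m" "(F * const2 c) $$ n $$ m = F $$ n $$ m * c"
  by (simp_all add: const2_def)

lemma hbar_mult_nth:
  fixes F :: "'a::ring_1 fls fls"
  shows "(hbar1 * F) $$ n $$ m = F $$ n $$ (m - 1)" "(F * hbar1) $$ n $$ m = F $$ n $$ (m - 1)"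
    "(hbar2 * F) $$ n $$ m = F $$ (n - 1) $$ m" "(F * hbar2) $$ n $$ m = F $$ (n - 1) $$ m"
  by (simp_all add: fls_X_times_conv_shift)

lemma hbar1_nth: "hbar1 $$ n $$ m = (if n = 0 \<and> m = 1 then 1 else 0)"
  by simp

lemma hh_mult_nth: "(hh * c) $$ n $$ m = 1/2 * c $$ n $$ (m - 1)"
  and h2_mult_nth: "(h2 * c) $$ n $$ m = c $$ (n - 1) $$ m"
  unfolding hh_def h2_def mult.assoc by (simp_all only: const2_mult_nth hbar_mult_nth)

lemma Lam_const2: "Lam a b (const2 p) = nf p a b"
  by (rule fls2_eqI) (simp add: Lam_const2_nth)

lemma Lam_scale: "Lam a b (map2 scalar c * F) = c * Lam a b F"
  by (rule Lam_scale') (simp_all add: nf_scalar_mult const2_mult_nth)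

lemma nf_kappa_nth:
  "nf (p * kappa * q) a b $$ n $$ m =
    1/2 * (nf (p * q) a b $$ n $$ (m - 1) + 2 * nf (p * gamma_act q) a b $$ (n - 1) $$ (m - 1))"
proof -
  have "nf (p * kappa * q) a b = hh * (nf (p * q) a b + const2 2 * (h2 * nf (p * gamma_act q) a b))"
    unfolding nf_kappa const2_numeral by (simp add: mult.assoc)
  then show ?thesis by (simp only: hh_mult_nth fls_plus_nth const2_mult_nth h2_mult_nth)
qed

text \<open>\<open>nf_kappa\<close> for series: all products are expanded over one box, where
  \<open>hh\<close> shifts the exponent of \<open>hbar1\<close> by one and \<open>h2\<close> that of
  \<open>hbar2\<close>.\<close>

lemma Lam_kappa:
  "Lam a b (u * const2 kappa * w) = hh * (Lam a b (u * w) + 2 * h2 * Lam a b (u * map2 gamma_act w))"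
proof (rule fls2_eqI)
  fix n m
  obtain A1 M1 B1 M1' where b: "lower_box A1 M1 n u" "lower_box B1 M1' n w"
    using lower_box_exists by metis
  obtain A2 M A3 M' where b': "lower_box A2 M (n - B1) u" "lower_box A3 M' (n - A1) w"
    using lower_box_exists by metis
  have u: "lower_box A1 M (n - B1) u" and w: "lower_box B1 M' (n - A1) w"
    using b b' by (auto simp: lower_box_def)
  have uk: "lower_box A1 M (n - B1) (u * const2 kappa)"
    using u by (auto simp: lower_box_def const2_mult_nth const2_def intro!: fls_eqI)
  have gw: "lower_box B1 M' (n - A1) (map2 gamma_act w)"
    using w by (auto simp: lower_box_def map2_nth[of gamma_act] intro!: fls_eqI)
  have box1: "Lam a b (u * const2 kappa * w) $$ n $$ m =
      (\<Sum>i=A1+B1..n. \<Sum>j=M+M'..m. \<Sum>i1=A1..n-B1. \<Sum>j1=M..m-M'.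
        nf ((u * const2 kappa) $$ i1 $$ j1 * w $$ (i - i1) $$ (j - j1)) a b $$ (n - i) $$ (m - j))"
    by (rule Lam_times_box[OF uk w order.refl order.refl])
  \<comment> \<open>The upper limits \<open>n\<close> and \<open>m\<close> are kept for the
    coefficients at lower exponents, so that the sums match.\<close>
  note box =
    Lam_times_box[OF u w order.refl, where m="m - 1" and m'=m, simplified]
    Lam_times_box[OF u gw, where n="n - 1" and m="m - 1" and m'=m, simplified]
  have "(hh * (Lam a b (u * w) + 2 * h2 * Lam a b (u * map2 gamma_act w))) $$ n $$ m =
    1/2 * (Lam a b (u * w) $$ n $$ (m - 1) + 2 * Lam a b (u * map2 gamma_act w) $$ (n - 1) $$ (m - 1))"
    unfolding const2_numeral[symmetric] mult.assoc
    by (simp only: hh_mult_nth fls_plus_nth const2_mult_nth h2_mult_nth)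
  also have "\<dots> = (\<Sum>i=A1+B1..n. \<Sum>j=M+M'..m. \<Sum>i1=A1..n-B1. \<Sum>j1=M..m-M'.
      1/2 * (nf (u $$ i1 $$ j1 * w $$ (i - i1) $$ (j - j1)) a b $$ (n - i) $$ (m - 1 - j) +
        2 * nf (u $$ i1 $$ j1 * gamma_act (w $$ (i - i1) $$ (j - j1))) a b $$ (n - 1 - i) $$ (m - 1 - j)))"
    by (simp only: box map2_nth[of gamma_act, OF gamma_act_0] sum_distrib_left distrib_left sum.distrib)
  also have "\<dots> = Lam a b (u * const2 kappa * w) $$ n $$ m"
  proof -
    have "k - 1 - j = k - j - 1" for j k :: int by simp
    then show ?thesis unfolding box1 const2_mult_nth nf_kappa_nth by (simp only:)
  qed
  finally show "Lam a b (u * const2 kappa * w) $$ n $$ m =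
    (hh * (Lam a b (u * w) + 2 * h2 * Lam a b (u * map2 gamma_act w))) $$ n $$ m" ..
qed

definition rel1 :: "free_alg fls fls" where "rel1 = const2 kappa - const2 (scalar (1/2)) * hbar1"
definition rel2 :: "free_alg fls fls" where "rel2 = - (hbar1 * hbar2)"

lemma relator_eq: "relator = (rel1, rel2)"
  by (simp add: relator_def rel1_def rel2_def kappa_def)

abbreviation "gam \<equiv> map2 gamma_act"

lemma gam_gam: "gam (gam F) = F"
  by (rule fls2_eqI) (simp add: map2_nth[of gamma_act])

lemma gam_rel: "gam rel1 = rel1" "gam rel2 = rel2"
proof -
  have g: "gamma_act 1 = 1" using gamma_act_scalar[of 1] by simp
  have k: "gamma_act kappa = kappa"
    using evenF_minus[OF evenF_gens evenF_gens] by (simp add: kappa_def evenF_def)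
  have u: "gamma_act (- p) = - gamma_act p" for p
    using gamma_act_minus[of 0 p] by simp
  show "gam rel1 = rel1"
    unfolding rel1_def
    by (rule fls2_eqI, simp only: map2_nth[of gamma_act, OF gamma_act_0] fls_minus_nth gamma_act_minus const2_nth const2_mult_nth(1)
      hbar1_nth) (simp add: k gamma_act_mult gamma_act_scalar g)
  show "gam rel2 = rel2"
    unfolding rel2_def
    by (rule fls2_eqI, simp only: map2_nth[of gamma_act, OF gamma_act_0] fls_uminus_nth u hbar_mult_nth(4) hbar1_nth) (simp add: g)
qed

text \<open>This says u (rel1 + rel2 \<gamma>) w e = 0: \<gamma> passes \<open>w\<close>, turning it
  into \<open>gam w\<close>, and is absorbed by e.\<close>

lemma Lam_relation: "Lam a b (u * rel1 * w) + Lam a b (u * rel2 * gam w) = 0"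
proof -
  have half: "const2 (scalar (1/2)) * hbar1 = map2 scalar hh"
    unfolding hh_def
    by (rule fls2_eqI, simp only: map2_nth[of scalar, OF scalar_0] const2_mult_nth(1) hbar1_nth) simp
  have h12: "hbar1 * hbar2 = map2 scalar (hbar1 * hbar2)"
    by (rule fls2_eqI, simp only: map2_nth[of scalar, OF scalar_0] hbar_mult_nth(3) hbar1_nth) simp
  have "u * (const2 (scalar (1/2)) * hbar1) * w = map2 scalar hh * (u * w)"
    unfolding half[symmetric] mult.assoc[symmetric]
    by (rule arg_cong[of _ _ "\<lambda>x. x * w"], rule fls2_eqI) (simp only: const2_mult_nth hbar_mult_nth mult.assoc[of "const2 (scalar (1/2))" hbar1 u] scalar_commute)
  moreover have "u * (hbar1 * hbar2) * gam w = map2 scalar (hbar1 * hbar2) * (u * gam w)"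
    unfolding h12[symmetric] mult.assoc[symmetric]
    by (rule arg_cong[of _ _ "\<lambda>x. x * gam w"], rule fls2_eqI) (simp only: hbar_mult_nth mult.assoc[of hbar1 hbar2 u])
  ultimately have "Lam a b (u * rel1 * w) + Lam a b (u * rel2 * gam w) =
    Lam a b (u * const2 kappa * w) - hh * Lam a b (u * w) - hbar1 * hbar2 * Lam a b (u * gam w)"
    by (simp add: rel1_def rel2_def left_diff_distrib right_diff_distrib Lam_minus Lam_scale
        coeff_functional.ext_uminus[OF coeff_functional_nf, folded Lam_def])
  then show ?thesis
    unfolding Lam_kappa two_hh h2_def[symmetric] by (simp add: algebra_simps)
qed

text \<open>Since \<gamma> e = e, the two components of the crossed product act on e in the same
  way.\<close>

definition LamC :: "nat \<Rightarrow> nat \<Rightarrow> crossed \<Rightarrow> coeffs" where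
  "LamC a b u = Lam a b (fst u) + Lam a b (snd u)"

lemma LamC_relator_ideal: "u \<in> relator_ideal \<Longrightarrow> LamC a b u = 0"
proof (induction rule: relator_ideal.induct)
  case (gen u w)
  obtain u1 u2 w1 w2 where uw: "u = (u1, u2)" "w = (w1, w2)" by (cases u; cases w) auto
  \<comment> \<open>The two components of \<open>u\<close> and of \<open>w\<close> give four copies
    of the relation.\<close>
  have "LamC a b (u \<odot> relator \<odot> w) =
     (Lam a b (u1 * rel1 * w1) + Lam a b (u1 * rel2 * gam w1)) + (Lam a b (u1 * rel1 * w2) + Lam a b (u1 * rel2 * gam w2))
   + (Lam a b (u2 * rel1 * gam w1) + Lam a b (u2 * rel2 * gam (gam w1))) + (Lam a b (u2 * rel1 * gam w2) + Lam a b (u2 * rel2 * gam (gam w2)))"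
    by (simp add: uw relator_eq gam_rel gam_gam LamC_def distrib_right Lam_add)
  then show ?case by (simp add: Lam_relation)
next
  case (add u v)
  then show ?case by (simp add: LamC_def Lam_add algebra_simps)
qed

lemma LamC_eq_R: "u \<doteq> v \<Longrightarrow> LamC a b u = LamC a b v"
  using LamC_relator_ideal[of "u - v" a b] by (simp add: eq_R_def LamC_def Lam_minus algebra_simps)

lemma spherical_eq: "spherical F = (F * const2 (scalar (1/2)), F * const2 (scalar (1/2)))"
  by (simp add: spherical_def idem_def)

lemma half_half: "F * const2 (scalar (1/2)) + F * const2 (scalar (1/2)) = F"
  by (simp add: distrib_left[symmetric] const2_add[symmetric] scalar_add[symmetric])

lemma LamC_spherical: "LamC a b (spherical F) = Lam a b F"
  unfolding LamC_def spherical_eq by (simp add: Lam_add[symmetric] half_half)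

text \<open>On ordered monomials the action on e returns the coefficients, so \<open>h\<close> can
  be recovered from \<open>series_spherical h\<close> modulo the ideal.\<close>

lemma Lam_ordered:
  "Lam a b (map2 (ordered gX gY) h) = map2 (\<lambda>p. lookup p (a, b)) h"
proof (rule fls2_eqI)
  fix n m
  have o0: "ordered gX gY 0 = 0" by (simp add: ordered_def)
  obtain A M where h: "lower_box A M n h" using lower_box_exists by metis
  have h': "lower_box (min A n) (min M m) n h" using h by (auto simp: lower_box_def)
  have "lower_box (min A n) (min M m) n (map2 (ordered gX gY) h)"
    using h' by (auto simp: lower_box_def map2_nth[of "ordered gX gY"] o0 intro!: fls_eqI)
  from Lam_box[OF this order.refl order.refl, of a b m]
  have "Lam a b (map2 (ordered gX gY) h) $$ n $$ m =
    (\<Sum>i=min A n..n. \<Sum>j=min M m..m. const2 (lookup (h $$ i $$ j) (a, b)) $$ (n - i) $$ (m - j))"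
    by (simp add: map2_nth[of "ordered gX gY"] o0 nf_ordered_xy)
  also have "\<dots> = (\<Sum>i=min A n..n. if i = n then \<Sum>j=min M m..m. if j = m then lookup (h $$ n $$ m) (a, b) else 0 else 0)"
  proof (intro sum.cong refl)
    fix i
    have "const2 (lookup (h $$ i $$ j) (a, b)) $$ (n - i) $$ (m - j) = 
      (if i = n then if j = m then lookup (h $$ n $$ m) (a, b) else 0 else 0)" for j
      by (simp add: const2_nth)
    then show "(\<Sum>j=min M m..m. const2 (lookup (h $$ i $$ j) (a, b)) $$ (n - i) $$ (m - j)) =
      (if i = n then \<Sum>j=min M m..m. if j = m then lookup (h $$ n $$ m) (a, b) else 0 else 0)"
      by (cases "i = n") simp_all
  qed
  also have "\<dots> = lookup (h $$ n $$ m) (a, b)"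
  proof -
    have "(\<Sum>j=min M m..m. if j = m then lookup (h $$ n $$ m) (a, b) else 0) = lookup (h $$ n $$ m) (a, b)"
      by simp
    then show ?thesis by simp
  qed
  finally show "Lam a b (map2 (ordered gX gY) h) $$ n $$ m = map2 (\<lambda>p. lookup p (a, b)) h $$ n $$ m"
    by (simp add: map2_nth)
qed

lemma LamC_series_spherical: "LamC a b (series_spherical h) = map2 (\<lambda>p. lookup p (a, b)) h"
  by (simp add: series_spherical_def LamC_spherical Lam_ordered)

lemma map2_const2: "f 0 = 0 \<Longrightarrow> map2 f (const2 c) = const2 (f c)"
  by (rule map2_eq) (simp_all add: const2_nth)

lemma series_spherical_const2: "series_spherical (const2 p) = spherical (const2 (ordered gX gY p))"
proof -
  have "ordered gX gY 0 = 0" by (simp add: ordered_def)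
  then show ?thesis by (simp add: series_spherical_def map2_const2)
qed

text \<open>An even \<open>q\<close> commutes with e, hence p e q e = p q e.\<close>

lemma LamC_product:
  assumes "evenF q"
  shows "LamC a b (spherical (const2 p) \<odot> spherical (const2 q)) = nf (p * q) a b"
proof -
  let ?s = "scalar (1/2)"
  have g: "gam (const2 (q * ?s)) = const2 (q * ?s)"
    using assms by (simp add: map2_const2 gamma_act_mult gamma_act_scalar evenF_def)
  have "p * ?s * (q * ?s) + p * ?s * (q * ?s) + (p * ?s * (q * ?s) + p * ?s * (q * ?s)) = p * q"
  proof -
    have s2: "?s * ?s + ?s * ?s + (?s * ?s + ?s * ?s) = 1"
      by (simp only: scalar_mult[symmetric] scalar_add[symmetric]) simp
    have "p * ?s * (q * ?s) = (p * q) * (?s * ?s)"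
      by (simp add: mult.assoc scalar_commute[of "1/2" "q * _"] scalar_commute[of "1/2" q])
    moreover have "r * x + r * x + (r * x + r * x) = r * (x + x + (x + x))" for r x :: free_alg
      by (simp only: distrib_left)
    from this[of "p * q" "?s * ?s"] have "p * q * (?s * ?s) + p * q * (?s * ?s) + (p * q * (?s * ?s) + p * q * (?s * ?s)) = p * q"
      unfolding s2 by simp
    ultimately show ?thesis by (simp only:)
  qed
  then show ?thesis
    unfolding spherical_eq const2_mult[symmetric] crossed_mult.simps g LamC_def fst_conv snd_conv
    by (simp only: const2_mult[symmetric] const2_add[symmetric] Lam_const2 Lam_add[symmetric] nf_add[symmetric, THEN fun_cong, THEN fun_cong])
qed

text \<open>The normal form is read off from the action on the left regular module, which kills the ideal
  of the relator.\<close>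

lemma series_of_product:
  assumes "even_poly g"
    and "series_spherical (const2 f) \<odot> series_spherical (const2 g) \<doteq> series_spherical h"
  shows "map2 (\<lambda>p. lookup p (a, b)) h = nf (ordered gX gY f * ordered gX gY g) a b"
  using LamC_eq_R[OF assms(2), of a b]
  by (simp add: LamC_series_spherical) (simp add: series_spherical_const2 LamC_product evenF_ordered_xy assms(1))

lemma series_of_spherical:
  assumes "spherical (const2 q) \<doteq> series_spherical h"
  shows "map2 (\<lambda>p. lookup p (a, b)) h = nf q a b"
  using LamC_eq_R[OF assms, of a b] by (simp add: LamC_series_spherical LamC_spherical Lam_const2)

subsection \<open>Functionals on the algebra of Laurent series\<close>

text \<open>The monomial \<open>hbar2^n hbar1^m\<close>; negative exponents allow division by the
  parameters.\<close>

definition hp :: "int \<Rightarrow> int \<Rightarrow> 'a::{zero,one} fls fls" where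
  "hp n m = fls_shift (- n) (fls_const (fls_shift (- m) 1))"

lemma hp_nth: "hp n m $$ i $$ j = (if i = n \<and> j = m then 1 else 0)"
  by (auto simp: hp_def)

lemma hp_mult_nth: "(hp n m * F) $$ i $$ j = F $$ (i - n) $$ (j - m)" for F :: "'a::ring_1 fls fls"
  unfolding hp_def by (simp add: fls_shifted_times_simps)

lemma smult_hp_nth: "smult (hp n m) F $$ i $$ j = F $$ (i - n) $$ (j - m)"
proof -
  have "map2 es_const (hp n m) = hp n m"
    by (rule map2_eq) (simp_all add: hp_nth)
  then show ?thesis by (simp add: smult_def hp_mult_nth)
qed

lemma smult_const2_nth: "smult (const2 c) F $$ i $$ j = es_const c * F $$ i $$ j"
  by (simp add: smult_def map2_const2 const2_mult_nth)

lemma smult_diff: "smult c (F - G) = smult c F - smult c G" and smult_add: "smult c (F + G) = smult c F + smult c G"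
  by (simp_all add: smult_def algebra_simps)

lemma map2_es_const_mult: "map2 es_const (c * d) = map2 es_const c * map2 es_const d"
proof -
  have "map2 (\<lambda>x. x) c = c" by (rule map2_eq) simp_all
  with map2_times[of es_const "\<lambda>x. x" es_const c d] show ?thesis
    by (simp add: es_const_add es_const_mult)
qed

lemma smult_smult: "smult c (smult d F) = smult (c * d) F"
  by (simp add: smult_def map2_es_const_mult mult.assoc)

definition kbounded :: "coeffs set \<Rightarrow> bool" where
  "kbounded T \<longleftrightarrow> (\<exists>N. \<forall>c\<in>T. \<forall>n<N. c $$ n = 0) \<and> (\<forall>n. \<exists>M. \<forall>c\<in>T. \<forall>m<M. c $$ n $$ m = 0) \<and>
     (\<forall>n m. bounded ((\<lambda>c. c $$ n $$ m) ` T))"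

lemma dunkl_bounded_mono: "dunkl_bounded T \<Longrightarrow> S \<subseteq> T \<Longrightarrow> dunkl_bounded S"
  unfolding dunkl_bounded_def by (meson es_bounded_mono image_mono subsetD)

lemma finite_fls_lower_bound: "finite X \<Longrightarrow> \<exists>M. \<forall>f\<in>X. \<forall>m<M. f $$ m = (0 :: 'a::zero)"
proof (induction X rule: finite_induct)
  case (insert f X)
  then obtain M where "\<forall>f\<in>X. \<forall>m<M. f $$ m = 0" by blast
  then show ?case by (intro exI[of _ "min M (fls_subdegree f)"]) auto
qed auto

lemma dunkl_bounded_finite:
  assumes "finite S" shows "dunkl_bounded S"
proof -
  have "\<exists>M. \<forall>F\<in>S. \<forall>m<M. F $$ n $$ m = 0" for n
    using finite_fls_lower_bound[of "(\<lambda>F. F $$ n) ` S"] assms by auto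
  then show ?thesis
    unfolding dunkl_bounded_def using finite_fls_lower_bound[OF assms] assms by (auto intro!: es_bounded_finite)
qed

lemma dunkl_bounded_lower_box:
  assumes "dunkl_bounded S" obtains A M where "\<And>F. F \<in> S \<Longrightarrow> lower_box A M n F"
proof -
  obtain A where A: "\<And>F i. F \<in> S \<Longrightarrow> i < A \<Longrightarrow> F $$ i = 0"
    using assms unfolding dunkl_bounded_def by blast
  obtain M where M: "\<And>i F j. F \<in> S \<Longrightarrow> j < M i \<Longrightarrow> F $$ i $$ j = 0"
    using assms unfolding dunkl_bounded_def by metis
  define M0 where "M0 = Min (insert 0 (M ` {A..n}))"
  have "F $$ i $$ j = 0" if "F \<in> S" "i \<le> n" "j < M0" for F i j
  proof (cases "i < A")
    case False
    then have "M0 \<le> M i" unfolding M0_def using that by (intro Min_le) auto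
    then show ?thesis using M that by auto
  qed (use A that in auto)
  then show ?thesis using A by (intro that[of A M0]) (auto simp: lower_box_def)
qed

lemma es_bounded_const2: "es_bounded S \<Longrightarrow> dunkl_bounded (const2 ` S)"
proof -
  assume S: "es_bounded S"
  have "es_bounded ((\<lambda>F. F $$ n $$ m) ` const2 ` S)" for n m
    by (rule es_bounded_mono[OF es_bounded_Un[OF S es_bounded_finite[of "{0}"]]]) (auto simp: const2_nth)
  then show ?thesis
    unfolding dunkl_bounded_def
    by (auto simp: const2_nth const2_def intro!: exI[of _ 0])
qed

definition tail1 :: "int \<Rightarrow> dunkl \<Rightarrow> dunkl" where
  "tail1 k F = fls2_of (\<lambda>i j. if j < k then 0 else F $$ i $$ j)"

definition tail2 :: "int \<Rightarrow> dunkl \<Rightarrow> dunkl" where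
  "tail2 k F = fls2_of (\<lambda>i j. if i < k then 0 else F $$ i $$ j)"

lemma tail1_nth: "tail1 k F $$ i $$ j = (if j < k then 0 else F $$ i $$ j)"
  unfolding tail1_def
proof (rule fls2_of_nth[of "fls_subdegree F"])
  show "\<exists>M. \<forall>j<M. (if j < k then 0 else F $$ i $$ j) = 0" for i by (rule exI[of _ k]) auto
qed auto

lemma tail2_nth: "tail2 k F $$ i $$ j = (if i < k then 0 else F $$ i $$ j)"
  unfolding tail2_def
proof (rule fls2_of_nth[of k])
  show "\<exists>M. \<forall>j<M. (if i < k then 0 else F $$ i $$ j) = 0" for i
    by (rule exI[of _ "fls_subdegree (F $$ i)"]) auto
qed auto

text \<open>A bounded functional is continuous for the adic topologies: the tails of order \<open>2 k\<close>, divided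
  by the \<open>k\<close>-th power of the parameter, form a bounded sequence.\<close>

lemma functional_eq_0:
  fixes L :: "dunkl \<Rightarrow> coeffs"
  assumes add: "\<And>F G. L (F + G) = L F + L G" and smult: "\<And>c F. L (smult c F) = c * L F"
    and bdd: "\<And>S. dunkl_bounded S \<Longrightarrow> kbounded (L ` S)"
    and poly: "\<And>p. even_poly p \<Longrightarrow> L (const2 (es_poly p)) = 0"
  shows "L F = 0"
proof -
  have const: "L (const2 f) = 0" for f
  proof (rule fls2_eqI)
    fix n m
    have "L (const2 f) $$ n $$ m = 0"
    proof (rule bounded_functional_eq_0[of "\<lambda>f. L (const2 f) $$ n $$ m"])
      show "L (const2 (f + g)) $$ n $$ m = L (const2 f) $$ n $$ m + L (const2 g) $$ n $$ m" for f g
        by (simp add: const2_add add)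
      have "const2 (es_const c * f) = smult (const2 c) (const2 f)" for c f
        by (rule fls2_eqI) (simp add: smult_const2_nth const2_nth)
      then show "L (const2 (es_const c * f)) $$ n $$ m = c * L (const2 f) $$ n $$ m" for c f
        by (simp add: smult const2_mult_nth)
      show "bounded ((\<lambda>f. L (const2 f) $$ n $$ m) ` S)" if "es_bounded S" for S
        using bdd[OF es_bounded_const2[OF that]] unfolding kbounded_def by (simp add: image_image)
      show "L (const2 (es_poly p)) $$ n $$ m = 0" if "even_poly p" for p
        using poly[OF that] by simp
    qed
    then show "L (const2 f) $$ n $$ m = 0 $$ n $$ m" by simp
  qed
  have hp_L: "L G = hp n m * L (smult (hp (- n) (- m)) G)" for n m G
  proof -
    have "smult (hp n m) (smult (hp (- n) (- m)) G) = G"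
      by (rule fls2_eqI) (simp add: smult_hp_nth)
    then show ?thesis using smult[of "hp n m" "smult (hp (- n) (- m)) G"] by simp
  qed
  \<comment> \<open>First a single power of \<open>hbar2\<close>. Finitely many powers of
    \<open>hbar1\<close> can be removed without changing \<open>L F\<close>, so only the tails
    matter.\<close>
  have row: "L F = 0" if F: "\<And>i. i \<noteq> n \<Longrightarrow> F $$ i = 0" for F n
  proof -
    define m0 where "m0 = fls_subdegree (F $$ n)"
    have step: "L (tail1 (k + 1) F) = L (tail1 k F)" for k
    proof -
      have "tail1 k F = tail1 (k + 1) F + smult (hp n k) (const2 (F $$ n $$ k))"
      proof (rule fls2_eqI)
        fix i j
        show "tail1 k F $$ i $$ j = (tail1 (k + 1) F + smult (hp n k) (const2 (F $$ n $$ k))) $$ i $$ j"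
          using F[of i] by (cases "i = n") (auto simp: tail1_nth smult_hp_nth const2_nth)
      qed
      then show ?thesis by (simp add: add smult const)
    qed
    have tail: "L (tail1 k F) = L F" if "m0 \<le> k" for k
      using that
    proof (induction k rule: int_ge_induct)
      case base
      have "tail1 m0 F = F"
      proof (rule fls2_eqI)
        fix i j show "tail1 m0 F $$ i $$ j = F $$ i $$ j"
          using F[of i] by (cases "i = n") (auto simp: tail1_nth m0_def)
      qed
      then show ?case by simp
    qed (simp add: step)
    \<comment> \<open>After the division the exponents are still at least k, so a given coefficient
      is nonzero for finitely many k only.\<close>
    define G where "G = (\<lambda>k::nat. smult (hp 0 (- int k)) (tail1 (2 * int k) F))"
    have G: "G k $$ i $$ j = (if j < int k then 0 else F $$ i $$ (j + int k))" for k i j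
      by (auto simp: G_def smult_hp_nth tail1_nth)
    have "dunkl_bounded (range G)"
      unfolding dunkl_bounded_def
    proof (intro conjI allI)
      have "G k $$ i = 0" if "i < n" for k i
        by (rule fls_eqI) (use F[of i] that in \<open>auto simp: G\<close>)
      then show "\<exists>N. \<forall>H\<in>range G. \<forall>i<N. H $$ i = 0" by blast
      show "\<exists>M. \<forall>H\<in>range G. \<forall>j<M. H $$ i $$ j = 0" for i
        by (rule exI[of _ 0]) (auto simp: G)
      fix i j
      have "(\<lambda>H. H $$ i $$ j) ` range G \<subseteq> insert 0 ((\<lambda>k. F $$ i $$ (j + int k)) ` {..nat j})"
        by (auto simp: G not_less)
      moreover have "finite \<dots>" by simp
      ultimately show "es_bounded ((\<lambda>H. H $$ i $$ j) ` range G)"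
        by (intro es_bounded_finite) (rule finite_subset)
    qed
    from bdd[OF this] have "\<forall>n. \<exists>M. \<forall>c\<in>L ` range G. \<forall>m<M. c $$ n $$ m = 0"
      unfolding kbounded_def by blast
    then obtain M where "\<forall>n. \<forall>c\<in>L ` range G. \<forall>m<M n. c $$ n $$ m = 0"
      unfolding choice_iff by blast
    then have M: "L (G k) $$ i $$ j = 0" if "j < M i" for i j k
      using that by blast
    show ?thesis
    proof (rule fls2_eqI)
      fix i j
      \<comment> \<open>\<open>M i\<close> is a lower bound for the exponents of all
        \<open>L (G k)\<close>; multiplying back by the k-th power of \<open>hbar1\<close> lifts it
        above \<open>j\<close>.\<close>
      define k where "k = nat (max (j - M i + 1) m0)"
      have k: "m0 \<le> int k" "j - int k < M i" unfolding k_def by linarith+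
      then have "L F = L (tail1 (2 * int k) F)" by (intro tail[symmetric]) linarith
      also have "\<dots> = hp 0 (int k) * L (G k)" unfolding G_def by (rule hp_L[of _ 0, simplified])
      finally have "L F $$ i $$ j = L (G k) $$ i $$ (j - int k)" by (simp add: hp_mult_nth)
      also have "\<dots> = 0" by (rule M[OF k(2)])
      finally show "L F $$ i $$ j = 0 $$ i $$ j" by simp
    qed
  qed
  define n0 where "n0 = fls_subdegree F"
  have step: "L (tail2 (k + 1) F) = L (tail2 k F)" for k
  proof -
    \<comment> \<open>Consecutive tails differ by one row, to which the first part applies.\<close>
    have "L (tail2 k F - tail2 (k + 1) F) = 0"
      by (rule row[of k]) (auto intro!: fls_eqI simp: tail2_nth)
    then show ?thesis using add[of "tail2 k F - tail2 (k + 1) F" "tail2 (k + 1) F"] by simp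
  qed
  have tail: "L (tail2 k F) = L F" if "n0 \<le> k" for k
    using that
  proof (induction k rule: int_ge_induct)
    case base
    have "tail2 n0 F = F"
      by (rule fls2_eqI) (auto simp: tail2_nth n0_def)
    then show ?case by simp
  qed (simp add: step)
  define G where "G = (\<lambda>k::nat. smult (hp (- int k) 0) (tail2 (2 * int k) F))"
  have G: "G k $$ i $$ j = (if i < int k then 0 else F $$ (i + int k) $$ j)" for k i j
    by (auto simp: G_def smult_hp_nth tail2_nth)
  have "dunkl_bounded (range G)"
    unfolding dunkl_bounded_def
  proof (intro conjI allI)
    have "G k $$ i = 0" if "i < 0" for k i
      by (rule fls_eqI) (use that in \<open>auto simp: G\<close>)
    then show "\<exists>N. \<forall>H\<in>range G. \<forall>i<N. H $$ i = 0" by blast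
    show "\<exists>M. \<forall>H\<in>range G. \<forall>j<M. H $$ i $$ j = 0" for i
    proof -
      obtain M where "\<forall>f\<in>(\<lambda>k. F $$ (i + int k)) ` {..nat i}. \<forall>m<M. f $$ m = 0"
        using finite_fls_lower_bound[of "(\<lambda>k. F $$ (i + int k)) ` {..nat i}"] by blast
      then show ?thesis by (intro exI[of _ M]) (auto simp: G)
    qed
    fix i j
    have "(\<lambda>H. H $$ i $$ j) ` range G \<subseteq> insert 0 ((\<lambda>k. F $$ (i + int k) $$ j) ` {..nat i})"
      by (auto simp: G not_less)
    moreover have "finite \<dots>" by simp
    ultimately show "es_bounded ((\<lambda>H. H $$ i $$ j) ` range G)"
      by (intro es_bounded_finite) (rule finite_subset)
  qed
  from bdd[OF this] obtain N where "\<forall>c\<in>L ` range G. \<forall>n<N. c $$ n = 0"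
    unfolding kbounded_def by blast
  then have N: "L (G k) $$ i = 0" if "i < N" for i k
    using that by blast
  show ?thesis
  proof (rule fls2_eqI)
    fix i j
    define k where "k = nat (max (i - N + 1) n0)"
    have k: "n0 \<le> int k" "i - int k < N" unfolding k_def by linarith+
    then have "L F = L (tail2 (2 * int k) F)" by (intro tail[symmetric]) linarith
    also have "\<dots> = hp (int k) 0 * L (G k)" unfolding G_def by (rule hp_L[of _ _ 0, simplified])
    finally have "L F $$ i $$ j = L (G k) $$ (i - int k) $$ j" by (simp add: hp_mult_nth)
    also have "L (G k) $$ (i - int k) = 0" by (simp add: N[OF k(2)])
    finally show "L F $$ i $$ j = 0 $$ i $$ j" by simp
  qed
qed

subsection \<open>The trace\<close>

text \<open>The derivative divided by (m!)^2 is the Taylor coefficient of x^m y^m. As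
  \<open>tau k\<close> is homogeneous of degree k in \<open>hbar1\<close>, no other Taylor
  coefficient is seen at exponent m.\<close>

definition theta :: "even_smooth \<Rightarrow> int \<Rightarrow> int \<Rightarrow> complex" where
  "theta f n m = (if m < 0 then 0 else
     tau (nat m) $$ n $$ m * (partial (nat m) (nat m) (es_fun f) (0, 0) / (fact (nat m))\<^sup>2))"

lemma coeff_functional_theta: "coeff_functional theta"
proof
  show "theta (f + g) n m = theta f n m + theta g n m" for f g n m
    by (simp add: theta_def partial_es_add add_divide_distrib algebra_simps)
  show "theta f n m = 0" if "n < 0 \<or> m < 0" for f n m
    using that pureK_tau[of "nat m"] by (auto simp: theta_def pureK_def)
qed

definition phi :: "dunkl \<Rightarrow> coeffs" where
  "phi = coeff_functional.ext theta"

lemmas phi_add = coeff_functional.ext_add[OF coeff_functional_theta, folded phi_def]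
lemmas phi_minus = coeff_functional.ext_minus[OF coeff_functional_theta, folded phi_def]
lemmas phi_box = coeff_functional.ext_box[OF coeff_functional_theta, folded phi_def]
lemmas phi_const2_nth = coeff_functional.ext_const2[OF coeff_functional_theta, folded phi_def]

lemma phi_smult: "phi (smult c F) = c * phi F"
  unfolding smult_def phi_def
  by (rule coeff_functional.ext_scale[OF coeff_functional_theta]) (simp_all add: theta_def partial_es_cmult)

lemma phi_bounded:
  assumes S: "dunkl_bounded S" shows "kbounded (phi ` S)"
  unfolding kbounded_def
proof (intro conjI allI)
  obtain A where A: "\<And>F i. F \<in> S \<Longrightarrow> i < A \<Longrightarrow> F $$ i = 0"
    using S unfolding dunkl_bounded_def by blast
  have "phi F $$ i = 0" if "F \<in> S" "i < A" for F i
  proof (rule fls_eqI)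
    fix j
    obtain A' M where "lower_box A' M i F" using lower_box_exists by metis
    then have "lower_box A M i F" using A that by (auto simp: lower_box_def)
    from phi_box[OF this order.refl order.refl] show "phi F $$ i $$ j = 0 $$ j" using that by simp
  qed
  then show "\<exists>N. \<forall>c\<in>phi ` S. \<forall>n<N. c $$ n = 0" by blast
  show "\<exists>M. \<forall>c\<in>phi ` S. \<forall>m<M. c $$ n $$ m = 0" for n
  proof -
    obtain A M where b: "\<And>F. F \<in> S \<Longrightarrow> lower_box A M n F" using dunkl_bounded_lower_box[OF S] by metis
    have "phi F $$ n $$ m = 0" if "F \<in> S" "m < M" for F m
      using phi_box[OF b[OF that(1)] order.refl order.refl, of m] that by simp
    then show ?thesis by blast
  qed
  show "bounded ((\<lambda>c. c $$ n $$ m) ` phi ` S)" for n m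
  proof -
    obtain A M where b: "\<And>F. F \<in> S \<Longrightarrow> lower_box A M n F" using dunkl_bounded_lower_box[OF S] by metis
    have "\<exists>B. \<forall>F\<in>S. cmod (theta (F $$ i $$ j) p q) \<le> B" for i j p q
    proof -
      have "es_bounded ((\<lambda>F. F $$ i $$ j) ` S)" using S unfolding dunkl_bounded_def by blast
      then obtain B where B: "\<And>F. F \<in> S \<Longrightarrow> cmod (partial (nat q) (nat q) (es_fun (F $$ i $$ j)) (0, 0)) \<le> B"
        unfolding es_bounded_iff using compact_sing[of "(0::real, 0::real)"] by (metis imageI singletonI)
      have "cmod (theta (F $$ i $$ j) p q) \<le> cmod (tau (nat q) $$ p $$ q) * (\<bar>B\<bar> / cmod ((fact (nat q))\<^sup>2))" if "F \<in> S" for F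
        using B[OF that] unfolding theta_def
        by (auto simp: norm_mult norm_divide intro!: mult_left_mono divide_right_mono)
      then show ?thesis by blast
    qed
    then have "\<forall>i j. \<exists>B. \<forall>F\<in>S. cmod (theta (F $$ i $$ j) (n - i) (m - j)) \<le> B" by blast
    then obtain B where "\<forall>i j. \<forall>F\<in>S. cmod (theta (F $$ i $$ j) (n - i) (m - j)) \<le> B i j"
      unfolding choice_iff by blast
    then have B: "cmod (theta (F $$ i $$ j) (n - i) (m - j)) \<le> B i j" if "F \<in> S" for F i j
      using that by blast
    have "cmod (phi F $$ n $$ m) \<le> (\<Sum>i=A..n. \<Sum>j=M..m. B i j)" if "F \<in> S" for F
      unfolding phi_box[OF b[OF that] order.refl order.refl] by (intro sum_norm_le B that)
    then show ?thesis unfolding bounded_iff by blast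
  qed
qed

lemma phi_1: "phi 1 = 1"
proof (rule fls2_eqI)
  fix n m
  have 0: "(pdy ^^ Suc k) (\<lambda>p. 1 :: complex) = (\<lambda>p. 0)" "(pdx ^^ k) (\<lambda>p. 0) = (\<lambda>p. 0)" for k
    by (induction k) (simp_all add: pd_const)
  have "partial (Suc k) (Suc k) (\<lambda>p. 1) = (\<lambda>p. 0)" for k
    unfolding partial_def 0(1) by (rule 0(2))
  then have "theta 1 n m = (if n = 0 \<and> m = 0 then 1 else 0)"
    by (cases "nat m") (auto simp: theta_def one_even_smooth.rep_eq)
  then show "phi 1 $$ n $$ m = 1 $$ n $$ m"
    using phi_const2_nth[of 1 n m] by simp
qed

lemma es_poly_0 [simp]: "es_poly 0 = 0"
  by (rule es_eqI) (simp add: es_fun_es_poly even_poly_def es_fun_simps poly_xy_def)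

lemma series_fun_nth: "series_fun h $$ n $$ m = es_poly (h $$ n $$ m)"
proof -
  have "Abs_even_smooth (poly_xy 0) = 0" using es_poly_0 by (simp add: es_poly_def)
  then show ?thesis by (simp add: series_fun_def map2_nth es_poly_def)
qed

lemma theta_es_poly:
  "even_poly p \<Longrightarrow> theta (es_poly p) n m = (if m < 0 then 0 else tau (nat m) $$ n $$ m * lookup p (nat m, nat m))"
  by (simp add: theta_def es_fun_es_poly partial_poly_xy_0 power2_eq_square)

text \<open>On polynomial coefficients the functional agrees with the one on normal forms, which
  carries cyclicity from words to the star product.\<close>

lemma phi_series_fun:
  assumes even: "even_series h" and v: "\<And>a b. map2 (\<lambda>p. lookup p (a, b)) h = v a b" and fin: "finM N v"
  shows "phi (series_fun h) = phiM v"
proof (rule fls2_eqI)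
  fix n m
  obtain A0 M0 where "lower_box A0 M0 n h" using lower_box_exists by metis
  then have h: "lower_box (min A0 0) (min M0 0) n h" by (auto simp: lower_box_def)
  define A M where "A = min A0 0" and "M = min M0 0"
  have AM: "A \<le> 0" "M \<le> 0" "lower_box A M n h" using h by (auto simp: A_def M_def)
  have v_nth: "v a b $$ i $$ j = lookup (h $$ i $$ j) (a, b)" for a b i j
    unfolding v[symmetric] by (simp add: map2_nth)
  have sf: "lower_box A M n (series_fun h)"
    using AM(3) by (auto simp: lower_box_def series_fun_nth intro!: fls_eqI)
  have bv: "lower_box A M (n - 0) (v k k)" for k
    using AM(3) by (auto simp: lower_box_def v_nth intro!: fls_eqI)
  have bt: "lower_box 0 0 (n - A) (tau k)" for k
    using pureK_tau[of k] by (auto simp: lower_box_def pureK_def intro!: fls_eqI)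
  have "phiM v $$ n $$ m = (\<Sum>k\<le>N. (v k k * tau k) $$ n $$ m)"
    unfolding phiM_eq[OF fin order.refl] by (simp add: fls_sum_nth)
  also have "\<dots> = (\<Sum>k\<le>N. \<Sum>i=A..n. \<Sum>j=M..m. v k k $$ i $$ j * tau k $$ (n - i) $$ (m - j))"
    by (intro sum.cong refl) (simp add: fls2_times_nth_box[OF bv bt order.refl order.refl])
  also have "\<dots> = (\<Sum>i=A..n. \<Sum>k\<le>N. \<Sum>j=M..m. v k k $$ i $$ j * tau k $$ (n - i) $$ (m - j))"
    by (rule sum.swap)
  also have "\<dots> = (\<Sum>i=A..n. \<Sum>j=M..m. \<Sum>k\<le>N. v k k $$ i $$ j * tau k $$ (n - i) $$ (m - j))"
    by (intro sum.cong refl sum.swap)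
  also have "\<dots> = (\<Sum>i=A..n. \<Sum>j=M..m. theta (series_fun h $$ i $$ j) (n - i) (m - j))"
  proof (intro sum.cong refl)
    fix i j assume "i \<in> {A..n}" "j \<in> {M..m}"
    then have "0 \<le> m - j" by simp
    \<comment> \<open>By homogeneity of \<open>tau\<close> only \<open>k = m - j\<close> survives in
      the sum over k.\<close>
    define q where "q = nat (m - j)"
    have mj: "m - j = int q" using \<open>0 \<le> m - j\<close> by (simp add: q_def)
    have "(\<Sum>k\<le>N. v k k $$ i $$ j * tau k $$ (n - i) $$ (m - j)) =
        (\<Sum>k\<le>N. if k = q then v q q $$ i $$ j * tau q $$ (n - i) $$ (m - j) else 0)"
      using pureK_tau by (intro sum.cong) (auto simp: pureK_def mj)
    also have "\<dots> = v q q $$ i $$ j * tau q $$ (n - i) $$ (m - j)"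
      using fin by (auto simp: finM_def)
    also have "\<dots> = theta (series_fun h $$ i $$ j) (n - i) (m - j)"
      using even by (simp add: series_fun_nth theta_es_poly even_series_def mj v_nth)
    finally show "(\<Sum>k\<le>N. v k k $$ i $$ j * tau k $$ (n - i) $$ (m - j)) =
      theta (series_fun h $$ i $$ j) (n - i) (m - j)" .
  qed
  also have "\<dots> = phi (series_fun h) $$ n $$ m"
    using phi_box[OF sf order.refl order.refl] by simp
  finally show "phi (series_fun h) $$ n $$ m = phiM v $$ n $$ m" ..
qed

subsection \<open>Termwise differentiation\<close>

text \<open>The termwise derivatives converge uniformly near \<open>x\<close> by the majorants
  \<open>B\<close>; their sum is identified with \<open>F'\<close> because \<open>F\<close> is
  already known to be differentiable.\<close>

lemma sums_vector_derivative:
  fixes f f' :: "nat \<Rightarrow> real \<Rightarrow> complex"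
  assumes d: "\<And>i t. (f i has_vector_derivative f' i t) (at t)"
    and B: "\<And>i t. \<bar>t - x\<bar> \<le> 1 \<Longrightarrow> cmod (f' i t) \<le> B i" "summable B"
    and s: "\<And>t. (\<lambda>i. f i t) sums F t"
    and F: "(F has_vector_derivative F') (at x)"
  shows "(\<lambda>i. f' i x) sums F'"
proof -
  let ?S = "{x - 1..x + 1}"
  define g' where "g' = (\<lambda>t. suminf (\<lambda>i. f' i t))"
  have unif: "uniform_limit ?S (\<lambda>n t. \<Sum>i<n. f' i t) g' sequentially"
    unfolding g'_def using B by (intro Weierstrass_m_test) (auto simp: abs_le_iff)
  have "\<exists>g. \<forall>t\<in>?S. (\<lambda>i. f i t) sums g t \<and> (g has_derivative (\<lambda>h. h *\<^sub>R g' t)) (at t within ?S)"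
  proof (rule has_derivative_series)
    show "(f i has_derivative (\<lambda>h. h *\<^sub>R f' i t)) (at t within ?S)" for i t
      using d has_vector_derivative_at_within unfolding has_vector_derivative_def by blast
    show "\<forall>\<^sub>F n in sequentially. \<forall>t\<in>?S. \<forall>h. cmod ((\<Sum>i<n. h *\<^sub>R f' i t) - h *\<^sub>R g' t) \<le> e * norm h" if "e > 0" for e
    proof -
      have "\<forall>\<^sub>F n in sequentially. \<forall>t\<in>?S. dist (\<Sum>i<n. f' i t) (g' t) < e"
        using unif that by (simp add: uniform_limit_iff)
      then show ?thesis
      proof eventually_elim
        case (elim n)
        show ?case
        proof (intro ballI allI)
          fix t and h :: real assume "t \<in> ?S"
          then have "cmod ((\<Sum>i<n. f' i t) - g' t) \<le> e" using elim by (auto simp: dist_norm less_imp_le)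
          then have "\<bar>h\<bar> * cmod ((\<Sum>i<n. f' i t) - g' t) \<le> \<bar>h\<bar> * e" by (intro mult_left_mono) auto
          then show "cmod ((\<Sum>i<n. h *\<^sub>R f' i t) - h *\<^sub>R g' t) \<le> e * norm h"
            by (simp add: scaleR_sum_right[symmetric] scaleR_diff_right[symmetric] mult.commute)
        qed
      qed
    qed
    show "x \<in> ?S" by simp
    show "(\<lambda>i. f i x) sums F x" by (rule s)
  qed simp
  then obtain g where g: "\<And>t. t \<in> ?S \<Longrightarrow> (\<lambda>i. f i t) sums g t"
    "(g has_derivative (\<lambda>h. h *\<^sub>R g' x)) (at x within ?S)" by force
  have eq: "F t = g t" if "t \<in> ?S" for t using g(1)[OF that] s sums_unique2 by blast
  have gv: "(g has_vector_derivative g' x) (at x within ?S)"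
    using g(2) by (simp only: has_vector_derivative_def)
  have "x \<in> ?S" by simp
  from has_vector_derivative_transform[OF this eq gv]
  have "(F has_vector_derivative g' x) (at x within ?S)" .
  then have "(F has_vector_derivative g' x) (at x)"
    by (simp add: at_within_Icc_at)
  then have "g' x = F'" using F vector_derivative_unique_at by blast
  moreover have "summable (\<lambda>i. f' i x)"
    using B(1)[of x] by (intro summable_comparison_test'[OF B(2)]) simp
  ultimately show ?thesis unfolding g'_def by (simp add: sums_iff)
qed

text \<open>Upgrades the pointwise sums that define boundaries to sums of all derivatives: a bounded
  sequence with summable coefficients supplies the majorants.\<close>

lemma sums_partial:
  fixes f :: "nat \<Rightarrow> plane_fun"
  assumes f: "\<And>i. smooth (f i)" and F: "smooth F" and c: "summable (\<lambda>i. cmod (c i))"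
    and bdd: "\<And>K j k. compact K \<Longrightarrow> \<exists>B. \<forall>i. \<forall>p\<in>K. cmod (partial j k (f i) p) \<le> B"
    and s: "\<And>p. (\<lambda>i. c i * f i p) sums F p"
  shows "(\<lambda>i. c i * partial j k (f i) p) sums partial j k F p"
proof -
  have y: "(\<lambda>i. c i * (pdy ^^ k) (f i) p) sums (pdy ^^ k) F p" for k p
  proof (induction k arbitrary: p)
    case (Suc k)
    obtain a b where p: "p = (a, b)" by (cases p)
    have "compact ({a} \<times> {b - 1..b + 1})" by (intro compact_Times) auto
    from bdd[OF this, of 0 "Suc k"] obtain B where
      "\<forall>i. \<forall>p\<in>{a} \<times> {b - 1..b + 1}. cmod (partial 0 (Suc k) (f i) p) \<le> B" by blast
    then have B: "cmod ((pdy ^^ Suc k) (f i) (a, t)) \<le> B" if "\<bar>t - b\<bar> \<le> 1" for i t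
      using that by (force simp: partial_def abs_le_iff)
    have "(\<lambda>i. c i * (pdy ^^ Suc k) (f i) (a, b)) sums (pdy ^^ Suc k) F (a, b)"
    proof (rule sums_vector_derivative[where B="\<lambda>i. cmod (c i) * B" and f="\<lambda>i t. c i * (pdy ^^ k) (f i) (a, t)"
          and f'="\<lambda>i t. c i * (pdy ^^ Suc k) (f i) (a, t)" and F="\<lambda>t. (pdy ^^ k) F (a, t)" and x=b])
      show "((\<lambda>t. c i * (pdy ^^ k) (f i) (a, t)) has_vector_derivative c i * (pdy ^^ Suc k) (f i) (a, t)) (at t)" for i t
        using pdy_deriv[OF smooth_funpow(2)[OF f]] by (intro has_vector_derivative_mult_right) simp
      show "cmod (c i * (pdy ^^ Suc k) (f i) (a, t)) \<le> cmod (c i) * B" if "\<bar>t - b\<bar> \<le> 1" for i t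
        using B[OF that] by (simp add: norm_mult mult_left_mono)
      show "summable (\<lambda>i. cmod (c i) * B)" by (rule summable_mult2[OF c])
      show "(\<lambda>i. c i * (pdy ^^ k) (f i) (a, t)) sums (pdy ^^ k) F (a, t)" for t by (rule Suc.IH)
      show "((\<lambda>t. (pdy ^^ k) F (a, t)) has_vector_derivative (pdy ^^ Suc k) F (a, b)) (at b)"
        using pdy_deriv[OF smooth_funpow(2)[OF F]] by simp
    qed
    then show ?case by (simp only: p)
  qed (simp add: s)
  show ?thesis
  proof (induction j arbitrary: p)
    case 0
    then show ?case using y by (simp add: partial_def)
  next
    case (Suc j)
    obtain a b where p: "p = (a, b)" by (cases p)
    have pS: "partial (Suc j) k g = pdx (partial j k g)" for g by (simp add: partial_def)
    have "compact ({a - 1..a + 1} \<times> {b})" by (intro compact_Times) auto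
    from bdd[OF this, of "Suc j" k] obtain B where
      "\<forall>i. \<forall>p\<in>{a - 1..a + 1} \<times> {b}. cmod (partial (Suc j) k (f i) p) \<le> B" by blast
    then have B: "cmod (partial (Suc j) k (f i) (t, b)) \<le> B" if "\<bar>t - a\<bar> \<le> 1" for i t
      using that by (force simp: abs_le_iff)
    have "(\<lambda>i. c i * partial (Suc j) k (f i) (a, b)) sums partial (Suc j) k F (a, b)"
    proof (rule sums_vector_derivative[where B="\<lambda>i. cmod (c i) * B" and f="\<lambda>i t. c i * partial j k (f i) (t, b)"
          and f'="\<lambda>i t. c i * partial (Suc j) k (f i) (t, b)" and F="\<lambda>t. partial j k F (t, b)" and x=a])
      show "((\<lambda>t. c i * partial j k (f i) (t, b)) has_vector_derivative c i * partial (Suc j) k (f i) (t, b)) (at t)" for i t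
        unfolding pS using pdx_deriv[OF smooth_partial[OF f]] by (intro has_vector_derivative_mult_right)
      show "cmod (c i * partial (Suc j) k (f i) (t, b)) \<le> cmod (c i) * B" if "\<bar>t - a\<bar> \<le> 1" for i t
        using B[OF that] by (simp add: norm_mult mult_left_mono)
      show "summable (\<lambda>i. cmod (c i) * B)" by (rule summable_mult2[OF c])
      show "(\<lambda>i. c i * partial j k (f i) (t, b)) sums partial j k F (t, b)" for t by (rule Suc.IH)
      show "((\<lambda>t. partial j k F (t, b)) has_vector_derivative partial (Suc j) k F (a, b)) (at a)"
        unfolding pS using pdx_deriv[OF smooth_partial[OF F]] .
    qed
    then show ?case by (simp only: p)
  qed
qed

subsection \<open>Bounded operators\<close>

lemma es_bounded_lincomb:
  assumes "es_bounded S" "es_bounded T" shows "es_bounded {f + es_const c * g | f g. f \<in> S \<and> g \<in> T}"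
  unfolding es_bounded_iff
proof (intro allI impI)
  fix K :: "(real \<times> real) set" and i j assume K: "compact K"
  obtain B where B: "\<forall>f\<in>S. \<forall>p\<in>K. cmod (partial i j (es_fun f) p) \<le> B"
    using assms(1) K unfolding es_bounded_iff by blast
  obtain B' where B': "\<forall>f\<in>T. \<forall>p\<in>K. cmod (partial i j (es_fun f) p) \<le> B'"
    using assms(2) K unfolding es_bounded_iff by blast
  have "cmod (partial i j (es_fun (f + es_const c * g)) p) \<le> B + cmod c * B'" if "f \<in> S" "g \<in> T" "p \<in> K" for f g p
    unfolding partial_es_add partial_es_cmult
    using B B' that by (intro norm_triangle_le add_mono) (auto simp: norm_mult intro!: mult_left_mono)
  then show "\<exists>B. \<forall>f\<in>{f + es_const c * g | f g. f \<in> S \<and> g \<in> T}. \<forall>p\<in>K. cmod (partial i j (es_fun f) p) \<le> B"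
    by blast
qed

lemma dunkl_bounded_lincomb:
  assumes S: "dunkl_bounded S" and T: "dunkl_bounded T"
  shows "dunkl_bounded {F + smult (const2 c) G | F G. F \<in> S \<and> G \<in> T}" (is "dunkl_bounded ?U")
proof -
  obtain N N' where N: "\<forall>F\<in>S. \<forall>n<N. F $$ n = 0" "\<forall>F\<in>T. \<forall>n<N'. F $$ n = 0"
    using S T unfolding dunkl_bounded_def by blast
  have "(F + smult (const2 c) G) $$ n = 0" if "F \<in> S" "G \<in> T" "n < min N N'" for F G n
    using N that by (intro fls_eqI) (simp add: smult_const2_nth)
  then have 1: "\<exists>N. \<forall>F\<in>?U. \<forall>n<N. F $$ n = 0" by blast
  have 2: "\<exists>M. \<forall>F\<in>?U. \<forall>m<M. F $$ n $$ m = 0" for n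
  proof -
    obtain M M' where "\<forall>F\<in>S. \<forall>m<M. F $$ n $$ m = 0" "\<forall>F\<in>T. \<forall>m<M'. F $$ n $$ m = 0"
      using S T unfolding dunkl_bounded_def by meson
    then have "(F + smult (const2 c) G) $$ n $$ m = 0" if "F \<in> S" "G \<in> T" "m < min M M'" for F G m
      using that by (simp add: smult_const2_nth)
    then show ?thesis by blast
  qed
  have 3: "es_bounded ((\<lambda>F. F $$ n $$ m) ` ?U)" for n m
  proof (rule es_bounded_mono[OF es_bounded_lincomb])
    show "es_bounded ((\<lambda>F. F $$ n $$ m) ` S)" "es_bounded ((\<lambda>F. F $$ n $$ m) ` T)"
      using S T unfolding dunkl_bounded_def by blast+
    show "(\<lambda>F. F $$ n $$ m) ` ?U \<subseteq> {f + es_const c * g | f g. f \<in> (\<lambda>F. F $$ n $$ m) ` S \<and> g \<in> (\<lambda>F. F $$ n $$ m) ` T}"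
      by (clarsimp simp: smult_const2_nth, blast)
  qed
  show ?thesis unfolding dunkl_bounded_def using 1 2 3 by blast
qed

lemma smult_minus_1: "F + smult (const2 (- 1)) G = F - G" and smult_1: "smult (const2 1) F = F"
proof -
  have "es_const (- 1) = - 1" by (rule es_eqI) (simp add: es_fun_simps)
  then show "F + smult (const2 (- 1)) G = F - G"
    by (intro fls2_eqI) (simp add: smult_const2_nth)
  show "smult (const2 1) F = F" by (intro fls2_eqI) (simp only: smult_const2_nth es_const_1 mult_1_left)
qed

lemma dunkl_bounded_diff: "dunkl_bounded S \<Longrightarrow> dunkl_bounded T \<Longrightarrow> dunkl_bounded {F - G | F G. F \<in> S \<and> G \<in> T}"
  using dunkl_bounded_lincomb[of S T "- 1"] unfolding smult_minus_1 .

lemma dunkl_bounded_add: "dunkl_bounded S \<Longrightarrow> dunkl_bounded T \<Longrightarrow> dunkl_bounded {F + G | F G. F \<in> S \<and> G \<in> T}"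
  using dunkl_bounded_lincomb[of S T 1] unfolding smult_1 .

lemma dunkl_bounded_shift:
  assumes "dunkl_bounded S" shows "dunkl_bounded (smult (hp a b) ` S)"
proof -
  have "\<exists>N. \<forall>F\<in>smult (hp a b) ` S. \<forall>n<N. F $$ n = 0"
  proof -
    obtain N where "\<forall>F\<in>S. \<forall>n<N. F $$ n = 0" using assms unfolding dunkl_bounded_def by blast
    then have "smult (hp a b) F $$ n = 0" if "F \<in> S" "n < N + a" for F n
      using that by (intro fls_eqI) (simp add: smult_hp_nth)
    then show ?thesis by blast
  qed
  moreover have "\<exists>M. \<forall>F\<in>smult (hp a b) ` S. \<forall>m<M. F $$ n $$ m = 0" for n
  proof -
    obtain M where "\<forall>F\<in>S. \<forall>m<M. F $$ (n - a) $$ m = 0" using assms unfolding dunkl_bounded_def by blast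
    then have "smult (hp a b) F $$ n $$ m = 0" if "F \<in> S" "m < M + b" for F m
      using that by (simp add: smult_hp_nth)
    then show ?thesis by blast
  qed
  moreover have "es_bounded ((\<lambda>F. F $$ n $$ m) ` smult (hp a b) ` S)" for n m
    using assms unfolding dunkl_bounded_def by (simp add: image_image smult_hp_nth)
  ultimately show ?thesis unfolding dunkl_bounded_def by blast
qed

lemma dunkl_bounded_map2:
  assumes S: "dunkl_bounded S" and q: "q 0 = 0" "\<And>S. es_bounded S \<Longrightarrow> es_bounded (q ` S)"
  shows "dunkl_bounded (map2 q ` S)"
proof -
  have "\<exists>N. \<forall>F\<in>map2 q ` S. \<forall>n<N. F $$ n = 0"
  proof -
    obtain N where "\<forall>F\<in>S. \<forall>n<N. F $$ n = 0" using S unfolding dunkl_bounded_def by blast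
    then have "map2 q F $$ n = 0" if "F \<in> S" "n < N" for F n
      using that by (intro fls_eqI) (simp add: map2_nth[of q] q)
    then show ?thesis by blast
  qed
  moreover have "\<exists>M. \<forall>F\<in>map2 q ` S. \<forall>m<M. F $$ n $$ m = 0" for n
  proof -
    obtain M where "\<forall>F\<in>S. \<forall>m<M. F $$ n $$ m = 0" using S unfolding dunkl_bounded_def by blast
    then have "map2 q F $$ n $$ m = 0" if "F \<in> S" "m < M" for F m
      using that by (simp add: map2_nth[of q] q)
    then show ?thesis by blast
  qed
  moreover have "es_bounded ((\<lambda>F. F $$ n $$ m) ` map2 q ` S)" for n m
  proof -
    have "es_bounded (q ` (\<lambda>F. F $$ n $$ m) ` S)"
      using S q(2) unfolding dunkl_bounded_def by blast
    then show ?thesis by (simp add: image_image map2_nth[of q] q)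
  qed
  ultimately show ?thesis unfolding dunkl_bounded_def by blast
qed

lemma bounded_es_eval:
  assumes "es_bounded S" shows "bounded ((\<lambda>f. partial i j (es_fun f) p) ` S)"
proof -
  obtain B where "\<forall>f\<in>S. \<forall>p\<in>{p}. cmod (partial i j (es_fun f) p) \<le> B"
    using assms compact_sing[of p] unfolding es_bounded_iff by meson
  then show ?thesis unfolding bounded_iff by auto
qed

lemma kbounded_eval:
  assumes S: "dunkl_bounded S" shows "kbounded (map2 (\<lambda>f. es_fun f p) ` S)"
proof -
  have z: "es_fun 0 p = 0" by (simp add: es_fun_simps)
  have "\<exists>N. \<forall>F\<in>map2 (\<lambda>f. es_fun f p) ` S. \<forall>n<N. F $$ n = 0"
  proof -
    obtain N where "\<forall>F\<in>S. \<forall>n<N. F $$ n = 0" using S unfolding dunkl_bounded_def by blast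
    then have "map2 (\<lambda>f. es_fun f p) F $$ n = 0" if "F \<in> S" "n < N" for F n
      using that by (intro fls_eqI) (simp add: map2_nth z)
    then show ?thesis by blast
  qed
  moreover have "\<exists>M. \<forall>F\<in>map2 (\<lambda>f. es_fun f p) ` S. \<forall>m<M. F $$ n $$ m = 0" for n
  proof -
    obtain M where "\<forall>F\<in>S. \<forall>m<M. F $$ n $$ m = 0" using S unfolding dunkl_bounded_def by blast
    then have "map2 (\<lambda>f. es_fun f p) F $$ n $$ m = 0" if "F \<in> S" "m < M" for F m
      using that by (simp add: map2_nth z)
    then show ?thesis by blast
  qed
  moreover have "bounded ((\<lambda>F. F $$ n $$ m) ` map2 (\<lambda>f. es_fun f p) ` S)" for n m
  proof -
    have "es_bounded ((\<lambda>F. F $$ n $$ m) ` S)" using S unfolding dunkl_bounded_def by blast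
    from bounded_es_eval[OF this, of 0 0 p] show ?thesis by (simp add: image_image map2_nth z)
  qed
  ultimately show ?thesis unfolding kbounded_def by blast
qed

text \<open>The commutators with \<open>x\<^sup>2\<close> and with \<open>y\<^sup>2\<close> have only three nonzero homogeneous components.\<close>

locale dunkl_operator =
  fixes T :: "dunkl \<Rightarrow> dunkl"
  assumes T_add: "T (F + G) = T F + T G" and T_smult: "T (smult c F) = smult c (T F)"
    and T_bounded: "dunkl_bounded S \<Longrightarrow> dunkl_bounded (T ` S)"
    and T_poly: "even_poly p \<Longrightarrow> (n, m) \<notin> {(0, 1), (0, 2), (1, 2)} \<Longrightarrow> T (const2 (es_poly p)) $$ n $$ m = 0"
begin

definition Q :: "int \<Rightarrow> int \<Rightarrow> even_smooth \<Rightarrow> even_smooth" where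
  "Q n m f = T (const2 f) $$ n $$ m"

lemma Q_add: "Q n m (f + g) = Q n m f + Q n m g"
  by (simp add: Q_def const2_add T_add)

lemma Q_cmult: "Q n m (es_const c * f) = es_const c * Q n m f"
proof -
  have "const2 (es_const c * f) = smult (const2 c) (const2 f)"
    by (rule fls2_eqI) (simp add: smult_const2_nth const2_nth)
  then show ?thesis by (simp add: Q_def T_smult smult_const2_nth)
qed

lemma Q_0 [simp]: "Q n m 0 = 0"
  using Q_add[of n m 0 0] by simp

lemma Q_bounded: "es_bounded S \<Longrightarrow> es_bounded (Q n m ` S)"
  using T_bounded[OF es_bounded_const2[of S]] unfolding dunkl_bounded_def
  by (simp add: image_image Q_def)

text \<open>Evaluating a component at a point is a bounded functional, hence determined by its
  values on even polynomials.\<close>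

lemma Q_eqI:
  assumes D: "\<And>f g. D (f + g) = D f + D g" "\<And>c f. D (es_const c * f) = c * D f"
    "\<And>S. es_bounded S \<Longrightarrow> bounded (D ` S)"
    and poly: "\<And>p. even_poly p \<Longrightarrow> es_fun (Q n m (es_poly p)) z = D (es_poly p)"
  shows "es_fun (Q n m f) z = D f"
proof -
  have "es_fun (Q n m f) z - D f = 0"
  proof (rule bounded_functional_eq_0[of "\<lambda>f. es_fun (Q n m f) z - D f"])
    fix S assume S: "es_bounded S"
    have "bounded ((\<lambda>f. es_fun (Q n m f) z) ` S)"
      using bounded_es_eval[OF Q_bounded[OF S], of 0 0 z] by (simp add: image_image)
    then show "bounded ((\<lambda>f. es_fun (Q n m f) z - D f) ` S)"
      using D(3)[OF S] by (rule bounded_minus_comp)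
  qed (unfold Q_add Q_cmult D, simp_all add: es_fun_simps poly algebra_simps)
  then show ?thesis by simp
qed

lemma Q_eq_0: "(n, m) \<notin> {(0, 1), (0, 2), (1, 2)} \<Longrightarrow> Q n m f = 0"
proof (rule es_eqI)
  fix z assume "(n, m) \<notin> {(0, 1), (0, 2), (1, 2)}"
  then have "es_fun (Q n m (es_poly p)) z = 0" if "even_poly p" for p
    using T_poly[OF that] by (simp add: Q_def es_fun_simps)
  note poly = this
  have "es_fun (Q n m f) z = (\<lambda>_. 0) f"
    by (rule Q_eqI) (simp_all add: poly image_constant_conv)
  then show "es_fun (Q n m f) z = es_fun 0 z" by (simp add: es_fun_simps)
qed

text \<open>Compatibility of \<open>T\<close> with infinite series has to be derived. The operator
  \<open>D\<close> built from the three components is bounded as well and agrees with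
  \<open>T\<close> on functions free of the parameters, so \<open>functional_eq_0\<close> applies to
  the value of \<open>T F - D F\<close> at a point.\<close>

lemma T_nth: "T F $$ n $$ m = Q 0 1 (F $$ n $$ (m - 1)) + Q 0 2 (F $$ n $$ (m - 2)) + Q 1 2 (F $$ (n - 1) $$ (m - 2))"
proof (rule es_eqI)
  fix z
  define D where "D = (\<lambda>F. smult (hp 0 1) (map2 (Q 0 1) F) + smult (hp 0 2) (map2 (Q 0 2) F) + smult (hp 1 2) (map2 (Q 1 2) F))"
  have D_nth: "D F $$ n $$ m = Q 0 1 (F $$ n $$ (m - 1)) + Q 0 2 (F $$ n $$ (m - 2)) + Q 1 2 (F $$ (n - 1) $$ (m - 2))" for F n m
    by (simp add: D_def smult_hp_nth map2_nth[of "Q _ _"])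
  have Q_map: "map2 (Q a b) (smult c F) = smult c (map2 (Q a b) F)" for a b c F
    unfolding smult_def by (rule map2_times) (simp_all add: Q_add Q_cmult)
  have D_smult: "D (smult c F) = smult c (D F)" for c F
    by (simp add: D_def Q_map smult_smult smult_add mult.commute)
  have D_add: "D (F + G) = D F + D G" for F G
    by (rule fls2_eqI) (simp add: D_nth Q_add)
  have D_bounded: "dunkl_bounded (D ` S)" if "dunkl_bounded S" for S
  proof -
    have q: "dunkl_bounded (smult (hp a b) ` map2 (Q c d) ` S)" for a b c d
      using that by (intro dunkl_bounded_shift dunkl_bounded_map2 Q_0 Q_bounded)
    from dunkl_bounded_add[OF dunkl_bounded_add[OF q[of 0 1 0 1] q[of 0 2 0 2]] q[of 1 2 1 2]]
    show ?thesis by (rule dunkl_bounded_mono) (clarsimp simp: D_def, blast)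
  qed
  define L where "L = (\<lambda>F. map2 (\<lambda>f. es_fun f z) (T F - D F))"
  have "L F = 0"
  proof (rule functional_eq_0)
    show "L (F + G) = L F + L G" for F G
      unfolding L_def by (subst map2_add[symmetric]) (simp_all add: es_fun_simps T_add D_add add_diff_add)
    show "L (smult c F) = c * L F" for c F
    proof -
      have "map2 (\<lambda>f. es_fun f z) (smult c H) = map2 (\<lambda>c. c) c * map2 (\<lambda>f. es_fun f z) H" for H
        unfolding smult_def by (rule map2_times) (simp_all add: es_fun_simps)
      moreover have "map2 (\<lambda>c. c) c = c" by (rule map2_eq) simp_all
      ultimately show ?thesis by (simp add: L_def T_smult D_smult smult_diff[symmetric])
    qed
    show "kbounded (L ` S)" if "dunkl_bounded S" for S
    proof -
      have "dunkl_bounded ((\<lambda>F. T F - D F) ` S)"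
        using dunkl_bounded_diff[OF T_bounded[OF that] D_bounded[OF that]] by (rule dunkl_bounded_mono) auto
      from kbounded_eval[OF this] show ?thesis by (simp add: L_def image_image)
    qed
    fix p assume "even_poly p"
    have "T (const2 f) $$ n $$ m = D (const2 f) $$ n $$ m" for f n m
    proof (cases "(n, m) \<in> {(0, 1), (0, 2), (1, 2)}")
      case True
      then show ?thesis by (auto simp: D_nth const2_nth) (simp_all add: Q_def)
    next
      case False
      then have "D (const2 f) $$ n $$ m = 0" by (auto simp: D_nth const2_nth)
      then show ?thesis using Q_eq_0[OF False] by (simp add: Q_def)
    qed
    then have "T (const2 f) = D (const2 f)" for f by (intro fls2_eqI)
    then show "L (const2 (es_poly p)) = 0"
      by (simp add: L_def) (rule map2_eq, simp_all add: es_fun_simps)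
  qed
  moreover have "L F $$ n $$ m = es_fun (T F $$ n $$ m) z - es_fun (D F $$ n $$ m) z"
    unfolding L_def by (subst map2_nth) (simp_all add: es_fun_simps)
  ultimately show "es_fun (T F $$ n $$ m) z =
      es_fun (Q 0 1 (F $$ n $$ (m - 1)) + Q 0 2 (F $$ n $$ (m - 2)) + Q 1 2 (F $$ (n - 1) $$ (m - 2))) z"
    by (simp add: D_nth)
qed

end

subsection \<open>Solving for a decomposition into commutators\<close>

text \<open>The equation is iterated from 0. Its right side refers to exponents of
  \<open>hbar1\<close> lower by one, so the k-th iterate is final below
  \<open>L n + k\<close>.\<close>

lemma coefficient_recursion:
  fixes F :: dunkl
  assumes W: "W0 0 = 0" "W1 0 = 0"
  obtains E :: dunkl where
    "\<And>n m. E $$ n $$ m = F $$ n $$ m - W0 (E $$ n $$ (m - 1)) - W1 (E $$ (n - 1) $$ (m - 1))"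
proof -
  define N where "N = fls_subdegree F"
  \<comment> \<open>Row n depends on row n - 1, so its lower bound takes all earlier rows into
    account and can only decrease with n.\<close>
  define L where "L = (\<lambda>n. Min (insert 0 ((\<lambda>i. fls_subdegree (F $$ i)) ` {N..n})))"
  have L_mono: "L n \<le> L (n - 1)" for n
    unfolding L_def by (intro Min_antimono insert_mono image_mono) auto
  have F_0: "F $$ n $$ m = 0" if "m < L n" for n m
  proof (cases "n < N")
    case False
    then have "L n \<le> fls_subdegree (F $$ n)" unfolding L_def by (intro Min_le) auto
    then show ?thesis using that by auto
  qed (simp add: N_def)
  define step where "step = (\<lambda>(e :: int \<Rightarrow> int \<Rightarrow> even_smooth) n m. if m < L n then 0 else
    F $$ n $$ m - W0 (e n (m - 1)) - W1 (e (n - 1) (m - 1)))"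
  define E where "E = (\<lambda>k. (step ^^ k) (\<lambda>n m. 0))"
  have E_Suc: "E (Suc k) n m = (if m < L n then 0 else F $$ n $$ m - W0 (E k n (m - 1)) - W1 (E k (n - 1) (m - 1)))" for k n m
    by (simp add: E_def step_def)
  have E_0: "E 0 n m = 0" for n m by (simp add: E_def)
  have stable: "E (Suc k) n m = E k n m" if "m < L n + int k" for k n m
    using that
  proof (induction k arbitrary: n m)
    case 0
    then show ?case by (simp add: E_Suc E_0)
  next
    case (Suc k)
    have "E (Suc k) n (m - 1) = E k n (m - 1)" "E (Suc k) (n - 1) (m - 1) = E k (n - 1) (m - 1)"
      using Suc.prems L_mono[of n] by (auto intro!: Suc.IH)
    then show ?case by (simp only: E_Suc[of "Suc k"] E_Suc[of k])
  qed
  have stable': "E k' n m = E k n m" if "m < L n + int k" "k \<le> k'" for k k' n m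
    using that(2,1) by (induction k' rule: dec_induct) (simp_all add: stable)
  \<comment> \<open>The first iterate that is final at exponent \<open>m\<close>.\<close>
  define e where "e = (\<lambda>n m. E (nat (m - L n + 1)) n m)"
  have e: "E k n m = e n m" if "m < L n + int k" for k n m
    unfolding e_def by (rule stable') (use that in linarith)+
  have e_neg: "e n m = 0" if "m < L n" for n m
    using e[of m n 0] that by (simp add: E_0)
  have e_eq: "e n m = F $$ n $$ m - W0 (e n (m - 1)) - W1 (e (n - 1) (m - 1))" for n m
  proof (cases "m < L n")
    case True
    then show ?thesis using L_mono[of n] by (simp add: e_neg F_0 W)
  next
    case False
    define k where "k = nat (m - L n + 1)"
    have k: "m < L n + int (Suc k)" "m - 1 < L n + int k" "m - 1 < L (n - 1) + int k"
      using False L_mono[of n] unfolding k_def by linarith+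
    show ?thesis using E_Suc[of k n m] False unfolding e[OF k(1)] e[OF k(2)] e[OF k(3)] by simp
  qed
  have "E k n m = 0" if "n < N" for k n m
    using that by (induction k arbitrary: n m) (auto simp: E_0 E_Suc W N_def)
  then have e_N: "e n m = 0" if "n < N" for n m using that by (simp add: e_def)
  have nth: "fls2_of e $$ n $$ m = e n m" for n m
    by (rule fls2_of_nth[OF e_N]) (use e_neg in blast)+
  show ?thesis by (rule that[of "fls2_of e"]) (unfold nth, rule e_eq)
qed

text \<open>\<open>E\<close> is \<open>F\<close> corrected by the higher order terms of
  \<open>T1\<close> and \<open>T2\<close>. Its coefficients are split by \<open>had\<close>, and the
  preimages are divided by \<open>hbar1\<close>, the order of the leading terms.\<close>

lemma commutator_decomposition:
  assumes "dunkl_operator T1" "dunkl_operator T2"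
    and had: "\<And>f. \<exists>g1 g2. f = es_const (es_fun f 0) + dunkl_operator.Q T1 0 1 g1 + dunkl_operator.Q T2 0 1 g2"
  shows "\<exists>c A B. F = smult c 1 + T1 A + T2 B"
proof -
  interpret T1: dunkl_operator T1 by fact
  interpret T2: dunkl_operator T2 by fact
  \<comment> \<open>The zero function must get zero preimages, so that a coefficientwise choice
    yields Laurent series again.\<close>
  have "\<exists>g1 g2. f = es_const (es_fun f 0) + T1.Q 0 1 g1 + T2.Q 0 1 g2 \<and> (f = 0 \<longrightarrow> g1 = 0 \<and> g2 = 0)" for f
  proof (cases "f = 0")
    case True
    show ?thesis unfolding True by (intro exI[of _ 0]) (simp add: es_fun_simps)
  qed (use had[of f] in blast)
  then have "\<forall>f. \<exists>g1 g2. f = es_const (es_fun f 0) + T1.Q 0 1 g1 + T2.Q 0 1 g2 \<and> (f = 0 \<longrightarrow> g1 = 0 \<and> g2 = 0)"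
    by blast
  then obtain H1 H2 where H: "\<And>f. f = es_const (es_fun f 0) + T1.Q 0 1 (H1 f) + T2.Q 0 1 (H2 f)"
    and H0: "H1 0 = 0" "H2 0 = 0"
    unfolding choice_iff by blast
  define W0 where "W0 = (\<lambda>f. T1.Q 0 2 (H1 f) + T2.Q 0 2 (H2 f))"
  define W1 where "W1 = (\<lambda>f. T1.Q 1 2 (H1 f) + T2.Q 1 2 (H2 f))"
  obtain E where E: "\<And>n m. E $$ n $$ m = F $$ n $$ m - W0 (E $$ n $$ (m - 1)) - W1 (E $$ (n - 1) $$ (m - 1))"
    using coefficient_recursion[of W0 W1 F] by (auto simp: W0_def W1_def H0)
  define c where "c = map2 (\<lambda>f. es_fun f 0) E"
  define A where "A = smult (hp 0 (- 1)) (map2 (\<lambda>f. H1 f) E)"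
  define B where "B = smult (hp 0 (- 1)) (map2 (\<lambda>f. H2 f) E)"
  have A: "A $$ n $$ m = H1 (E $$ n $$ (m + 1))" and B: "B $$ n $$ m = H2 (E $$ n $$ (m + 1))" for n m
    unfolding A_def B_def smult_hp_nth by (simp_all add: map2_nth H0)
  have c: "smult c 1 $$ n $$ m = es_const (es_fun (E $$ n $$ m) 0)" for n m
    by (simp add: smult_def map2_nth c_def es_fun_simps)
  have "F = smult c 1 + T1 A + T2 B"
  proof (rule fls2_eqI)
    fix n m :: int
    have m: "m - 2 + 1 = m - 1" "m - 1 + 1 = m" by simp_all
    have "(smult c 1 + T1 A + T2 B) $$ n $$ m = E $$ n $$ m + W0 (E $$ n $$ (m - 1)) + W1 (E $$ (n - 1) $$ (m - 1))"
      using H[of "E $$ n $$ m"] by (simp only: fls_plus_nth c T1.T_nth T2.T_nth A B m W0_def W1_def) (simp add: algebra_simps)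
    then show "F $$ n $$ m = (smult c 1 + T1 A + T2 B) $$ n $$ m"
      using E[of n m] by simp
  qed
  then show ?thesis by blast
qed

subsection \<open>The commutators with \<open>x\<^sup>2\<close> and \<open>y\<^sup>2\<close>\<close>

lemma eval2_diff: "eval2 (p - q) u v = eval2 p u v - eval2 q u v"
  using eval2_add[of "p - q" q u v] by simp

lemma even_poly_diff:
  assumes "even_poly p" "even_poly q" shows "even_poly (p - q)"
  unfolding even_poly_def
proof
  fix k assume "k \<in> Poly_Mapping.keys (p - q)"
  then have "k \<in> Poly_Mapping.keys p \<or> k \<in> Poly_Mapping.keys q"
    by (auto simp: in_keys_iff lookup_minus)
  then show "even (fst k + snd k)" using assms unfolding even_poly_def by blast
qed

lemma es_poly_diff:
  assumes "even_poly p" "even_poly q" shows "es_poly p - es_poly q = es_poly (p - q)"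
proof (rule es_eqI)
  fix z
  show "es_fun (es_poly p - es_poly q) z = es_fun (es_poly (p - q)) z"
    using assms even_poly_diff[OF assms]
    by (cases z) (simp add: es_fun_simps es_fun_es_poly poly_xy_def eval2_diff)
qed

lemma eval2_times_fst:
  assumes "\<And>a b. lookup q (a, b) = (case a of 0 \<Rightarrow> 0 | Suc a \<Rightarrow> lookup r (a, b))"
  shows "eval2 q u v = u * eval2 r u v"
proof -
  have "q = (\<Sum>k\<in>Poly_Mapping.keys r. Poly_Mapping.single (Suc (fst k), snd k) (lookup r k))"
  proof (rule poly2_eqI)
    fix a b
    show "lookup q (a, b) = lookup (\<Sum>k\<in>Poly_Mapping.keys r. Poly_Mapping.single (Suc (fst k), snd k) (lookup r k)) (a, b)"
    proof (cases a)
      case (Suc a')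
      have "(\<Sum>k\<in>Poly_Mapping.keys r. lookup (Poly_Mapping.single (Suc (fst k), snd k) (lookup r k)) (a, b)) =
          (\<Sum>k\<in>Poly_Mapping.keys r. if k = (a', b) then lookup r (a', b) else 0)"
        by (intro sum.cong) (auto simp: Suc lookup_single when_def)
      then show ?thesis by (simp add: assms Suc lookup_sum in_keys_iff)
    qed (simp add: assms lookup_sum lookup_single)
  qed
  also have "eval2 \<dots> u v = u * eval2 r u v"
    by (simp add: eval2_sum eval2_single) (simp add: eval2_def sum_distrib_left ac_simps)
  finally show ?thesis .
qed

lemma eval2_times_snd:
  assumes "\<And>a b. lookup q (a, b) = (case b of 0 \<Rightarrow> 0 | Suc b \<Rightarrow> lookup r (a, b))"
  shows "eval2 q u v = v * eval2 r u v"
proof -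
  have "q = (\<Sum>k\<in>Poly_Mapping.keys r. Poly_Mapping.single (fst k, Suc (snd k)) (lookup r k))"
  proof (rule poly2_eqI)
    fix a b
    show "lookup q (a, b) = lookup (\<Sum>k\<in>Poly_Mapping.keys r. Poly_Mapping.single (fst k, Suc (snd k)) (lookup r k)) (a, b)"
    proof (cases b)
      case (Suc b')
      have "(\<Sum>k\<in>Poly_Mapping.keys r. lookup (Poly_Mapping.single (fst k, Suc (snd k)) (lookup r k)) (a, b)) =
          (\<Sum>k\<in>Poly_Mapping.keys r. if k = (a, b') then lookup r (a, b') else 0)"
        by (intro sum.cong) (auto simp: Suc lookup_single when_def)
      then show ?thesis by (simp add: assms Suc lookup_sum in_keys_iff)
    qed (simp add: assms lookup_sum lookup_single)
  qed
  also have "eval2 \<dots> u v = v * eval2 r u v"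
    by (simp add: eval2_sum eval2_single) (simp add: eval2_def sum_distrib_left ac_simps)
  finally show ?thesis .
qed

definition sqX :: poly2 where "sqX = Poly_Mapping.single (2, 0) 1"
definition sqY :: poly2 where "sqY = Poly_Mapping.single (0, 2) 1"

lemma even_sq: "even_poly sqX" "even_poly sqY"
  by (simp_all add: even_poly_def sqX_def sqY_def)

lemma ordered_sq: "ordered gX gY sqX = gX * gX" "ordered gX gY sqY = gY * gY"
  by (simp_all add: ordered_def sqX_def sqY_def power2_eq_square)

text \<open>The shape of a coefficient of a commutator with a square: multiples of
  \<open>hbar1\<close>, \<open>hbar1^2\<close> and \<open>hbar1^2 hbar2\<close>, the first one being
  \<open>X\<close>.\<close>

definition components :: "complex \<Rightarrow> coeffs \<Rightarrow> bool" where
  "components X c \<longleftrightarrow> (\<forall>n m. (n, m) \<notin> {(0, 1), (0, 2), (1, 2)} \<longrightarrow> c $$ n $$ m = 0) \<and> c $$ 0 $$ 1 = X"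

lemma componentsI: "components X (hbar1 * const2 X + hbar1 * (hh * (const2 y + h2 * const2 w)))"
  unfolding components_def
  by (simp only: fls_plus_nth hbar_mult_nth(1) hh_mult_nth h2_mult_nth const2_nth) auto

lemma sign_const2: "(- 1) ^ b = const2 ((- 1) ^ b :: complex)"
  by (cases "even b") (simp_all add: const2_uminus)

lemma const2_half: "const2 c / 2 = const2 (c / 2)" for c :: complex
  by (simp add: nonzero_divide_eq_eq const2_numeral[symmetric] const2_mult[symmetric])

lemma dd_form: "\<exists>y w. dd b = const2 y + h2 * const2 w"
proof -
  have "dd b = const2 (of_nat (b * (b - 1)) / 2) + h2 * const2 (2 * (- 1) ^ b * of_nat (b div 2))"
    unfolding dd_def const2_half[symmetric] const2_of_nat[symmetric] const2_mult const2_numeral sign_const2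
    by (simp add: ac_simps)
  then show ?thesis by blast
qed

text \<open>One of a + 1 and a + 2 is even, hence no square of \<open>h2\<close> occurs.\<close>

lemma cc_cc_form: "\<exists>y w. cc (Suc a) b * cc (Suc (Suc a)) b = const2 y + h2 * const2 w"
proof -
  have c: "cc a b = const2 (of_nat a) + h2 * const2 (if odd a then 2 * (- 1) ^ b else 0)" for a
    unfolding cc_def const2_of_nat
    by (simp add: const2_mult const2_numeral sign_const2[symmetric])
  have "cc (Suc a) b * cc (Suc (Suc a)) b = const2 (of_nat (Suc a) * of_nat (Suc (Suc a))) +
    h2 * const2 (of_nat (Suc a) * (if even a then 0 else 2 * (- 1) ^ b) + of_nat (Suc (Suc a)) * (if even a then 2 * (- 1) ^ b else 0))"
    unfolding c by (cases "even a") (simp_all add: const2_mult const2_add algebra_simps del: of_nat_Suc)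
  then show ?thesis by blast
qed

text \<open>The leading coefficients are those of x d/dy applied to \<open>p\<close>; for y^2 below
  they are those of y d/dx.\<close>

lemma RX_components:
  "components (of_nat (Suc b) * (case a of 0 \<Rightarrow> 0 | Suc a \<Rightarrow> lookup p (a, Suc b)))
    (RX (nf (ordered gX gY p)) a b - XO (XO (nf (ordered gX gY p))) a b)"
proof -
  obtain y w where d: "dd (Suc (Suc b)) = const2 y + h2 * const2 w" using dd_form by blast
  let ?l = "lookup p (a, Suc (Suc b))"
  have "RX (nf (ordered gX gY p)) a b - XO (XO (nf (ordered gX gY p))) a b =
    hbar1 * const2 (of_nat (Suc b) * (case a of 0 \<Rightarrow> 0 | Suc a \<Rightarrow> lookup p (a, Suc b))) +
    hbar1 * (hh * (const2 (y * ?l) + h2 * const2 (w * ?l)))"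
    unfolding RX_def nf_ordered_xy d const2_mult const2_of_nat two_hh
    by (cases a) (simp_all add: algebra_simps)
  then show ?thesis using componentsI by simp
qed

lemma YO_components:
  "components (of_nat (Suc a) * (case b of 0 \<Rightarrow> 0 | Suc b \<Rightarrow> lookup p (Suc a, b)))
    (YO (YO (nf (ordered gX gY p))) a b - RY (nf (ordered gX gY p)) a b)"
proof -
  obtain y w where d: "cc (Suc a) b * cc (Suc (Suc a)) b = const2 y + h2 * const2 w" using cc_cc_form by blast
  let ?l = "lookup p (Suc (Suc a), b)"
  have h: "hh = hbar1 * const2 (1/2)" by (simp add: hh_def mult.commute)
  have "YO (YO (nf (ordered gX gY p))) a b - RY (nf (ordered gX gY p)) a b =
    hbar1 * const2 (of_nat (Suc a) * (case b of 0 \<Rightarrow> 0 | Suc b \<Rightarrow> lookup p (Suc a, b))) +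
    hh * (hh * (const2 (y * ?l) + h2 * const2 (w * ?l)))"
    unfolding YO_YO nf_ordered_xy d const2_mult const2_of_nat two_hh
    by (cases b) (simp_all add: algebra_simps)
  also have "hh * (hh * (const2 (y * ?l) + h2 * const2 (w * ?l))) =
      hbar1 * (hh * (const2 (1/2 * (y * ?l)) + h2 * const2 (1/2 * (w * ?l))))"
    by (subst (1) h, simp only: const2_mult[of "1/2"], simp add: algebra_simps)
  finally show ?thesis using componentsI by simp
qed

subsection \<open>Even solutions of the transport equations\<close>

text \<open>The y-derivative of the candidate is the integral over [0, 1] of the t-derivative of t
  A(x, t y).\<close>

lemma antiderivative_y:
  assumes A: "smooth A"
  defines "G \<equiv> (\<lambda>z. (case z of (x, y) \<Rightarrow> of_real y) * param_int (\<lambda>t. 1) (\<lambda>t. 1) (\<lambda>t. t) A z)"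
  shows "smooth G" "pdy G = A"
proof -
  have c: "continuous_on UNIV (\<lambda>t::real. 1::real)" "continuous_on UNIV (\<lambda>t::real. t)" "continuous_on UNIV (\<lambda>t::real. 1::complex)"
    by (auto intro!: continuous_intros)
  show "smooth G" unfolding G_def by (intro smooth_mult smooth_coords smooth_param_int c A)
  show "pdy G = A"
  proof (rule pdy_eqI)
    fix x y
    let ?B = "param_int (\<lambda>t. 1) (\<lambda>t. 1) (\<lambda>t. t) A" and ?B' = "param_int (\<lambda>t. 1 * of_real t) (\<lambda>t. 1) (\<lambda>t. t) (pdy A)"
    have dB: "((\<lambda>t. ?B (x, t)) has_vector_derivative ?B' (x, y)) (at y)"
      by (intro param_int_deriv(2)[OF c(1,2,3)] smooth_differentiable smooth_continuous smooth_pdx smooth_pdy A)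
    have dy: "(complex_of_real has_vector_derivative 1) (at y)" by (auto intro!: derivative_eq_intros)
    have "((\<lambda>t. of_real t * ?B (x, t)) has_vector_derivative of_real y * ?B' (x, y) + 1 * ?B (x, y)) (at y)"
      by (rule has_vector_derivative_mult[OF dy dB])
    moreover have "of_real y * ?B' (x, y) + 1 * ?B (x, y) = A (x, y)"
    proof -
      have cA: "continuous_on {0..1} (\<lambda>t. g (x, t * y))" if "smooth g" for g
        by (rule continuous_on_section[OF smooth_continuous[OF that]]) (intro continuous_intros)+
      have d: "((\<lambda>t. of_real t * A (x, t * y)) has_vector_derivative of_real t * (y *\<^sub>R pdy A (x, t * y)) + 1 * A (x, t * y)) (at t)" for t
      proof (rule has_vector_derivative_mult)
        show "((\<lambda>t. A (x, t * y)) has_vector_derivative y *\<^sub>R pdy A (x, t * y)) (at t)"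
          using has_vector_derivative_scaled_arg[of "\<lambda>t. A (x, t)" "pdy A (x, y * t)" y t] pdy_deriv[OF A, of x "y * t"]
          by (simp add: mult.commute)
      qed (auto intro!: derivative_eq_intros)
      have "((\<lambda>t. of_real t * (y *\<^sub>R pdy A (x, t * y)) + 1 * A (x, t * y)) has_integral
          of_real 1 * A (x, 1 * y) - of_real 0 * A (x, 0 * y)) {0..1}"
        by (rule fundamental_theorem_of_calculus[of 0 1 "\<lambda>t. of_real t * A (x, t * y)"])
          (simp_all only: has_vector_derivative_at_within[OF d] zero_le_one)
      then have "integral {0..1} (\<lambda>t. of_real t * (y *\<^sub>R pdy A (x, t * y)) + 1 * A (x, t * y)) = A (x, y)"
        by (simp add: integral_unique)
      moreover have "integral {0..1} (\<lambda>t. of_real t * (y *\<^sub>R pdy A (x, t * y)) + 1 * A (x, t * y)) =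
          integral {0..1} (\<lambda>t. of_real t * (y *\<^sub>R pdy A (x, t * y))) + integral {0..1} (\<lambda>t. 1 * A (x, t * y))"
        by (rule Henstock_Kurzweil_Integration.integral_add)
          (auto intro!: integrable_continuous_interval continuous_intros cA smooth_pdy A)
      moreover have "integral {0..1} (\<lambda>t. of_real t * (y *\<^sub>R pdy A (x, t * y))) =
          of_real y * integral {0..1} (\<lambda>t. of_real t * pdy A (x, t * y))"
        unfolding integral_mult_right[symmetric] by (simp add: scaleR_conv_of_real ac_simps)
      ultimately show ?thesis by (simp add: param_int_def)
    qed
    ultimately show "((\<lambda>t. G (x, t)) has_vector_derivative A (x, y)) (at y)"
      unfolding G_def by simp
  qed
qed

lemma param_int_minus: "param_int \<phi> \<alpha> \<beta> f (- z) = param_int \<phi> \<alpha> \<beta> (\<lambda>z. f (- z)) z"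
  by (simp add: param_int_def uminus_prod_def)

lemma param_int_odd:
  assumes "\<And>z. f (- z) = - f z" shows "param_int \<phi> \<alpha> \<beta> f (- z) = - param_int \<phi> \<alpha> \<beta> f z"
  unfolding param_int_minus assms by (simp add: param_int_def)

text \<open>The origin is joined to (x, y) along the y axis and then horizontally. The quotient
  \<open>m\<close> on the axis depends on y only, so x m is a primitive in x. The quotients of an
  even function are odd, and their primitives, taken from the axes, are even.\<close>

lemma transport_solution:
  "\<exists>g1 g2. \<forall>x y. es_fun f (x, y) = es_fun f 0 + of_real x * pdy (es_fun g1) (x, y) + of_real y * pdx (es_fun g2) (x, y)"
proof -
  have c: "continuous_on UNIV (\<lambda>t::real. 1::real)" "continuous_on UNIV (\<lambda>t::real. t)" "continuous_on UNIV (\<lambda>t::real. 1::complex)"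
    "continuous_on UNIV (\<lambda>t::real. 0::real)"
    by (auto intro!: continuous_intros)
  let ?f = "es_fun f"
  have f: "smooth ?f" by (rule es_fun_smooth)
  have "(\<lambda>p. ?f (- p)) = ?f" by (simp only: es_fun_even)
  then have odd: "pdx ?f (- z) = - pdx ?f z" "pdy ?f (- z) = - pdy ?f z" for z
    using fun_cong[OF pd_minus(1)[OF f], of z] fun_cong[OF pd_minus(2)[OF f], of z] by simp_all
  define A where "A = param_int (\<lambda>t. 1) (\<lambda>t. t) (\<lambda>t. 1) (pdx ?f)"
  define m where "m = param_int (\<lambda>t. 1) (\<lambda>t. 0) (\<lambda>t. t) (pdy ?f)"
  have A: "smooth A" and m: "smooth m"
    unfolding A_def m_def by (intro smooth_param_int c smooth_pdx smooth_pdy f)+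
  have A_odd: "A (- z) = - A z" and m_odd: "m (- z) = - m z" for z
    unfolding A_def m_def by (intro param_int_odd odd)+
  define G where "G = (\<lambda>z. (case z of (x, y) \<Rightarrow> of_real y) * param_int (\<lambda>t. 1) (\<lambda>t. 1) (\<lambda>t. t) A z)"
  define H where "H = (\<lambda>z. (case z of (x, y) \<Rightarrow> of_real x) * m z)"
  have G: "smooth G" "pdy G = A" unfolding G_def by (rule antiderivative_y[OF A])+
  have neg: "(case - z of (x, y) \<Rightarrow> complex_of_real x) = - (case z of (x, y) \<Rightarrow> complex_of_real x)"
    "(case - z of (x, y) \<Rightarrow> complex_of_real y) = - (case z of (x, y) \<Rightarrow> complex_of_real y)" for z
    by (cases z; simp)+
  have "G (- z) = G z" for z
    unfolding G_def neg param_int_odd[of A, OF A_odd] by simp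
  then have eG: "es_fun (Abs_even_smooth G) = G" by (rule es_fun_Abs[OF G(1)])
  have H: "smooth H" unfolding H_def by (intro smooth_mult smooth_coords m)
  have "H (- z) = H z" for z
    unfolding H_def neg m_odd by simp
  then have eH: "es_fun (Abs_even_smooth H) = H" by (rule es_fun_Abs[OF H])
  have m_const: "m (x, y) = m (0, y)" for x y by (simp add: m_def param_int_def)
  have dH: "pdx H = m"
  proof (rule pdx_eqI)
    fix x y
    have "((\<lambda>t. of_real t * m (0, y)) has_vector_derivative m (0, y)) (at x)"
      by (auto intro!: derivative_eq_intros)
    moreover have "(\<lambda>t. H (t, y)) = (\<lambda>t. of_real t * m (0, y))"
      by (rule HOL.ext, simp only: H_def prod.case, subst m_const, rule refl)
    ultimately show "((\<lambda>t. H (t, y)) has_vector_derivative m (x, y)) (at x)"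
      by (simp only: m_const[of x y])
  qed
  have "?f (x, y) = ?f 0 + of_real x * A (x, y) + of_real y * m (x, y)" for x y
  proof -
    have h1: "?f (x, y) = ?f (0, y) + of_real x * A (x, y)"
      unfolding A_def by (rule hadamard_x[OF f])
    have "m (0, y) = param_int (\<lambda>t. 1) (\<lambda>t. 1) (\<lambda>t. t) (pdy ?f) (0, y)"
      by (simp add: m_def param_int_def)
    then have h2: "?f (0, y) = ?f (0, 0) + of_real y * m (0, y)"
      by (simp only: hadamard_y[OF f, of 0 y, symmetric])
    show ?thesis unfolding h1 h2 zero_prod_def m_const[of x y] by (simp only: add_ac)
  qed
  then have "\<forall>x y. ?f (x, y) = ?f 0 + of_real x * pdy (es_fun (Abs_even_smooth G)) (x, y) +
      of_real y * pdx (es_fun (Abs_even_smooth H)) (x, y)"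
    unfolding eG eH G(2) dH by blast
  then show ?thesis by blast
qed

subsection \<open>Jets\<close>

definition jet_eq :: "nat \<Rightarrow> plane_fun \<Rightarrow> plane_fun \<Rightarrow> bool" where
  "jet_eq N f g \<longleftrightarrow> (\<forall>i j. i + j \<le> N \<longrightarrow> partial i j f (0, 0) = partial i j g (0, 0))"

lemma dz_eq: "dz f = (\<lambda>p. 1/2 * pdx f p + (- \<i> / 2) * pdy f p)" "dzbar f = (\<lambda>p. 1/2 * pdx f p + (\<i> / 2) * pdy f p)"
  by (simp_all add: dz_def dzbar_def fun_eq_iff field_simps)

lemma smooth_dz: "smooth f \<Longrightarrow> smooth (dz f)" "smooth f \<Longrightarrow> smooth (dzbar f)"
  unfolding dz_eq by (intro smooth_add smooth_cmult smooth_pdx smooth_pdy; assumption)+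

lemma jet_eq_dz:
  assumes fg: "smooth f" "smooth g" and j: "jet_eq (Suc N) f g"
  shows "jet_eq N (dz f) (dz g)" "jet_eq N (dzbar f) (dzbar g)"
proof -
  have "partial i j (\<lambda>p. a * pdx f p + b * pdy f p) (0, 0) = partial i j (\<lambda>p. a * pdx g p + b * pdy g p) (0, 0)"
    if "i + j \<le> N" for i j a b
  proof -
    have "partial i j (\<lambda>p. a * pdx f p + b * pdy f p) = (\<lambda>p. a * partial (Suc i) j f p + b * partial i (Suc j) f p)"
      if "smooth f" for f
      using that by (subst partial_add) (simp_all add: smooth_cmult smooth_pdx smooth_pdy partial_cmult partial_Suc_left partial_Suc_right)
    then show ?thesis using j fg that by (simp add: jet_eq_def)
  qed
  then show "jet_eq N (dz f) (dz g)" "jet_eq N (dzbar f) (dzbar g)"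
    unfolding jet_eq_def dz_eq by blast+
qed

lemma jet_eq_funpow:
  assumes "smooth f" "smooth g" "jet_eq (N + l) f g"
  shows "jet_eq N ((dz ^^ l) f) ((dz ^^ l) g)" "jet_eq N ((dzbar ^^ l) f) ((dzbar ^^ l) g)"
  using assms
proof (induction l arbitrary: f g)
  case (Suc l)
  { case 1
    then show ?case using Suc.IH(1)[of "dz f" "dz g"] jet_eq_dz[of f g "N + l"]
      by (simp add: funpow_swap1 smooth_dz) }
  { case 2
    then show ?case using Suc.IH(2)[of "dzbar f" "dzbar g"] jet_eq_dz[of f g "N + l"]
      by (simp add: funpow_swap1 smooth_dz) }
qed simp_all

text \<open>An operator of order 2 k at the origin sees only the 2 k-jet, so \<open>f\<close> may be
  replaced by the polynomial.\<close>

lemma dz_dzbar_jet: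
  assumes f: "smooth f" and j: "\<forall>i j. i + j \<le> 2 * k \<longrightarrow> partial i j (poly_zz p) (0, 0) = partial i j f (0, 0)"
  shows "(dz ^^ k) ((dzbar ^^ k) f) (0, 0) = (fact k)\<^sup>2 * lookup p (k, k)"
proof -
  have s: "smooth ((dzbar ^^ k) f)" if "smooth f" for f using that by (induction k) (auto intro: smooth_dz)
  have "jet_eq (0 + k + k) (poly_zz p) f" using j by (simp add: jet_eq_def mult_2)
  then have "jet_eq 0 ((dz ^^ k) ((dzbar ^^ k) (poly_zz p))) ((dz ^^ k) ((dzbar ^^ k) f))"
    by (intro jet_eq_funpow s f smooth_poly_zz)
  then show ?thesis by (simp add: jet_eq_def dz_dzbar_poly_zz_0)
qed

subsection \<open>Dunkl--Weyl products\<close>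

lemma series_fun_const2: "series_fun (const2 p) = const2 (es_poly p)"
  by (rule fls2_eqI) (simp add: series_fun_nth const2_nth)

locale dunkl_star =
  fixes star :: "dunkl \<Rightarrow> dunkl \<Rightarrow> dunkl"
  assumes dunkl_weyl: "dunkl_weyl_product star"
begin

lemma star_add: "star (F + G) H = star F H + star G H" "star H (F + G) = star H F + star H G"
  and star_smult: "star (smult c F) G = smult c (star F G)" "star F (smult c G) = smult c (star F G)"
  and star_bounded: "dunkl_bounded S \<Longrightarrow> dunkl_bounded T \<Longrightarrow> dunkl_bounded {star F G | F G. F \<in> S \<and> G \<in> T}"
  using dunkl_weyl unfolding dunkl_weyl_product_def by blast+

lemma star_poly:
  assumes "even_poly f" "even_poly g"
  obtains h where "even_series h" "\<And>a b. map2 (\<lambda>p. lookup p (a, b)) h = nf (ordered gX gY f * ordered gX gY g) a b"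
    "star (const2 (es_poly f)) (const2 (es_poly g)) = series_fun h"
proof -
  obtain h where "even_series h" "series_spherical (const2 f) \<odot> series_spherical (const2 g) \<doteq> series_spherical h"
    "star (series_fun (const2 f)) (series_fun (const2 g)) = series_fun h"
    using dunkl_weyl assms unfolding dunkl_weyl_product_def by meson
  then show ?thesis using series_of_product[OF assms(2)] by (intro that[of h]) (auto simp: series_fun_const2)
qed

definition comm :: "dunkl \<Rightarrow> dunkl \<Rightarrow> dunkl" where
  "comm F G = star F G - star G F"

lemma comm_add: "comm (F + G) H = comm F H + comm G H" "comm H (F + G) = comm H F + comm H G"
  and comm_smult: "comm (smult c F) G = smult c (comm F G)" "comm F (smult c G) = smult c (comm F G)"
  by (simp_all add: comm_def star_add star_smult smult_diff)

lemma comm_bounded: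
  assumes "dunkl_bounded S" "dunkl_bounded T" shows "dunkl_bounded {comm F G | F G. F \<in> S \<and> G \<in> T}"
  by (rule dunkl_bounded_mono[OF dunkl_bounded_diff[OF star_bounded[OF assms] star_bounded[OF assms(2,1)]]])
    (auto simp: comm_def)

lemma comm_bounded_image:
  "dunkl_bounded S \<Longrightarrow> dunkl_bounded ((\<lambda>F. comm F G) ` S)" "dunkl_bounded S \<Longrightarrow> dunkl_bounded ((\<lambda>F. comm G F) ` S)"
  by (rule dunkl_bounded_mono[OF comm_bounded[of S "{G}"]]; auto simp: dunkl_bounded_finite)
    (rule dunkl_bounded_mono[OF comm_bounded[of "{G}" S]]; auto simp: dunkl_bounded_finite)

lemma phi_star_poly:
  assumes "even_poly f" "even_poly g"
  shows "phi (star (const2 (es_poly f)) (const2 (es_poly g))) = phiM (nf (ordered gX gY f * ordered gX gY g))"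
proof -
  obtain n where "finM n (nf (ordered gX gY f * ordered gX gY g))" using finM_nf by blast
  then show ?thesis using star_poly[OF assms] phi_series_fun by metis
qed

text \<open>Density is applied to one argument at a time; for two polynomials the claim is
  \<open>tracial_even\<close>.\<close>

lemma phi_comm: "phi (comm F G) = 0"
proof -
  have "phi (comm F (const2 (es_poly g))) = 0" if g: "even_poly g" for F g
  proof (rule functional_eq_0[of "\<lambda>F. phi (comm F (const2 (es_poly g)))"])
    show "kbounded ((\<lambda>F. phi (comm F (const2 (es_poly g)))) ` S)" if "dunkl_bounded S" for S
      using phi_bounded[OF comm_bounded_image(1)[OF that]] by (simp add: image_image)
    show "phi (comm (const2 (es_poly f)) (const2 (es_poly g))) = 0" if f: "even_poly f" for f
      using tracial_even[OF evenF_ordered_xy[OF f]] evenF_ordered_xy[OF g]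
      by (simp add: comm_def phi_minus phi_star_poly f g tracial_def)
  qed (simp_all add: comm_add comm_smult phi_add phi_smult)
  note poly = this
  show ?thesis
  proof (rule functional_eq_0[of "\<lambda>G. phi (comm F G)"])
    show "kbounded ((\<lambda>G. phi (comm F G)) ` S)" if "dunkl_bounded S" for S
      using phi_bounded[OF comm_bounded_image(2)[OF that]] by (simp add: image_image)
  qed (simp_all add: comm_add comm_smult phi_add phi_smult poly)
qed

lemma is_trace_phi: "is_trace star phi"
  using phi_comm by (simp add: is_trace_def phi_add phi_smult comm_def)

definition SX :: dunkl where "SX = const2 (es_poly sqX)"
definition SY :: dunkl where "SY = const2 (es_poly sqY)"

text \<open>Right minus left multiplication by x^2. For y^2 the order is reversed, which makes both
  leading terms positive.\<close>

lemma comm_SX_poly: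
  assumes p: "even_poly p"
  obtains q where "even_poly q" "comm (const2 (es_poly p)) SX $$ n $$ m = es_poly q"
    "\<And>a b. lookup q (a, b) = (RX (nf (ordered gX gY p)) a b - XO (XO (nf (ordered gX gY p))) a b) $$ n $$ m"
proof -
  obtain h where h: "even_series h" "\<And>a b. map2 (\<lambda>p. lookup p (a, b)) h = nf (ordered gX gY p * ordered gX gY sqX) a b"
    "star (const2 (es_poly p)) SX = series_fun h"
    unfolding SX_def by (rule star_poly[OF p even_sq(1)]) blast
  obtain h' where h': "even_series h'" "\<And>a b. map2 (\<lambda>p. lookup p (a, b)) h' = nf (ordered gX gY sqX * ordered gX gY p) a b"
    "star SX (const2 (es_poly p)) = series_fun h'"
    unfolding SX_def by (rule star_poly[OF even_sq(1) p]) blast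
  have "lookup (h $$ n $$ m) (a, b) = RX (nf (ordered gX gY p)) a b $$ n $$ m" for a b
    using h(2)[of a b] map2_nth[of "\<lambda>p. lookup p (a, b)" h n m] by (simp add: ordered_sq nf_times_gX_gX)
  moreover have "lookup (h' $$ n $$ m) (a, b) = XO (XO (nf (ordered gX gY p))) a b $$ n $$ m" for a b
    using h'(2)[of a b] map2_nth[of "\<lambda>p. lookup p (a, b)" h' n m] by (simp add: ordered_sq nf_gens mult.assoc)
  moreover have "even_poly (h $$ n $$ m)" "even_poly (h' $$ n $$ m)"
    using h(1) h'(1) by (auto simp: even_series_def)
  ultimately show ?thesis
    by (intro that[of "h $$ n $$ m - h' $$ n $$ m"])
      (simp_all add: comm_def h(3) h'(3) series_fun_nth es_poly_diff even_poly_diff lookup_minus)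
qed

lemma comm_SY_poly:
  assumes p: "even_poly p"
  obtains q where "even_poly q" "comm SY (const2 (es_poly p)) $$ n $$ m = es_poly q"
    "\<And>a b. lookup q (a, b) = (YO (YO (nf (ordered gX gY p))) a b - RY (nf (ordered gX gY p)) a b) $$ n $$ m"
proof -
  obtain h where h: "even_series h" "\<And>a b. map2 (\<lambda>p. lookup p (a, b)) h = nf (ordered gX gY p * ordered gX gY sqY) a b"
    "star (const2 (es_poly p)) SY = series_fun h"
    unfolding SY_def by (rule star_poly[OF p even_sq(2)]) blast
  obtain h' where h': "even_series h'" "\<And>a b. map2 (\<lambda>p. lookup p (a, b)) h' = nf (ordered gX gY sqY * ordered gX gY p) a b"
    "star SY (const2 (es_poly p)) = series_fun h'"
    unfolding SY_def by (rule star_poly[OF even_sq(2) p]) blast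
  have "lookup (h $$ n $$ m) (a, b) = RY (nf (ordered gX gY p)) a b $$ n $$ m" for a b
    using h(2)[of a b] map2_nth[of "\<lambda>p. lookup p (a, b)" h n m] by (simp add: ordered_sq nf_times_gY_gY)
  moreover have "lookup (h' $$ n $$ m) (a, b) = YO (YO (nf (ordered gX gY p))) a b $$ n $$ m" for a b
    using h'(2)[of a b] map2_nth[of "\<lambda>p. lookup p (a, b)" h' n m] by (simp add: ordered_sq nf_gens mult.assoc)
  moreover have "even_poly (h $$ n $$ m)" "even_poly (h' $$ n $$ m)"
    using h(1) h'(1) by (auto simp: even_series_def)
  ultimately show ?thesis
    by (intro that[of "h' $$ n $$ m - h $$ n $$ m"])
      (simp_all add: comm_def h(3) h'(3) series_fun_nth es_poly_diff even_poly_diff lookup_minus)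
qed

lemma dunkl_operator_comm_SX: "dunkl_operator (\<lambda>F. comm F SX)"
proof
  fix p and n m :: int assume p: "even_poly p" and nm: "(n, m) \<notin> {(0, 1), (0, 2), (1, 2)}"
  obtain q where q: "even_poly q" "comm (const2 (es_poly p)) SX $$ n $$ m = es_poly q"
    "\<And>a b. lookup q (a, b) = (RX (nf (ordered gX gY p)) a b - XO (XO (nf (ordered gX gY p))) a b) $$ n $$ m"
    by (rule comm_SX_poly[OF p]) blast
  have "q = 0"
  proof (rule poly2_eqI)
    fix a b
    have "(RX (nf (ordered gX gY p)) a b - XO (XO (nf (ordered gX gY p))) a b) $$ n $$ m = 0"
      using RX_components[where a=a and b=b and p=p] nm unfolding components_def by blast
    then show "lookup q (a, b) = lookup 0 (a, b)" unfolding q(3) by simp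
  qed
  then show "comm (const2 (es_poly p)) SX $$ n $$ m = 0" using q(2) by simp
qed (simp_all add: comm_add comm_smult comm_bounded_image)

lemma dunkl_operator_comm_SY: "dunkl_operator (comm SY)"
proof
  fix p and n m :: int assume p: "even_poly p" and nm: "(n, m) \<notin> {(0, 1), (0, 2), (1, 2)}"
  obtain q where q: "even_poly q" "comm SY (const2 (es_poly p)) $$ n $$ m = es_poly q"
    "\<And>a b. lookup q (a, b) = (YO (YO (nf (ordered gX gY p))) a b - RY (nf (ordered gX gY p)) a b) $$ n $$ m"
    by (rule comm_SY_poly[OF p]) blast
  have "q = 0"
  proof (rule poly2_eqI)
    fix a b
    have "(YO (YO (nf (ordered gX gY p))) a b - RY (nf (ordered gX gY p)) a b) $$ n $$ m = 0"
      using YO_components[where a=a and b=b and p=p] nm unfolding components_def by blast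
    then show "lookup q (a, b) = lookup 0 (a, b)" unfolding q(3) by simp
  qed
  then show "comm SY (const2 (es_poly p)) $$ n $$ m = 0" using q(2) by simp
qed (simp_all add: comm_add comm_smult comm_bounded_image[of _ SY, simplified])

lemma bounded_scaled_partial:
  assumes "es_bounded S" shows "bounded ((\<lambda>f. c * partial i j (es_fun f) z) ` S)"
  using bounded_es_eval[OF assms, of i j z] bounded_linear_image[OF _ bounded_linear_mult_right[of c]]
  by (fastforce simp: image_image)

lemma Q_SX: "es_fun (dunkl_operator.Q (\<lambda>F. comm F SX) 0 1 f) (x, y) = of_real x * pdy (es_fun f) (x, y)"
proof -
  interpret dunkl_operator "\<lambda>F. comm F SX" by (rule dunkl_operator_comm_SX)
  have pdy: "pdy g = partial 0 1 g" for g by (simp add: partial_def)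
  have "es_fun (Q 0 1 f) (x, y) = (\<lambda>f. of_real x * partial 0 1 (es_fun f) (x, y)) f"
  proof (rule Q_eqI)
    fix p assume p: "even_poly p"
    obtain q where q: "even_poly q" "comm (const2 (es_poly p)) SX $$ 0 $$ 1 = es_poly q"
      "\<And>a b. lookup q (a, b) = (RX (nf (ordered gX gY p)) a b - XO (XO (nf (ordered gX gY p))) a b) $$ 0 $$ 1"
      by (rule comm_SX_poly[OF p]) blast
    have "lookup q (a, b) = (case a of 0 \<Rightarrow> 0 | Suc a \<Rightarrow> lookup (dY p) (a, b))" for a b
      using RX_components[where a=a and b=b and p=p] unfolding components_def q(3)
      by (cases a) (simp_all add: lookup_dY)
    then have "eval2 q u v = u * eval2 (dY p) u v" for u v by (rule eval2_times_fst)
    then show "es_fun (Q 0 1 (es_poly p)) (x, y) = of_real x * partial 0 1 (es_fun (es_poly p)) (x, y)"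
      unfolding pdy[symmetric] Q_def q(2) es_fun_es_poly[OF p] es_fun_es_poly[OF q(1)] pd_poly_xy
      by (simp add: poly_xy_def)
  qed (simp_all add: partial_es_add partial_es_cmult bounded_scaled_partial distrib_left)
  then show ?thesis by (simp add: pdy)
qed

lemma Q_SY: "es_fun (dunkl_operator.Q (comm SY) 0 1 f) (x, y) = of_real y * pdx (es_fun f) (x, y)"
proof -
  interpret dunkl_operator "comm SY" by (rule dunkl_operator_comm_SY)
  have pdx: "pdx g = partial 1 0 g" for g by (simp add: partial_def)
  have "es_fun (Q 0 1 f) (x, y) = (\<lambda>f. of_real y * partial 1 0 (es_fun f) (x, y)) f"
  proof (rule Q_eqI)
    fix p assume p: "even_poly p"
    obtain q where q: "even_poly q" "comm SY (const2 (es_poly p)) $$ 0 $$ 1 = es_poly q"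
      "\<And>a b. lookup q (a, b) = (YO (YO (nf (ordered gX gY p))) a b - RY (nf (ordered gX gY p)) a b) $$ 0 $$ 1"
      by (rule comm_SY_poly[OF p]) blast
    have "lookup q (a, b) = (case b of 0 \<Rightarrow> 0 | Suc b \<Rightarrow> lookup (dX p) (a, b))" for a b
      using YO_components[where a=a and b=b and p=p] unfolding components_def q(3)
      by (cases b) (simp_all add: lookup_dX)
    then have "eval2 q u v = v * eval2 (dX p) u v" for u v by (rule eval2_times_snd)
    then show "es_fun (Q 0 1 (es_poly p)) (x, y) = of_real y * partial 1 0 (es_fun (es_poly p)) (x, y)"
      unfolding pdx[symmetric] Q_def q(2) es_fun_es_poly[OF p] es_fun_es_poly[OF q(1)] pd_poly_xy
      by (simp add: poly_xy_def)
  qed (simp_all add: partial_es_add partial_es_cmult bounded_scaled_partial distrib_left)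
  then show ?thesis by (simp add: pdx)
qed

lemma decomposition: "\<exists>c A B. F = smult c 1 + comm A SX + comm SY B"
proof (rule commutator_decomposition[OF dunkl_operator_comm_SX dunkl_operator_comm_SY])
  fix f
  obtain g1 g2 where g: "\<And>x y. es_fun f (x, y) = es_fun f 0 + of_real x * pdy (es_fun g1) (x, y) + of_real y * pdx (es_fun g2) (x, y)"
    using transport_solution by blast
  have "f = es_const (es_fun f 0) + dunkl_operator.Q (\<lambda>F. comm F SX) 0 1 g1 + dunkl_operator.Q (comm SY) 0 1 g2"
  proof (rule es_eqI)
    fix z :: "real \<times> real"
    obtain x y where z: "z = (x, y)" by (cases z)
    show "es_fun f z = es_fun (es_const (es_fun f 0) + dunkl_operator.Q (\<lambda>F. comm F SX) 0 1 g1 + dunkl_operator.Q (comm SY) 0 1 g2) z"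
      unfolding z es_fun_simps Q_SX Q_SY by (rule g)
  qed
  then show "\<exists>g1 g2. f = es_const (es_fun f 0) + dunkl_operator.Q (\<lambda>F. comm F SX) 0 1 g1 + dunkl_operator.Q (comm SY) 0 1 g2"
    by blast
qed

text \<open>A normalised trace can only take the value \<open>c\<close> of the
  decomposition.\<close>

lemma trace_unique:
  assumes "is_trace star \<psi>" "\<psi> 1 = 1" shows "\<psi> = phi"
proof
  fix F
  obtain c A B where F: "F = smult c 1 + comm A SX + comm SY B" using decomposition by blast
  have val: "\<tau> F = c" if "is_trace star \<tau>" "\<tau> 1 = 1" for \<tau>
    using that unfolding F comm_def is_trace_def by simp
  show "\<psi> F = phi F" using val[OF assms] val[OF is_trace_phi phi_1] by simp
qed

subsection \<open>The class of the unit\<close>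

text \<open>The trace is compared at exponent (0, 0). There it is a finite sum of derivatives at the
  origin, over a box common to all commutators of the bounded sequence, and these derivatives may be
  summed termwise by \<open>sums_partial\<close>.\<close>

lemma one_notin_boundaries: "1 \<notin> hochschild_boundaries star"
proof
  assume "1 \<in> hochschild_boundaries star"
  then obtain c a a' where c: "summable (\<lambda>i. cmod (c i))" and aa: "dunkl_bounded (range a)" "dunkl_bounded (range a')"
    and s: "\<And>n m p. (\<lambda>i. c i * es_fun (comm (a i) (a' i) $$ n $$ m) p) sums es_fun ((1 :: dunkl) $$ n $$ m) p"
    unfolding hochschild_boundaries_def comm_def by blast
  define D where "D = (\<lambda>i. comm (a i) (a' i))"
  have D: "dunkl_bounded (range D)"
    by (rule dunkl_bounded_mono[OF comm_bounded[OF aa]]) (auto simp: D_def)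
  obtain A M where box: "\<And>i. lower_box A M 0 (D i)"
    using dunkl_bounded_lower_box[OF D, of 0] by (metis rangeI)
  have zero: "(1 :: dunkl) $$ n $$ m = 0" if "\<And>i. D i $$ n $$ m = 0" for n m
  proof (rule es_eqI)
    fix p
    have "(\<lambda>i. 0) sums es_fun ((1 :: dunkl) $$ n $$ m) p"
      using s[of n m p] that by (simp add: D_def es_fun_simps)
    from sums_unique2[OF this sums_zero] show "es_fun ((1 :: dunkl) $$ n $$ m) p = es_fun 0 p"
      by (simp add: es_fun_simps)
  qed
  \<comment> \<open>The sum inherits the box of its terms, so that both sides use the same finite
    range.\<close>
  have box1: "lower_box A M 0 (1 :: dunkl)"
  proof (unfold lower_box_def, intro conjI allI impI)
    fix i :: int
    assume "i < A"
    then have "\<And>j k. D k $$ i $$ j = 0" using lower_boxD(1)[OF box] by simp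
    then show "(1 :: dunkl) $$ i = 0" by (intro fls_eqI) (simp only: zero fls_zero_nth)
  next
    fix i j :: int
    assume "i \<le> 0" "j < M"
    then show "(1 :: dunkl) $$ i $$ j = 0" by (intro zero) (rule lower_boxD(2)[OF box])
  qed
  have "(\<lambda>k. c k * theta (D k $$ i $$ j) p q) sums theta ((1 :: dunkl) $$ i $$ j) p q" for i j p q
  proof -
    let ?q = "nat q"
    have "(\<lambda>k. c k * partial ?q ?q (es_fun (D k $$ i $$ j)) (0, 0)) sums partial ?q ?q (es_fun ((1 :: dunkl) $$ i $$ j)) (0, 0)"
    proof (rule sums_partial[OF es_fun_smooth es_fun_smooth c])
      show "(\<lambda>k. c k * es_fun (D k $$ i $$ j) p) sums es_fun ((1 :: dunkl) $$ i $$ j) p" for p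
        unfolding D_def by (rule s)
      have "es_bounded ((\<lambda>F. F $$ i $$ j) ` range D)" using D unfolding dunkl_bounded_def by blast
      then show "\<exists>B. \<forall>k. \<forall>p\<in>K. cmod (partial l r (es_fun (D k $$ i $$ j)) p) \<le> B" if "compact K" for K l r
        unfolding es_bounded_iff using that by (simp add: image_image)
    qed
    from sums_mult[OF this, of "tau ?q $$ p $$ q / (fact ?q)\<^sup>2"] show ?thesis
      by (auto simp: theta_def field_simps)
  qed
  then have "(\<lambda>k. \<Sum>i=A..0. \<Sum>j=M..0. c k * theta (D k $$ i $$ j) (0 - i) (0 - j)) sums
      (\<Sum>i=A..0. \<Sum>j=M..0. theta ((1 :: dunkl) $$ i $$ j) (0 - i) (0 - j))"
    by (intro sums_sum)
  moreover have "(\<Sum>i=A..0. \<Sum>j=M..0. c k * theta (D k $$ i $$ j) (0 - i) (0 - j)) = 0" for k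
  proof -
    have "(\<Sum>i=A..0. \<Sum>j=M..0. c k * theta (D k $$ i $$ j) (0 - i) (0 - j)) = c k * phi (D k) $$ 0 $$ 0"
      unfolding phi_box[OF box order.refl order.refl] by (simp only: sum_distrib_left)
    then show ?thesis by (simp add: D_def phi_comm)
  qed
  moreover have "(\<Sum>i=A..0. \<Sum>j=M..0. theta ((1 :: dunkl) $$ i $$ j) (0 - i) (0 - j)) = 1"
    unfolding phi_box[OF box1 order.refl order.refl, symmetric] by (simp add: phi_1)
  ultimately have "(\<lambda>k. 0 :: complex) sums 1" by simp
  then show False using sums_unique2[OF sums_zero] by force
qed

lemma HH0_class_one: "HH0_class star 1 \<noteq> HH0_class star 0"
proof
  assume eq: "HH0_class star 1 = HH0_class star 0"
  have "0 \<in> hochschild_boundaries star"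
    unfolding hochschild_boundaries_def
    by (rule CollectI, intro exI[of _ "\<lambda>_. 0"]) (simp add: es_fun_simps dunkl_bounded_finite)
  then have "1 \<in> HH0_class star 1" by (simp add: HH0_class_def)
  then have "1 \<in> HH0_class star 0" unfolding eq .
  then show False using one_notin_boundaries by (simp add: HH0_class_def)
qed

end

subsection \<open>The formula\<close>

text \<open>At exponent m of \<open>hbar1\<close>, the coefficient of \<open>hbar1^j\<close> in
  \<open>F\<close> enters through a derivative of order 2 (m - j). Counting \<open>hbar1\<close>
  with degree 2 the total degree is 2 m, so \<open>represents\<close> is used with this
  order.\<close>

lemma phi_represents:
  assumes "represents f F"
  shows "phi F $$ n $$ m = (if m < 0 then 0 else
    (dz ^^ nat m) ((dzbar ^^ nat m) (es_fun f)) (0, 0) / (fact (nat m))\<^sup>2 *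
      ((iK * hbar1) ^ nat m * (\<Prod>l=1..nat m. rr l)) $$ n $$ m)"
proof -
  define N where "N = 2 * nat m"
  define Z where "Z = (\<lambda>k. (iK * hbar1) ^ k * (\<Prod>l=1..k. rr l))"
  obtain p h where p: "even_poly p" "even_series h"
    "\<And>i j. i + j \<le> N \<Longrightarrow> partial i j (poly_zz p) (0, 0) = partial i j (es_fun f) (0, 0)"
    "spherical (const2 (ordered gen_z gen_zbar p)) \<doteq> series_spherical h"
    "\<And>n m i j. int i + int j + 2 * m \<le> int N \<Longrightarrow>
       partial i j (es_fun (F $$ n $$ m)) (0, 0) = partial i j (es_fun (series_fun h $$ n $$ m)) (0, 0)"
    using assms unfolding represents_def by meson
  obtain A1 M1 A2 M2 where b: "lower_box A1 M1 n F" "lower_box A2 M2 n (series_fun h)"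
    using lower_box_exists by metis
  define A M where "A = min A1 A2" and "M = min M1 M2"
  have bF: "lower_box A M n F" and bh: "lower_box A M n (series_fun h)"
    using b by (auto simp: A_def M_def lower_box_def)
  have "theta (F $$ i $$ j) (n - i) (m - j) = theta (series_fun h $$ i $$ j) (n - i) (m - j)" if "j \<le> m" for i j
  proof -
    have "int (nat (m - j)) + int (nat (m - j)) + 2 * j \<le> int N"
      using that by (simp add: N_def)
    from p(5)[OF this, of i] show ?thesis by (simp add: theta_def)
  qed
  then have "phi F $$ n $$ m = phi (series_fun h) $$ n $$ m"
    unfolding phi_box[OF bF order.refl order.refl] phi_box[OF bh order.refl order.refl]
    by (intro sum.cong refl) simp
  also have "phi (series_fun h) = phiM (nf (ordered gen_z gen_zbar p))"
    using finM_nf[of "ordered gen_z gen_zbar p"] phi_series_fun[OF p(2) series_of_spherical[OF p(4)]] by blast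
  also have "\<dots> $$ n $$ m = (\<Sum>k\<in>Poly_Mapping.keys p. if fst k = snd k then lookup p k * Z (fst k) $$ n $$ m else 0)"
    unfolding phiM_nf_ordered_zz[OF p(1)] fls_sum_nth
    by (intro sum.cong refl) (simp add: const2_mult_nth Z_def)
  finally have phi: "phi F $$ n $$ m = \<dots>" .
  have Z: "pureK k (Z k)" for k
  proof (induction k)
    case 0
    then show ?case using pureK_const2[of 1] by (simp add: Z_def)
  next
    case (Suc k)
    have "pureK 1 hbar1" by (auto simp: pureK_def)
    then have "pureK (0 + 1 + 0 + k) (iK * hbar1 * rr (Suc k) * Z k)"
      unfolding iK_def by (intro pureK_mult pureK_const2 pureK_rr Suc)
    then show ?case by (simp add: Z_def ac_simps)
  qed
  show ?thesis
  proof (cases "m < 0")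
    case True
    then show ?thesis unfolding phi using Z by (auto simp: pureK_def intro!: sum.neutral)
  next
    case False
    define k where "k = nat m"
    have m: "m = int k" using False by (simp add: k_def)
    have "phi F $$ n $$ m = (\<Sum>l\<in>Poly_Mapping.keys p. if l = (k, k) then lookup p (k, k) * Z k $$ n $$ m else 0)"
      unfolding phi
    proof (intro sum.cong refl)
      fix l :: "nat \<times> nat"
      show "(if fst l = snd l then lookup p l * Z (fst l) $$ n $$ m else 0) = (if l = (k, k) then lookup p (k, k) * Z k $$ n $$ m else 0)"
        using Z[of "fst l"] by (cases l) (auto simp: pureK_def m)
    qed
    also have "\<dots> = lookup p (k, k) * Z k $$ n $$ m" by (simp add: in_keys_iff)
    also have "lookup p (k, k) = (dz ^^ k) ((dzbar ^^ k) (es_fun f)) (0, 0) / (fact k)\<^sup>2"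
      using dz_dzbar_jet[OF es_fun_smooth, of k p f] p(3) by (simp add: N_def m)
    finally show ?thesis using False by (simp add: k_def Z_def)
  qed
qed

theorem theorem2:
  fixes star :: "dunkl \<Rightarrow> dunkl \<Rightarrow> dunkl"
  assumes "dunkl_weyl_product star"
  shows "HH0_class star 1 \<noteq> HH0_class star 0 \<and>
    (\<exists>!\<phi>. is_trace star \<phi> \<and> \<phi> 1 = 1) \<and>
    (\<forall>\<phi>. is_trace star \<phi> \<and> \<phi> 1 = 1 \<longrightarrow>
      (\<forall>f F. represents f F \<longrightarrow>
        formal_sums
          (\<lambda>k. (const2 \<i> * hbar1) ^ k / (of_nat (fact k))\<^sup>2 *
               (\<Prod>l=1..k. of_nat l / 2 +
                  (- 1) ^ (l + 1) * (2 * of_int \<lfloor>(real l + 1) / 2\<rfloor> * hbar2) / (of_nat l + 1)) *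
               const2 ((dz ^^ k) ((dzbar ^^ k) (es_fun f)) (0, 0)))
          (\<phi> F)))"
proof -
  interpret dunkl_star star by standard (rule assms)
  have "formal_sums
          (\<lambda>k. (const2 \<i> * hbar1) ^ k / (of_nat (fact k))\<^sup>2 *
               (\<Prod>l=1..k. of_nat l / 2 +
                  (- 1) ^ (l + 1) * (2 * of_int \<lfloor>(real l + 1) / 2\<rfloor> * hbar2) / (of_nat l + 1)) *
               const2 ((dz ^^ k) ((dzbar ^^ k) (es_fun f)) (0, 0)))
          (phi F)" if rep: "represents f F" for f F
    unfolding formal_sums_def iK_def[symmetric] rr_def[symmetric]
  proof (intro allI)
    fix n m
    let ?d = "\<lambda>k. (dz ^^ k) ((dzbar ^^ k) (es_fun f)) (0, 0)"
    let ?Z = "\<lambda>k. (iK * hbar1) ^ k * (\<Prod>l=1..k. rr l)"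
    have term_eq: "(iK * hbar1) ^ k / (of_nat (fact k))\<^sup>2 * (\<Prod>l=1..k. rr l) * const2 (?d k) = const2 (?d k / (fact k)\<^sup>2) * ?Z k" for k
    proof -
      have "const2 (?d k / (fact k)\<^sup>2) * (of_nat (fact k))\<^sup>2 = const2 (?d k)"
        by (simp add: const2_of_nat[symmetric] power2_eq_square const2_mult[symmetric])
      moreover have "(of_nat (fact k) :: coeffs) \<noteq> 0" by simp
      ultimately show ?thesis by (simp add: field_simps)
    qed
    \<comment> \<open>\<open>iK * hbar1\<close> is a constant multiple of \<open>- hh\<close>, so
      homogeneity is inherited from \<open>tau\<close>.\<close>
    have pure: "?Z k $$ n $$ m = 0" if "m \<noteq> int k" for k
    proof -
      have "(iK * hbar1) ^ k * (\<Prod>l=1..k. rr l) = (- 2 * iK) ^ k * tau k"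
      proof -
        have "- 2 * iK * - hh = iK * hbar1" by (simp add: two_hh ac_simps)
        then show ?thesis
          unfolding tau_def by (simp only: mult.assoc[symmetric] power_mult_distrib[symmetric])
      qed
      moreover have "pureK (0 + k) ((- 2 * iK) ^ k * tau k)"
      proof (rule pureK_mult[OF _ pureK_tau])
        have "- 2 * iK = const2 (- 2 * \<i>)" by (simp add: iK_def const2_mult const2_uminus const2_numeral)
        then show "pureK 0 ((- 2 * iK) ^ k)"
          using pureK_const2 pureK_mult[of 0 _ 0] by (induction k) (use pureK_const2[of 1] in auto)
      qed
      ultimately show ?thesis using that by (simp add: pureK_def)
    qed
    \<comment> \<open>At a given exponent m of \<open>hbar1\<close> at most one term of the series
      is nonzero, the one with k = m.\<close>
    have "(\<lambda>k. if k = nat m then (if m < 0 then 0 else ?d k / (fact k)\<^sup>2 * ?Z k $$ n $$ m) else 0) sums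
        (if m < 0 then 0 else ?d (nat m) / (fact (nat m))\<^sup>2 * ?Z (nat m) $$ n $$ m)"
      by (rule sums_single)
    moreover have "(if k = nat m then (if m < 0 then 0 else ?d k / (fact k)\<^sup>2 * ?Z k $$ n $$ m) else 0) =
        (const2 (?d k / (fact k)\<^sup>2) * ?Z k) $$ n $$ m" for k
      using pure[of k] by (auto simp: const2_mult_nth)
    ultimately show "(\<lambda>k. ((iK * hbar1) ^ k / (of_nat (fact k))\<^sup>2 * (\<Prod>l=1..k. rr l) * const2 (?d k)) $$ n $$ m) sums
        (phi F $$ n $$ m)"
      unfolding term_eq phi_represents[OF rep] by simp
  qed
  moreover have "\<exists>!\<phi>. is_trace star \<phi> \<and> \<phi> 1 = 1"
    using is_trace_phi phi_1 trace_unique by blast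
  ultimately show ?thesis using HH0_class_one trace_unique by blast
qed

end
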